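(* Let $s\ge1$ be a given integer, and suppose that $u\in H^s(\Omega)\cap\dot H^1_0(\Omega)$. If $d(x)>0$ for $x\in\Omega$, $d\in H^r(\Omega)$ with $r=\max(s-1,3)$, and $d$ is the distance function to $\partial\Omega$ near $\partial\Omega$, then $\dfrac ud\in H^{s-1}(\Omega)$ and $$\Big\|\frac ud\Big\|_{s-1}\le C\|u\|_s ,$$ where $C$ is a constant independent of $u$.
   Context: $\Omega=\mathbb T^2\times(0,1)\subset\mathbb R^3$, i.e. functions are $1$-periodic in $x_1,x_2$, and $\partial\Omega=\Gamma=\{x_3=0\}\cup\{x_3=1\}$. $\|\cdot\|_s$ denotes the $H^s(\Omega)$-norm. $\dot H^1_0(\Omega)=\{u\in H^1(\Omega): u=0\text{ on }\Gamma\text{ (in the sense of trace)},\ (x_1,x_2)\mapsto u(x_1,x_2)\text{ is periodic}\}$. *)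

theory Defs
  imports "HOL-Analysis.Analysis"
begin

text \<open>
  Functions on \<open>\<Omega> = T\<^sup>2 \<times> (0,1)\<close> are represented by functions on \<open>\<real>\<^sup>3\<close> whose restriction to the
  covering slab \<open>\<real>\<^sup>2 \<times> (0,1)\<close> is 1-periodic in the first two variables; values outside the slab
  are irrelevant.  Integrals over \<open>\<Omega>\<close> are integrals over a fundamental domain.
\<close>

definition slab :: "(real^3) set" where
  "slab = {x. 0 < x$3 \<and> x$3 < 1}"

definition Gam :: "(real^3) set" where
  "Gam = {x. x$3 = 0} \<union> {x. x$3 = 1}"

definition cell :: "(real^3) set" where
  "cell = {x \<in> slab. 0 \<le> x$1 \<and> x$1 < 1 \<and> 0 \<le> x$2 \<and> x$2 < 1}"

definition square :: "(real^2) set" where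
  "square = {y. 0 \<le> y$1 \<and> y$1 < 1 \<and> 0 \<le> y$2 \<and> y$2 < 1}"

definition periodic_on :: "(real^3) set \<Rightarrow> (real^3 \<Rightarrow> real) \<Rightarrow> bool" where
  "periodic_on A f \<longleftrightarrow> (\<forall>x\<in>A. f (x + axis 1 1) = f x \<and> f (x + axis 2 1) = f x)"

definition partial_deriv :: "3 \<Rightarrow> (real^3 \<Rightarrow> real) \<Rightarrow> real^3 \<Rightarrow> real" where
  "partial_deriv i f = (\<lambda>x. frechet_derivative f (at x) (axis i 1))"

primrec Ck :: "nat \<Rightarrow> (real^3 \<Rightarrow> real) \<Rightarrow> bool" where
  "Ck 0 f \<longleftrightarrow> continuous_on UNIV f"
| "Ck (Suc k) f \<longleftrightarrow> (\<forall>x. f differentiable (at x)) \<and> (\<forall>i. Ck k (partial_deriv i f))"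

definition smooth :: "(real^3 \<Rightarrow> real) \<Rightarrow> bool" where
  "smooth f \<longleftrightarrow> (\<forall>k. Ck k f)"

definition mi_order :: "nat^3 \<Rightarrow> nat" where
  "mi_order \<alpha> = (\<Sum>i\<in>UNIV. \<alpha>$i)"

definition multi_deriv :: "nat^3 \<Rightarrow> (real^3 \<Rightarrow> real) \<Rightarrow> real^3 \<Rightarrow> real" where
  "multi_deriv \<alpha> f =
     (partial_deriv 1 ^^ (\<alpha>$1)) ((partial_deriv 2 ^^ (\<alpha>$2)) ((partial_deriv 3 ^^ (\<alpha>$3)) f))"

text \<open>
  \<open>C\<^sub>c\<^sup>\<infinity>(\<Omega>)\<close>: as \<open>T\<^sup>2\<close> is compact, compact support in \<open>\<Omega>\<close> only restricts the third variable.
\<close>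

definition test_function :: "(real^3 \<Rightarrow> real) \<Rightarrow> bool" where
  "test_function \<phi> \<longleftrightarrow> smooth \<phi> \<and> periodic_on UNIV \<phi> \<and>
     (\<exists>\<epsilon>>0. \<forall>x. x$3 < \<epsilon> \<or> 1 - \<epsilon> < x$3 \<longrightarrow> \<phi> x = 0)"

definition L2 :: "(real^3 \<Rightarrow> real) set" where
  "L2 = {f. periodic_on slab f \<and> f \<in> borel_measurable (lebesgue_on cell) \<and>
            integrable (lebesgue_on cell) (\<lambda>x. (f x)\<^sup>2)}"

definition is_weak_deriv :: "nat^3 \<Rightarrow> (real^3 \<Rightarrow> real) \<Rightarrow> (real^3 \<Rightarrow> real) \<Rightarrow> bool" where
  "is_weak_deriv \<alpha> u v \<longleftrightarrow>
     (\<forall>\<phi>. test_function \<phi> \<longrightarrow>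
        (\<integral>x. u x * multi_deriv \<alpha> \<phi> x \<partial>lebesgue_on cell) =
        (-1) ^ mi_order \<alpha> * (\<integral>x. v x * \<phi> x \<partial>lebesgue_on cell))"

definition sobolev :: "nat \<Rightarrow> (real^3 \<Rightarrow> real) set" where
  "sobolev s = {u \<in> L2. \<forall>\<alpha>. mi_order \<alpha> \<le> s \<longrightarrow> (\<exists>v\<in>L2. is_weak_deriv \<alpha> u v)}"

text \<open>Weak derivatives are unique up to null sets, so the norm does not depend on the choice.\<close>

definition weak_deriv :: "nat^3 \<Rightarrow> (real^3 \<Rightarrow> real) \<Rightarrow> real^3 \<Rightarrow> real" where
  "weak_deriv \<alpha> u = (SOME v. v \<in> L2 \<and> is_weak_deriv \<alpha> u v)"

definition sobolev_norm :: "nat \<Rightarrow> (real^3 \<Rightarrow> real) \<Rightarrow> real" where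
  "sobolev_norm s u =
     sqrt (\<Sum>\<alpha> | mi_order \<alpha> \<le> s. \<integral>x. (weak_deriv \<alpha> u x)\<^sup>2 \<partial>lebesgue_on cell)"

lemma finite_mi_order_le: "finite {\<alpha>. mi_order \<alpha> \<le> s}"
proof -
  have "{\<alpha>. mi_order \<alpha> \<le> s} \<subseteq> vec_lambda ` (Pi\<^sub>E UNIV (\<lambda>_. {..s}))"
  proof
    fix \<alpha> :: "nat^3"
    assume "\<alpha> \<in> {\<alpha>. mi_order \<alpha> \<le> s}"
    then have "\<alpha>$i \<le> s" for i
      using member_le_sum[of i UNIV "\<lambda>i. \<alpha>$i"] by (simp add: mi_order_def)
    then show "\<alpha> \<in> vec_lambda ` (Pi\<^sub>E UNIV (\<lambda>_. {..s}))"
      by (intro image_eqI[where x = "\<lambda>i. \<alpha>$i"]) auto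
  qed
  then show ?thesis
    by (rule finite_subset) (intro finite_imageI finite_PiE, auto)
qed

text \<open>
  The trace \<open>H\<^sup>1(\<Omega>) \<rightarrow> L\<^sup>2(\<Gamma>)\<close> is the continuous extension of the restriction map on \<open>C\<^sup>\<infinity>\<close> functions
  on the closure of \<open>\<Omega>\<close>; its graph is the closure of the graph of that map.
\<close>

definition L2_bdry :: "(real^3 \<Rightarrow> real) set" where
  "L2_bdry = {g. \<forall>c\<in>{0, 1}.
     (\<lambda>y::real^2. g (vector [y$1, y$2, c])) \<in> borel_measurable (lebesgue_on square) \<and>
     integrable (lebesgue_on square) (\<lambda>y. (g (vector [y$1, y$2, c]))\<^sup>2)}"

definition bdry_norm :: "(real^3 \<Rightarrow> real) \<Rightarrow> real" where
  "bdry_norm g =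
     sqrt (\<Sum>c\<in>{0, 1}. \<integral>y. (g (vector [y$1, y$2, c]))\<^sup>2 \<partial>lebesgue_on square)"

definition has_trace :: "(real^3 \<Rightarrow> real) \<Rightarrow> (real^3 \<Rightarrow> real) \<Rightarrow> bool" where
  "has_trace u g \<longleftrightarrow> u \<in> sobolev 1 \<and> g \<in> L2_bdry \<and>
     (\<exists>w :: nat \<Rightarrow> real^3 \<Rightarrow> real.
        (\<forall>n. smooth (w n) \<and> periodic_on UNIV (w n)) \<and>
        (\<lambda>n. sobolev_norm 1 (\<lambda>x. w n x - u x)) \<longlonglongrightarrow> 0 \<and>
        (\<lambda>n. bdry_norm (\<lambda>x. w n x - g x)) \<longlonglongrightarrow> 0)"

definition H10 :: "(real^3 \<Rightarrow> real) set" where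
  "H10 = {u \<in> sobolev 1. has_trace u (\<lambda>_. 0)}"

definition is_distance_near_bdry :: "(real^3 \<Rightarrow> real) \<Rightarrow> bool" where
  "is_distance_near_bdry d \<longleftrightarrow>
     (\<exists>\<epsilon>>0. \<forall>x\<in>slab. infdist x Gam < \<epsilon> \<longrightarrow> d x = infdist x Gam)"

end

theory Submission
  imports Defs
begin

text \<open>
  If \<open>u\<close> vanishes on \<open>x\<^sub>3 = c\<close> then \<open>u / (x\<^sub>3 - c)\<close> is the average of \<open>\<partial>\<^sub>3 u\<close> over the vertical segment joining
  \<open>x\<close> to that face, that is, the integral over \<open>\<theta> \<in> (0,1)\<close> of \<open>\<partial>\<^sub>3 u\<close> composed with a vertical contraction.
  Each derivative of such an average is again an average, with weight \<open>\<theta>\<^sup>a\<close>, so that Hardy's inequality bounds all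
  derivatives at once, and \<open>w = u / x\<^sub>3 - u / (x\<^sub>3 - 1) = u / (x\<^sub>3 (1 - x\<^sub>3))\<close> has \<open>s - 1\<close> weak derivatives.

  It remains to multiply \<open>w\<close> by \<open>g = x\<^sub>3 (1 - x\<^sub>3) / d\<close>. Near the boundary \<open>g\<close> is a polynomial, and away from it
  \<open>d\<close> is bounded below, so \<open>g\<close> is a smooth function divided by a function which lies in the same Sobolev
  space as \<open>d\<close> and is bounded below. As second order Sobolev functions of three variables are bounded, in every term
  of the Leibniz rule for \<open>w g\<close> and in the chain rule for a reciprocal at most one factor is unbounded.

  All facts about weak derivatives are obtained by duality, moving translations, dilations and difference quotients
  to the test function; no mollification is involved.
\<close>

section \<open>Smooth functions\<close>

text \<open>\<open>u\<close> loses exactly one derivative: the averages act on its vertical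
  derivative, which has \<open>s - 1\<close> weak derivatives, and averaging costs only a constant.
  Since \<open>d\<close> vanishes at both faces while an average deals with one, the two are joined
  by the partial fractions of 1 / (t (1 - t)), without cutting \<open>u\<close> off near the faces.

  The product is governed by a count. With \<open>k = s - 1\<close>, the derivatives of
  \<open>w\<close> of order below \<open>k - 1\<close> and those of \<open>g\<close> of order below
  \<open>r - 1\<close> are bounded. A Leibniz term with two unbounded factors would have order at
  least (k - 1) + (r - 1), which exceeds \<open>k\<close> as soon as \<open>r\<close> is at least 3;
  this is what the 3 in the regularity of \<open>d\<close> provides.

  A further obstacle is that \<open>u\<close>, \<open>d\<close> and the derivatives chosen by
  \<open>weak_deriv\<close> are known only up to null sets. The analysis is therefore done for
  Borel, periodic representatives vanishing outside the slab, measured by explicit bounds instead of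
  Sobolev norms, with a translation to and from \<open>sobolev\<close> at the ends.\<close>

lemma partial_deriv_eq:
  assumes "(f has_derivative f') (at x)"
  shows "partial_deriv i f x = f' (axis i 1)"
  unfolding partial_deriv_def using frechet_derivative_at[OF assms] by simp

lemma partial_deriv_add:
  assumes "f differentiable (at x)" "g differentiable (at x)"
  shows "partial_deriv i (\<lambda>x. f x + g x) x = partial_deriv i f x + partial_deriv i g x"
  using has_derivative_add[OF assms[unfolded frechet_derivative_works]]
  by (subst partial_deriv_eq) (auto simp: partial_deriv_def)

lemma partial_deriv_mult:
  assumes "f differentiable (at x)" "g differentiable (at x)"
  shows "partial_deriv i (\<lambda>x. f x * g x) x = f x * partial_deriv i g x + partial_deriv i f x * g x"
  using has_derivative_mult[OF assms[unfolded frechet_derivative_works]]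
  by (subst partial_deriv_eq) (auto simp: partial_deriv_def)

lemma partial_deriv_compose:
  fixes F :: "real \<Rightarrow> real"
  assumes "f differentiable (at x)" "(F has_real_derivative F') (at (f x))"
  shows "partial_deriv i (\<lambda>x. F (f x)) x = F' * partial_deriv i f x"
proof -
  have "((\<lambda>x. F (f x)) has_derivative (\<lambda>h. F' * frechet_derivative f (at x) h)) (at x)"
    using has_derivative_compose[OF assms(1)[unfolded frechet_derivative_works]
      assms(2)[unfolded has_field_derivative_def]] by simp
  then show ?thesis by (subst partial_deriv_eq) (auto simp: partial_deriv_def)
qed

text \<open>Unit translations, shifts of test functions, dilations and vertical contractions are all
  of this form, so one chain rule and one change of variables serve them all.\<close>

definition diag_affine :: "real^3 \<Rightarrow> real^3 \<Rightarrow> real^3 \<Rightarrow> real^3" where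
  "diag_affine b l x = (\<chi> i. b$i + l$i * x$i)"

lemma diag_affine_nth [simp]: "diag_affine b l x $ i = b$i + l$i * x$i"
  by (simp add: diag_affine_def)

lemma has_derivative_diag_affine:
  "(diag_affine b l has_derivative (\<lambda>h. \<chi> i. l$i * h$i)) (at x)"
proof -
  have "bounded_linear (\<lambda>h::real^3. (\<chi> i. l$i * h$i))"
    by (intro linear_conv_bounded_linear[THEN iffD1] linearI) (auto simp: vec_eq_iff algebra_simps)
  then have "((\<lambda>x. b + (\<chi> i. l$i * x$i)) has_derivative (\<lambda>h. \<chi> i. l$i * h$i)) (at x)"
    by (auto intro!: derivative_eq_intros bounded_linear_imp_has_derivative)
  moreover have "(\<lambda>x. b + (\<chi> i. l$i * x$i)) = diag_affine b l"
    by (auto simp: fun_eq_iff vec_eq_iff)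
  ultimately show ?thesis by simp
qed

lemma partial_deriv_diag_affine:
  assumes "f differentiable (at (diag_affine b l x))"
  shows "partial_deriv i (\<lambda>x. f (diag_affine b l x)) x = l$i * partial_deriv i f (diag_affine b l x)"
proof -
  let ?D = "frechet_derivative f (at (diag_affine b l x))"
  have D: "(f has_derivative ?D) (at (diag_affine b l x))"
    using assms by (simp add: frechet_derivative_works)
  have "partial_deriv i (\<lambda>x. f (diag_affine b l x)) x = ?D (\<chi> j. l$j * axis i 1 $ j)"
    by (rule partial_deriv_eq) (rule has_derivative_compose[OF has_derivative_diag_affine D])
  also have "(\<chi> j. l$j * axis i 1 $ j) = l$i *\<^sub>R axis i (1::real)"
    by (auto simp: vec_eq_iff axis_def)
  also have "?D (l$i *\<^sub>R axis i 1) = l$i * ?D (axis i 1)"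
    using linear_scale[OF has_derivative_linear[OF D]] by simp
  finally show ?thesis by (simp add: partial_deriv_def)
qed

section \<open>Closure properties of smooth functions\<close>

lemma Ck_SucD: "Ck (Suc k) f \<Longrightarrow> Ck k f"
proof (induction k arbitrary: f)
  case 0
  then show ?case
    by (auto simp: continuous_on_eq_continuous_at intro: differentiable_imp_continuous_within)
next
  case (Suc k)
  then show ?case by simp
qed

lemma Ck_const: "Ck k (\<lambda>x. c)"
proof (induction k arbitrary: c)
  case (Suc k)
  have "partial_deriv i (\<lambda>x. c) = (\<lambda>x. 0)" for i
    by (intro ext) (simp add: partial_deriv_eq[OF has_derivative_const])
  with Suc show ?case by simp
qed simp

lemma Ck_nth: "Ck k (\<lambda>x. x$i)"
proof (cases k)
  case (Suc k')
  have D: "((\<lambda>x::real^3. x$i) has_derivative (\<lambda>h. h$i)) (at x)" for x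
    by (intro bounded_linear_imp_has_derivative bounded_linear_vec_nth)
  have "partial_deriv j (\<lambda>x. x$i) = (\<lambda>x. axis j 1 $ i)" for j
    by (intro ext) (simp add: partial_deriv_eq[OF D])
  then show ?thesis using Suc D by (auto simp: Ck_const differentiable_def)
qed (auto intro: continuous_intros)

lemma Ck_add: "Ck k f \<Longrightarrow> Ck k g \<Longrightarrow> Ck k (\<lambda>x. f x + g x)"
proof (induction k arbitrary: f g)
  case (Suc k)
  have "partial_deriv i (\<lambda>x. f x + g x) = (\<lambda>x. partial_deriv i f x + partial_deriv i g x)" for i
    using Suc.prems by (intro ext partial_deriv_add) auto
  with Suc show ?case by auto
qed (auto intro: continuous_intros)

lemma Ck_mult: "Ck k f \<Longrightarrow> Ck k g \<Longrightarrow> Ck k (\<lambda>x. f x * g x)"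
proof (induction k arbitrary: f g)
  case (Suc k)
  have "partial_deriv i (\<lambda>x. f x * g x) = (\<lambda>x. f x * partial_deriv i g x + partial_deriv i f x * g x)" for i
    using Suc.prems by (intro ext partial_deriv_mult) auto
  moreover have "Ck k f" "Ck k g"
    using Suc.prems by (auto intro: Ck_SucD simp del: Ck.simps)
  ultimately show ?case
    using Suc by (auto intro!: Ck_add)
qed (auto intro: continuous_intros)

text \<open>The outer function is given by the whole sequence of its derivatives: the chain rule
  turns \<open>F n\<close> into \<open>F (Suc n)\<close>, so the induction on \<open>k\<close> has
  to range over all \<open>n\<close>.\<close>

lemma Ck_compose:
  fixes F :: "nat \<Rightarrow> real \<Rightarrow> real"
  assumes F: "\<And>n x. (F n has_real_derivative F (Suc n) x) (at x)"
  shows "Ck k f \<Longrightarrow> Ck k (\<lambda>x. F n (f x))"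
proof (induction k arbitrary: n)
  case 0
  have "continuous_on UNIV (F n)"
    using F by (auto simp: continuous_on_eq_continuous_at intro: DERIV_isCont)
  with 0 show ?case by (auto intro: continuous_on_compose2[of UNIV "F n"])
next
  case (Suc k)
  have "partial_deriv i (\<lambda>x. F n (f x)) = (\<lambda>x. F (Suc n) (f x) * partial_deriv i f x)" for i
    using Suc.prems F by (intro ext partial_deriv_compose) auto
  moreover have "(\<lambda>x. F n (f x)) differentiable (at x)" for x
  proof -
    have "f differentiable (at x)" using Suc.prems by simp
    then obtain D where "(f has_derivative D) (at x)" by (auto simp: differentiable_def)
    from has_derivative_compose[OF this F[unfolded has_field_derivative_def]]
    show ?thesis by (auto simp: differentiable_def)
  qed
  moreover have "Ck k f"
    using Suc.prems by (rule Ck_SucD)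
  ultimately show ?case using Suc by (auto intro!: Ck_mult)
qed

lemma Ck_diag_affine: "Ck k f \<Longrightarrow> Ck k (\<lambda>x. f (diag_affine b l x))"
proof (induction k arbitrary: f)
  case 0
  have "continuous_on UNIV (diag_affine b l)"
    by (auto simp: continuous_on_eq_continuous_at intro: has_derivative_continuous has_derivative_diag_affine)
  with 0 show ?case by (auto intro: continuous_on_compose2[of UNIV f])
next
  case (Suc k)
  have "partial_deriv i (\<lambda>x. f (diag_affine b l x)) = (\<lambda>x. l$i * partial_deriv i f (diag_affine b l x))" for i
    using Suc.prems by (intro ext partial_deriv_diag_affine) auto
  moreover have "(\<lambda>x. f (diag_affine b l x)) differentiable (at x)" for x
  proof -
    have "f differentiable (at (diag_affine b l x))" using Suc.prems by simp
    then obtain D where "(f has_derivative D) (at (diag_affine b l x))" by (auto simp: differentiable_def)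
    from has_derivative_compose[OF has_derivative_diag_affine this]
    show ?thesis by (auto simp: differentiable_def)
  qed
  ultimately show ?case using Suc by (auto intro!: Ck_mult Ck_const)
qed

lemma smooth_const: "smooth (\<lambda>x. c)"
  and smooth_nth: "smooth (\<lambda>x. x$i)"
  and smooth_add: "smooth f \<Longrightarrow> smooth g \<Longrightarrow> smooth (\<lambda>x. f x + g x)"
  and smooth_mult: "smooth f \<Longrightarrow> smooth g \<Longrightarrow> smooth (\<lambda>x. f x * g x)"
  and smooth_diag_affine: "smooth f \<Longrightarrow> smooth (\<lambda>x. f (diag_affine b l x))"
  by (simp_all add: smooth_def Ck_const Ck_nth Ck_add Ck_mult Ck_diag_affine)

lemma smooth_compose:
  fixes F :: "nat \<Rightarrow> real \<Rightarrow> real"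
  assumes "\<And>n x. (F n has_real_derivative F (Suc n) x) (at x)" "smooth f"
  shows "smooth (\<lambda>x. F n (f x))"
  using assms Ck_compose[of F] by (auto simp: smooth_def)

lemma smooth_diff: "smooth f \<Longrightarrow> smooth g \<Longrightarrow> smooth (\<lambda>x. f x - g x)"
  using smooth_add[of f "\<lambda>x. (-1) * g x"] smooth_mult[of "\<lambda>x. -1" g] smooth_const by auto

lemma smooth_prod:
  "finite I \<Longrightarrow> (\<And>i. i \<in> I \<Longrightarrow> smooth (f i)) \<Longrightarrow> smooth (\<lambda>x. \<Prod>i\<in>I. f i x)"
  by (induction I rule: finite_induct) (auto intro: smooth_mult smooth_const)

lemma smooth_partial_deriv: "smooth f \<Longrightarrow> smooth (partial_deriv i f)"
  unfolding smooth_def by (metis Ck.simps(2))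

lemma smooth_differentiable: "smooth f \<Longrightarrow> f differentiable (at x)"
  unfolding smooth_def by (metis Ck.simps(2))

lemma smooth_continuous: "smooth f \<Longrightarrow> continuous_on UNIV f"
  unfolding smooth_def by (metis Ck.simps(1))

lemma smooth_borel: "smooth f \<Longrightarrow> f \<in> borel_measurable borel"
  by (intro borel_measurable_continuous_onI smooth_continuous)

section \<open>Derivatives along lines and symmetry of mixed derivatives\<close>

lemma smooth_line_deriv_general:
  assumes "smooth f"
  shows "((\<lambda>t. f (x + t *\<^sub>R z)) has_real_derivative (\<Sum>i\<in>UNIV. z$i * partial_deriv i f (x + t *\<^sub>R z))) (at t)"
proof -
  let ?y = "x + t *\<^sub>R z"
  have D: "(f has_derivative frechet_derivative f (at ?y)) (at ?y)"
    using smooth_differentiable[OF assms] by (simp add: frechet_derivative_works)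
  have "((\<lambda>t. x + t *\<^sub>R z) has_derivative (\<lambda>h. h *\<^sub>R z)) (at t)"
    by (auto intro!: derivative_eq_intros)
  from has_derivative_compose[OF this D]
  have "((\<lambda>t. f (x + t *\<^sub>R z)) has_derivative (\<lambda>h. frechet_derivative f (at ?y) (h *\<^sub>R z))) (at t)" .
  moreover have "frechet_derivative f (at ?y) (h *\<^sub>R z) = (\<Sum>i\<in>UNIV. z$i * partial_deriv i f ?y) * h" for h
  proof -
    note lin = has_derivative_linear[OF D]
    have "z = (\<Sum>i\<in>UNIV. z$i *\<^sub>R axis i 1)"
      by (simp add: basis_expansion scalar_mult_eq_scaleR[symmetric])
    then have "frechet_derivative f (at ?y) z = (\<Sum>i\<in>UNIV. z$i * partial_deriv i f ?y)"
      using linear_sum[OF lin, of "\<lambda>i. z$i *\<^sub>R axis i 1" UNIV] linear_scale[OF lin]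
      by (simp add: partial_deriv_def)
    then show ?thesis using linear_scale[OF lin] by simp
  qed
  ultimately show ?thesis by (simp add: has_field_derivative_def)
qed

lemma sum_axis_mult: "(\<Sum>j\<in>UNIV. axis i 1 $ j * y j) = (y i :: real)"
proof -
  have "axis i 1 $ j * y j = (if i = j then y j else 0)" for j by (simp add: axis_def)
  then show ?thesis by simp
qed

lemma smooth_line_deriv:
  assumes "smooth f"
  shows "((\<lambda>t. f (x + t *\<^sub>R axis i 1)) has_real_derivative partial_deriv i f (x + t *\<^sub>R axis i 1)) (at t)"
  using smooth_line_deriv_general[OF assms, of x "axis i 1" t] by (simp only: sum_axis_mult)

text \<open>The mean value theorem is applied in direction \<open>i\<close> to a difference in
  direction \<open>j\<close>, then in direction \<open>j\<close>. The left side is symmetric in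
  \<open>i\<close> and \<open>j\<close> but the right side is not, and this asymmetry yields the
  symmetry of mixed derivatives.\<close>

lemma second_difference_mvt:
  assumes f: "smooth f" and h: "h > 0"
  shows "\<exists>s t. 0 < s \<and> s < h \<and> 0 < t \<and> t < h \<and>
    f (x + h *\<^sub>R axis i 1 + h *\<^sub>R axis j 1) - f (x + h *\<^sub>R axis i 1) - f (x + h *\<^sub>R axis j 1) + f x
      = h * h * partial_deriv j (partial_deriv i f) (x + s *\<^sub>R axis i 1 + t *\<^sub>R axis j 1)"
proof -
  let ?g = "\<lambda>s. f (x + h *\<^sub>R axis j 1 + s *\<^sub>R axis i 1) - f (x + s *\<^sub>R axis i 1)"
  let ?g' = "\<lambda>s. partial_deriv i f (x + h *\<^sub>R axis j 1 + s *\<^sub>R axis i 1) - partial_deriv i f (x + s *\<^sub>R axis i 1)"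
  have "\<exists>s. 0 < s \<and> s < h \<and> ?g h - ?g 0 = (h - 0) * ?g' s"
    using h by (intro MVT2) (auto intro!: derivative_eq_intros smooth_line_deriv f)
  then obtain s where s: "0 < s" "s < h" "?g h - ?g 0 = h * ?g' s" by auto
  let ?k = "\<lambda>t. partial_deriv i f (x + s *\<^sub>R axis i 1 + t *\<^sub>R axis j 1)"
  have "\<exists>t. 0 < t \<and> t < h \<and> ?k h - ?k 0 = (h - 0) * partial_deriv j (partial_deriv i f) (x + s *\<^sub>R axis i 1 + t *\<^sub>R axis j 1)"
    using h by (intro MVT2) (auto intro!: derivative_eq_intros smooth_line_deriv smooth_partial_deriv f)
  then obtain t where t: "0 < t" "t < h" "?k h - ?k 0 = h * partial_deriv j (partial_deriv i f) (x + s *\<^sub>R axis i 1 + t *\<^sub>R axis j 1)"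
    by auto
  have "?g' s = ?k h - ?k 0" by (simp add: algebra_simps)
  then have "?g h - ?g 0 = h * h * partial_deriv j (partial_deriv i f) (x + s *\<^sub>R axis i 1 + t *\<^sub>R axis j 1)"
    using s(3) t(3) by simp
  moreover have "f (x + h *\<^sub>R axis i 1 + h *\<^sub>R axis j 1) - f (x + h *\<^sub>R axis i 1) - f (x + h *\<^sub>R axis j 1) + f x = ?g h - ?g 0"
    by (simp add: algebra_simps)
  ultimately show ?thesis using s t by metis
qed

text \<open>The symmetric quotient \<open>Q\<close> equals either mixed derivative at some point
  close to \<open>x\<close>; by continuity both mixed derivatives at \<open>x\<close> are its
  limit.\<close>

lemma partial_deriv_commute:
  assumes f: "smooth f"
  shows "partial_deriv i (partial_deriv j f) = partial_deriv j (partial_deriv i f)"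
proof
  fix x
  define Q where "Q = (\<lambda>h. (f (x + h *\<^sub>R axis i 1 + h *\<^sub>R axis j 1) - f (x + h *\<^sub>R axis i 1)
    - f (x + h *\<^sub>R axis j 1) + f x) / (h * h))"
  have lim: "(\<lambda>n. Q (1 / real (Suc n))) \<longlonglongrightarrow> partial_deriv b (partial_deriv a f) x"
    if ab: "(a, b) = (i, j) \<or> (a, b) = (j, i)" for a b
  proof -
    define h where "h n = 1 / real (Suc n)" for n
    have h0: "h n > 0" for n by (simp add: h_def)
    have "\<exists>s t. 0 < s \<and> s < h n \<and> 0 < t \<and> t < h n \<and>
      Q (h n) = partial_deriv b (partial_deriv a f) (x + s *\<^sub>R axis a 1 + t *\<^sub>R axis b 1)" for n
    proof -
      obtain s t where st: "0 < s" "s < h n" "0 < t" "t < h n"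
        "f (x + h n *\<^sub>R axis a 1 + h n *\<^sub>R axis b 1) - f (x + h n *\<^sub>R axis a 1) - f (x + h n *\<^sub>R axis b 1) + f x
          = h n * h n * partial_deriv b (partial_deriv a f) (x + s *\<^sub>R axis a 1 + t *\<^sub>R axis b 1)"
        using second_difference_mvt[OF f h0[of n], of x a b] by blast
      have "Q (h n) = (h n * h n * partial_deriv b (partial_deriv a f) (x + s *\<^sub>R axis a 1 + t *\<^sub>R axis b 1)) / (h n * h n)"
        unfolding st(5)[symmetric] Q_def using ab by (auto simp: algebra_simps)
      then show ?thesis using st h0[of n] by auto
    qed
    then obtain s t where st: "\<And>n. 0 < s n" "\<And>n. s n < h n" "\<And>n. 0 < t n" "\<And>n. t n < h n"
      "\<And>n. Q (h n) = partial_deriv b (partial_deriv a f) (x + s n *\<^sub>R axis a 1 + t n *\<^sub>R axis b 1)"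
      by metis
    have hl: "h \<longlonglongrightarrow> 0" using LIMSEQ_inverse_real_of_nat by (simp add: h_def[abs_def] inverse_eq_divide)
    have sl: "s \<longlonglongrightarrow> 0"
      by (rule tendsto_sandwich[OF _ _ tendsto_const hl]) (auto intro!: always_eventually less_imp_le st)
    have tl: "t \<longlonglongrightarrow> 0"
      by (rule tendsto_sandwich[OF _ _ tendsto_const hl]) (auto intro!: always_eventually less_imp_le st)
    have "(\<lambda>n. x + s n *\<^sub>R axis a 1 + t n *\<^sub>R axis b 1) \<longlonglongrightarrow> x + 0 *\<^sub>R axis a 1 + 0 *\<^sub>R axis b 1"
      by (intro tendsto_intros sl tl)
    then have "(\<lambda>n. partial_deriv b (partial_deriv a f) (x + s n *\<^sub>R axis a 1 + t n *\<^sub>R axis b 1))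
       \<longlonglongrightarrow> partial_deriv b (partial_deriv a f) x"
      using smooth_continuous[OF smooth_partial_deriv[OF smooth_partial_deriv[OF f]]]
      by (intro isCont_tendsto_compose[of _ "partial_deriv b (partial_deriv a f)"])
        (auto simp: continuous_on_eq_continuous_at)
    then show ?thesis unfolding st(5)[symmetric] by (simp add: h_def)
  qed
  show "partial_deriv i (partial_deriv j f) x = partial_deriv j (partial_deriv i f) x"
    using LIMSEQ_unique[OF lim[of i j] lim[of j i]] by simp
qed

section \<open>A smooth function that vanishes exactly on the left half-line\<close>

text \<open>
  The \<open>n\<close>-th derivative of \<open>exp (- 1 / t)\<close> is \<open>poly (bump_poly n) (1 / t) * exp (- 1 / t)\<close>.
\<close>

primrec bump_poly :: "nat \<Rightarrow> real poly" where
  "bump_poly 0 = 1"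
| "bump_poly (Suc n) = [:0, 0, 1:] * (bump_poly n - pderiv (bump_poly n))"

definition bump_deriv :: "nat \<Rightarrow> real \<Rightarrow> real" where
  "bump_deriv n t = (if t > 0 then poly (bump_poly n) (1 / t) * exp (- (1 / t)) else 0)"

abbreviation bump :: "real \<Rightarrow> real" where "bump \<equiv> bump_deriv 0"

lemma bump_eq: "bump t = (if t > 0 then exp (- (1 / t)) else 0)"
  by (simp add: bump_deriv_def)

lemma poly_exp_tendsto_0: "((\<lambda>x::real. poly p x * exp (- x)) \<longlongrightarrow> 0) at_top"
proof -
  have mono: "((\<lambda>x::real. x ^ k * exp (- x)) \<longlongrightarrow> 0) at_top" for k
    using tendsto_power_div_exp_0[of k] by (simp add: exp_minus field_simps)
  have "((\<lambda>x::real. \<Sum>k\<le>degree p. coeff p k * (x ^ k * exp (- x))) \<longlongrightarrow> (\<Sum>k\<le>degree p. coeff p k * 0)) at_top"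
    by (intro tendsto_intros mono)
  then show ?thesis by (simp add: poly_altdef sum_distrib_right mult.assoc)
qed

lemma bump_deriv_has_derivative:
  "(bump_deriv n has_real_derivative bump_deriv (Suc n) t) (at t)"
proof -
  consider "t > 0" | "t < 0" | "t = 0" by linarith
  then show ?thesis
  proof cases
    case 1
    have "((\<lambda>t. poly (bump_poly n) (1 / t) * exp (- (1 / t))) has_real_derivative bump_deriv (Suc n) t) (at t)"
      using 1 by (auto intro!: derivative_eq_intros DERIV_chain2[OF poly_DERIV]
        simp: bump_deriv_def field_simps power2_eq_square)
    then show ?thesis
      by (rule has_field_derivative_transform_within_open[where S = "{0<..}"])
        (use 1 in \<open>auto simp: bump_deriv_def\<close>)
  next
    case 2
    have "((\<lambda>t. 0) has_real_derivative bump_deriv (Suc n) t) (at t)"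
      using 2 by (simp add: bump_deriv_def)
    then show ?thesis
      by (rule has_field_derivative_transform_within_open[where S = "{..<0}"])
        (use 2 in \<open>auto simp: bump_deriv_def\<close>)
  next
    case 3
    \<comment> \<open>Dividing by \<open>h\<close> in the difference quotient at 0 multiplies the
      polynomial in \<open>1 / h\<close> by its variable, and the exponential still
      dominates.\<close>
    let ?p = "[:0, 1:] * bump_poly n"
    have "((\<lambda>x. poly ?p (inverse x) * exp (- inverse x)) \<longlongrightarrow> 0) (at_right (0::real))"
      using poly_exp_tendsto_0[of ?p] unfolding filterlim_at_top_to_right .
    then have "((\<lambda>h. (bump_deriv n h - bump_deriv n 0) / (h - 0)) \<longlongrightarrow> 0) (at_right 0)"
      by (rule Lim_transform_eventually)
        (auto simp: eventually_at_right_field bump_deriv_def field_simps intro!: exI[of _ 1])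
    moreover have "((\<lambda>h. (bump_deriv n h - bump_deriv n 0) / (h - 0)) \<longlongrightarrow> 0) (at_left 0)"
      by (rule Lim_transform_eventually[OF tendsto_const])
        (auto simp: eventually_at_left_field bump_deriv_def intro!: exI[of _ "-1"])
    ultimately have "((\<lambda>h. (bump_deriv n h - bump_deriv n 0) / (h - 0)) \<longlongrightarrow> 0) (at 0)"
      by (simp add: filterlim_split_at)
    then show ?thesis using 3 by (simp add: has_field_derivative_iff bump_deriv_def)
  qed
qed

lemma bump_nonneg: "0 \<le> bump t" and bump_le_1: "bump t \<le> 1" and bump_pos_iff: "0 < bump t \<longleftrightarrow> 0 < t"
  by (auto simp: bump_eq)

lemma smooth_bump: "smooth f \<Longrightarrow> smooth (\<lambda>x. bump (f x))"
  using smooth_compose[of bump_deriv f 0] bump_deriv_has_derivative by auto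

lemma smooth_sin:
  assumes "smooth f" shows "smooth (\<lambda>x. sin (f x))"
proof -
  \<comment> \<open>Each derivative of the sine is a shift by a quarter period, which puts all
    derivatives into the one sequence that \<open>smooth_compose\<close> asks for.\<close>
  define F :: "nat \<Rightarrow> real \<Rightarrow> real" where
    "F n x = sin (x + of_nat n * (pi / 2))" for n x
  have "(F n has_real_derivative F (Suc n) x) (at x)" for n x
  proof -
    have "x + of_nat (Suc n) * (pi / 2) = (x + of_nat n * (pi / 2)) + pi / 2"
      by (simp add: field_simps)
    then have "F (Suc n) x = cos (x + of_nat n * (pi / 2))"
      by (simp only: F_def sin_add) simp
    then show ?thesis unfolding F_def[abs_def] by (auto intro!: derivative_eq_intros)
  qed
  from smooth_compose[of F f 0, OF this assms] show ?thesis by (simp add: F_def)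
qed

section \<open>Integration over the periodicity cell\<close>

text \<open>A measure on the whole space with the Borel sets takes the place of Lebesgue measure on
  the cell: measurability no longer refers to the cell and no completion occurs.
  \<open>integral_cell\<close> translates back.\<close>

definition nu :: "(real^3) measure" where
  "nu = density lborel (indicator cell)"

text \<open>A fundamental domain of the horizontal period lattice, unbounded vertically. Unlike the
  cell it is well suited to shifts with a vertical component.\<close>

definition tube :: "(real^3) set" where
  "tube = {x. 0 \<le> x$1 \<and> x$1 < 1 \<and> 0 \<le> x$2 \<and> x$2 < 1}"

lemma borel_measurable_nth [measurable]: "(\<lambda>x::real^3. x$i) \<in> borel_measurable borel"
  by (intro borel_measurable_continuous_onI continuous_intros)

lemma sets_slab [measurable]: "slab \<in> sets borel"
  and sets_tube [measurable]: "tube \<in> sets borel"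
  and sets_cell [measurable]: "cell \<in> sets borel"
  unfolding slab_def tube_def cell_def by measurable

lemma cell_eq: "cell = tube \<inter> slab"
  by (auto simp: cell_def tube_def)

lemma sets_nu [simp, measurable_cong]: "sets nu = sets borel"
  by (simp add: nu_def)

lemma space_nu [simp]: "space nu = UNIV"
  by (simp add: nu_def)

lemma nn_integral_nu:
  "f \<in> borel_measurable borel \<Longrightarrow> (\<integral>\<^sup>+x. f x \<partial>nu) = (\<integral>\<^sup>+x. indicator cell x * f x \<partial>lborel)"
  by (simp add: nu_def nn_integral_density)

lemma AE_nu_iff: "(AE x in nu. P x) \<longleftrightarrow> (AE x in lborel. x \<in> cell \<longrightarrow> P x)"
  unfolding nu_def by (subst AE_density) (auto simp: indicator_def)

lemma AE_nu_cell: "(\<And>x. x \<in> cell \<Longrightarrow> P x) \<Longrightarrow> AE x in nu. P x"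
  by (simp add: AE_nu_iff)

lemma prod_3: "prod f (UNIV::3 set) = f 1 * f 2 * f 3" for f :: "3 \<Rightarrow> 'a::comm_monoid_mult"
  unfolding UNIV_3 by (simp add: ac_simps)

lemma prod_Basis_3: "prod f (Basis :: (real^3) set) = f (axis 1 1) * f (axis 2 1) * f (axis 3 1)"
  for f :: "real^3 \<Rightarrow> 'a::comm_monoid_mult"
proof -
  have B: "(Basis :: (real^3) set) = (\<lambda>i. axis i 1) ` UNIV"
    by (auto simp: Basis_vec_def)
  have inj: "inj (\<lambda>i::3. axis i (1::real))"
    by (simp add: inj_def axis_eq_axis)
  show ?thesis
    unfolding B prod.reindex[OF inj] o_def prod_3 ..
qed

lemma inner_axis_nth: "x \<bullet> axis i 1 = (x::real^3) $ i"
  by (simp add: cart_eq_inner_axis)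

lemma emeasure_cell: "emeasure lborel cell \<le> 1"
proof -
  have "cell \<subseteq> cbox 0 (\<chi> i. 1)"
    by (simp add: cell_def slab_def mem_box_cart forall_3 subset_eq)
  then have "emeasure lborel cell \<le> emeasure lborel (cbox 0 (\<chi> i. 1) :: (real^3) set)"
    by (intro emeasure_mono) auto
  also have "\<dots> = 1"
  proof (subst emeasure_lborel_cbox)
    fix b :: "real^3" assume "b \<in> Basis"
    then obtain i where "b = axis i 1" by (auto simp: Basis_vec_def)
    then show "0 \<bullet> b \<le> (\<chi> i. 1) \<bullet> b" by (simp add: inner_axis_nth)
  qed (simp add: prod_Basis_3 inner_axis_nth)
  finally show ?thesis .
qed

lemma emeasure_nu_UNIV: "emeasure nu UNIV \<le> 1"
proof -
  have "emeasure nu UNIV = (\<integral>\<^sup>+x. indicator cell x \<partial>lborel)"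
    by (simp add: nu_def emeasure_density)
  then show ?thesis using emeasure_cell by (simp add: nn_integral_indicator)
qed

interpretation nu: finite_measure nu
proof
  show "emeasure nu (space nu) \<noteq> \<infinity>"
    using emeasure_nu_UNIV by (auto simp: top_unique)
qed

lemma borel_measurable_diag_affine [measurable]: "diag_affine b l \<in> borel_measurable borel"
  by (intro borel_measurable_continuous_onI)
    (auto simp: continuous_on_eq_continuous_at intro: has_derivative_continuous has_derivative_diag_affine)

lemma nn_integral_diag_affine:
  assumes [measurable]: "F \<in> borel_measurable borel" and l: "\<And>i. l$i \<noteq> 0"
  shows "(\<integral>\<^sup>+x. F x \<partial>lborel) = ennreal \<bar>l$1 * l$2 * l$3\<bar> * (\<integral>\<^sup>+x. F (diag_affine b l x) \<partial>lborel)"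
proof -
  have T: "b + (\<Sum>j\<in>Basis. ((l \<bullet> j) * (x \<bullet> j)) *\<^sub>R j) = diag_affine b l x" for x
  proof (intro euclidean_eqI[of _ "diag_affine b l x"])
    fix k :: "real^3" assume "k \<in> Basis"
    then obtain i where k: "k = axis i 1" by (auto simp: Basis_vec_def)
    have "(\<Sum>j\<in>Basis. ((l \<bullet> j) * (x \<bullet> j)) *\<^sub>R j) \<bullet> k = (l \<bullet> k) * (x \<bullet> k)"
      using \<open>k \<in> Basis\<close> by (simp add: inner_sum_left_Basis)
    then show "(b + (\<Sum>j\<in>Basis. ((l \<bullet> j) * (x \<bullet> j)) *\<^sub>R j)) \<bullet> k = diag_affine b l x \<bullet> k"
      by (simp add: inner_add_left k inner_axis_nth)
  qed
  have c: "l \<bullet> j \<noteq> 0" if "j \<in> Basis" for j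
    using that l by (auto simp: Basis_vec_def inner_axis_nth)
  have "lborel = density (distr lborel borel (diag_affine b l)) (\<lambda>_. ennreal \<bar>l$1 * l$2 * l$3\<bar>)"
    using lborel_affine_euclidean[where c = "\<lambda>j. l \<bullet> j" and t = b, OF c]
    by (simp add: T prod_Basis_3 inner_axis_nth abs_mult)
  then have "(\<integral>\<^sup>+x. F x \<partial>lborel) = (\<integral>\<^sup>+x. F x \<partial>density (distr lborel borel (diag_affine b l)) (\<lambda>_. ennreal \<bar>l$1 * l$2 * l$3\<bar>))"
    by simp
  also have "\<dots> = (\<integral>\<^sup>+x. ennreal \<bar>l$1 * l$2 * l$3\<bar> * F (diag_affine b l x) \<partial>lborel)"
    by (subst nn_integral_density) (auto simp: nn_integral_distr)
  also have "\<dots> = ennreal \<bar>l$1 * l$2 * l$3\<bar> * (\<integral>\<^sup>+x. F (diag_affine b l x) \<partial>lborel)"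
    by (rule nn_integral_cmult) simp
  finally show ?thesis .
qed

lemma nn_integral_translation:
  fixes v :: "real^3"
  assumes [measurable]: "F \<in> borel_measurable borel"
  shows "(\<integral>\<^sup>+x. F (x + v) \<partial>lborel) = (\<integral>\<^sup>+x. F x \<partial>lborel)"
proof -
  have "(\<integral>\<^sup>+x. F x \<partial>lborel) = (\<integral>\<^sup>+x. F x \<partial>distr lborel borel ((+) v))"
    by (simp add: lborel_distr_plus)
  also have "\<dots> = (\<integral>\<^sup>+x. F (x + v) \<partial>lborel)"
    by (subst nn_integral_distr) (auto simp: add.commute)
  finally show ?thesis by simp
qed

section \<open>Shift invariance of integrals of periodic functions\<close>

definition per :: "(real^3 \<Rightarrow> 'a) \<Rightarrow> bool" where
  "per f \<longleftrightarrow> (\<forall>x. f (x + axis 1 1) = f x \<and> f (x + axis 2 1) = f x)"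

lemma axis_cases [simp]:
  "axis (1::3) (a::real) $ 1 = a" "axis (1::3) (a::real) $ 2 = 0" "axis (1::3) (a::real) $ 3 = 0"
  "axis (2::3) (a::real) $ 1 = 0" "axis (2::3) (a::real) $ 2 = a" "axis (2::3) (a::real) $ 3 = 0"
  "axis (3::3) (a::real) $ 1 = 0" "axis (3::3) (a::real) $ 2 = 0" "axis (3::3) (a::real) $ 3 = a"
  by (simp_all add: axis_def)

text \<open>As \<open>t\<close> is at most 1, the shifted period [t, 1 + t) is cut once, at 1, and
  the piece beyond is moved back by one period.\<close>

lemma nn_integral_tube_shift_axis:
  fixes F :: "real^3 \<Rightarrow> ennreal"
  assumes [measurable]: "F \<in> borel_measurable borel" and F: "\<And>x. F (x + axis i 1) = F x"
    and i: "(i, j) = (1::3, 2::3) \<or> (i, j) = (2, 1)" and t: "0 \<le> t" "t \<le> 1"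
  shows "(\<integral>\<^sup>+x. indicator tube x * F (x + t *\<^sub>R axis i 1) \<partial>lborel) = (\<integral>\<^sup>+x. indicator tube x * F x \<partial>lborel)"
proof -
  define A where "A a b = {x::real^3. a \<le> x$i \<and> x$i < b \<and> 0 \<le> x$j \<and> x$j < 1}" for a b
  have [measurable]: "A a b \<in> sets borel" for a b
    unfolding A_def by measurable
  have tube: "tube = A 0 1" using i by (auto simp: tube_def A_def)
  have sh: "(\<integral>\<^sup>+x. indicator (A a b) x * F (x + s *\<^sub>R axis i 1) \<partial>lborel)
      = (\<integral>\<^sup>+x. indicator (A (a + s) (b + s)) x * F x \<partial>lborel)" for a b s
  proof -
    have "(\<integral>\<^sup>+x. indicator (A (a + s) (b + s)) x * F x \<partial>lborel)
       = (\<integral>\<^sup>+x. indicator (A (a + s) (b + s)) (x + s *\<^sub>R axis i 1) * F (x + s *\<^sub>R axis i 1) \<partial>lborel)"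
      by (subst nn_integral_translation[symmetric, where v = "s *\<^sub>R axis i 1"]) auto
    also have "\<dots> = (\<integral>\<^sup>+x. indicator (A a b) x * F (x + s *\<^sub>R axis i 1) \<partial>lborel)"
      using i by (intro nn_integral_cong) (auto simp: A_def indicator_def)
    finally show ?thesis by simp
  qed
  have split: "(\<integral>\<^sup>+x. indicator (A a c) x * F x \<partial>lborel)
      = (\<integral>\<^sup>+x. indicator (A a b) x * F x \<partial>lborel) + (\<integral>\<^sup>+x. indicator (A b c) x * F x \<partial>lborel)"
    if "a \<le> b" "b \<le> c" for a b c
  proof -
    have "indicator (A a c) x * F x = indicator (A a b) x * F x + indicator (A b c) x * F x" for x
      using that by (auto simp: A_def indicator_def)
    then show ?thesis by (simp add: nn_integral_add)
  qed
  have "(\<integral>\<^sup>+x. indicator tube x * F (x + t *\<^sub>R axis i 1) \<partial>lborel)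
     = (\<integral>\<^sup>+x. indicator (A t (1 + t)) x * F x \<partial>lborel)"
    using sh[of 0 1 t] by (simp add: tube)
  also have "\<dots> = (\<integral>\<^sup>+x. indicator (A t 1) x * F x \<partial>lborel) + (\<integral>\<^sup>+x. indicator (A 1 (1 + t)) x * F x \<partial>lborel)"
    using t by (intro split) auto
  also have "(\<integral>\<^sup>+x. indicator (A 1 (1 + t)) x * F x \<partial>lborel) = (\<integral>\<^sup>+x. indicator (A 0 t) x * F x \<partial>lborel)"
    using sh[of 0 t 1] F by (simp add: add.commute)
  also have "(\<integral>\<^sup>+x. indicator (A t 1) x * F x \<partial>lborel) + \<dots> = (\<integral>\<^sup>+x. indicator tube x * F x \<partial>lborel)"
    using split[of 0 t 1] t by (simp add: tube add.commute)
  finally show ?thesis .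
qed

text \<open>The shift is split into its three components. The horizontal ones use periodicity, the
  vertical one maps the tube to itself and is plain translation invariance.\<close>

lemma nn_integral_tube_shift:
  fixes F :: "real^3 \<Rightarrow> ennreal"
  assumes [measurable]: "F \<in> borel_measurable borel" and F: "per F"
    and v: "0 \<le> v$1" "v$1 \<le> 1" "0 \<le> v$2" "v$2 \<le> 1"
  shows "(\<integral>\<^sup>+x. indicator tube x * F (x + v) \<partial>lborel) = (\<integral>\<^sup>+x. indicator tube x * F x \<partial>lborel)"
proof -
  define F1 where "F1 x = F (x + v$3 *\<^sub>R axis 3 1)" for x
  define F2 where "F2 x = F1 (x + v$2 *\<^sub>R axis 2 1)" for x
  have [measurable]: "F1 \<in> borel_measurable borel" unfolding F1_def by measurable
  have [measurable]: "F2 \<in> borel_measurable borel" unfolding F2_def by measurable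
  have per1: "F1 (x + axis 1 1) = F1 x" "F1 (x + axis 2 1) = F1 x" for x
    using F[unfolded per_def, rule_format, of "x + v$3 *\<^sub>R axis 3 1"] by (auto simp: F1_def ac_simps)
  have per2: "F2 (x + axis 1 1) = F2 x" for x
    using per1(1)[of "x + v$2 *\<^sub>R axis 2 1"] by (simp add: F2_def ac_simps)
  have "x + v = x + v$1 *\<^sub>R axis 1 1 + v$2 *\<^sub>R axis 2 1 + v$3 *\<^sub>R axis 3 1" for x
    by (auto simp: vec_eq_iff forall_3)
  note eq = this
  have "(\<integral>\<^sup>+x. indicator tube x * F (x + v) \<partial>lborel) = (\<integral>\<^sup>+x. indicator tube x * F2 (x + v$1 *\<^sub>R axis 1 1) \<partial>lborel)"
    unfolding F2_def F1_def by (rule nn_integral_cong) (simp only: eq[symmetric])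
  also have "\<dots> = (\<integral>\<^sup>+x. indicator tube x * F2 x \<partial>lborel)"
    using v per2 by (intro nn_integral_tube_shift_axis[where j = 2]) auto
  also have "\<dots> = (\<integral>\<^sup>+x. indicator tube x * F1 x \<partial>lborel)"
    unfolding F2_def using v per1(2) by (intro nn_integral_tube_shift_axis[where j = 1]) auto
  also have "\<dots> = (\<integral>\<^sup>+x. indicator tube (x + v$3 *\<^sub>R axis 3 1) * F (x + v$3 *\<^sub>R axis 3 1) \<partial>lborel)"
    by (simp add: F1_def tube_def indicator_def)
  also have "\<dots> = (\<integral>\<^sup>+x. indicator tube x * F x \<partial>lborel)"
    by (rule nn_integral_translation[where F = "\<lambda>x. indicator tube x * F x"]) simp
  finally show ?thesis .
qed

lemma nn_integral_nu_tube:
  assumes [measurable]: "F \<in> borel_measurable borel" and F: "\<And>x. x \<notin> slab \<Longrightarrow> F x = 0"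
  shows "(\<integral>\<^sup>+x. F x \<partial>nu) = (\<integral>\<^sup>+x. indicator tube x * F x \<partial>lborel)"
proof -
  have "indicator cell x * F x = indicator tube x * F x" for x
    using F by (auto simp: indicator_def cell_eq)
  then show ?thesis by (simp add: nn_integral_nu)
qed

text \<open>The vertical component of \<open>v\<close> is arbitrary: the last two assumptions say
  that neither integrand has mass outside the slab, so the cell may be replaced by the tube on both
  sides.\<close>

lemma nn_integral_nu_shift:
  assumes [measurable]: "F \<in> borel_measurable borel" and F: "per F"
    and v: "0 \<le> v$1" "v$1 \<le> 1" "0 \<le> v$2" "v$2 \<le> 1"
    and "\<And>x. x \<notin> slab \<Longrightarrow> F x = 0" "\<And>x. x \<notin> slab \<Longrightarrow> F (x + v) = 0"
  shows "(\<integral>\<^sup>+x. F (x + v) \<partial>nu) = (\<integral>\<^sup>+x. F x \<partial>nu)"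
  using assms by (simp add: nn_integral_nu_tube nn_integral_tube_shift)

text \<open>Transfers changes of variables from nonnegative integrals, where they hold
  unconditionally, to the positive and negative parts of a real integrand; integrability need not be
  known beforehand.\<close>

lemma integral_eq_of_nn_integral_eq:
  fixes F G :: "'a \<Rightarrow> real"
  assumes [measurable]: "F \<in> borel_measurable M" "G \<in> borel_measurable M"
    and "(\<integral>\<^sup>+x. ennreal (F x) \<partial>M) = (\<integral>\<^sup>+x. ennreal (G x) \<partial>M)"
    and "(\<integral>\<^sup>+x. ennreal (- F x) \<partial>M) = (\<integral>\<^sup>+x. ennreal (- G x) \<partial>M)"
  shows "integral\<^sup>L M F = integral\<^sup>L M G" "integrable M F \<longleftrightarrow> integrable M G"
proof -
  show iff: "integrable M F \<longleftrightarrow> integrable M G"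
    using assms by (simp add: real_integrable_def)
  show "integral\<^sup>L M F = integral\<^sup>L M G"
    by (cases "integrable M F") (use iff assms in \<open>auto simp: real_lebesgue_integral_def not_integrable_integral_eq\<close>)
qed

lemma integral_nu_shift:
  fixes F :: "real^3 \<Rightarrow> real"
  assumes [measurable]: "F \<in> borel_measurable borel" and F: "per F"
    and v: "0 \<le> v$1" "v$1 \<le> 1" "0 \<le> v$2" "v$2 \<le> 1"
    and "\<And>x. x \<notin> slab \<Longrightarrow> F x = 0" "\<And>x. x \<notin> slab \<Longrightarrow> F (x + v) = 0"
  shows "(\<integral>x. F (x + v) \<partial>nu) = (\<integral>x. F x \<partial>nu)"
    "integrable nu (\<lambda>x. F (x + v)) \<longleftrightarrow> integrable nu F"
proof -
  have "per (\<lambda>x. ennreal (F x))" "per (\<lambda>x. ennreal (- F x))"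
    using F by (auto simp: per_def)
  with assms have
    "(\<integral>\<^sup>+x. ennreal (F (x + v)) \<partial>nu) = (\<integral>\<^sup>+x. ennreal (F x) \<partial>nu)"
    "(\<integral>\<^sup>+x. ennreal (- F (x + v)) \<partial>nu) = (\<integral>\<^sup>+x. ennreal (- F x) \<partial>nu)"
    by (auto intro!: nn_integral_nu_shift[where F = "\<lambda>x. ennreal (F x)"] nn_integral_nu_shift[where F = "\<lambda>x. ennreal (- F x)"])
  from integral_eq_of_nn_integral_eq[OF _ _ this]
  show "(\<integral>x. F (x + v) \<partial>nu) = (\<integral>x. F x \<partial>nu)"
    "integrable nu (\<lambda>x. F (x + v)) \<longleftrightarrow> integrable nu F" by auto
qed

section \<open>Square integrable functions and density of test functions\<close>

definition sqint :: "(real^3 \<Rightarrow> real) \<Rightarrow> bool" where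
  "sqint f \<longleftrightarrow> f \<in> borel_measurable borel \<and> integrable nu (\<lambda>x. (f x)\<^sup>2)"

definition nrm :: "(real^3 \<Rightarrow> real) \<Rightarrow> real" where
  "nrm f = sqrt (\<integral>x. (f x)\<^sup>2 \<partial>nu)"

lemma sqint_borel [measurable_dest]: "sqint f \<Longrightarrow> f \<in> borel_measurable borel"
  by (simp add: sqint_def)

lemma nrm_nonneg [simp]: "0 \<le> nrm f"
  by (simp add: nrm_def)

lemma nrm_sq: "(nrm f)\<^sup>2 = (\<integral>x. (f x)\<^sup>2 \<partial>nu)"
  by (simp add: nrm_def)

lemma sqint_mult_integrable:
  assumes f: "sqint f" and g: "sqint g" shows "integrable nu (\<lambda>x. f x * g x)"
proof (rule Bochner_Integration.integrable_bound)
  show "integrable nu (\<lambda>x. (f x)\<^sup>2 + (g x)\<^sup>2)"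
    using assms by (auto simp: sqint_def)
  have "\<bar>a * b\<bar> \<le> a\<^sup>2 + b\<^sup>2" for a b :: real
  proof -
    have "0 \<le> (\<bar>a\<bar> - \<bar>b\<bar>)\<^sup>2" by simp
    then have "2 * \<bar>a * b\<bar> \<le> a\<^sup>2 + b\<^sup>2" by (simp add: power2_diff abs_mult)
    then show ?thesis using zero_le_power2[of a] zero_le_power2[of b] by linarith
  qed
  then show "AE x in nu. norm (f x * g x) \<le> norm ((f x)\<^sup>2 + (g x)\<^sup>2)"
    by simp
qed (use assms in \<open>auto simp: sqint_def\<close>)

lemma sqint_cong_AE:
  assumes "sqint f" "g \<in> borel_measurable borel" "AE x in nu. \<bar>g x\<bar> \<le> B * \<bar>f x\<bar>"
  shows "sqint g"
proof -
  have "integrable nu (\<lambda>x. (g x)\<^sup>2)"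
  proof (rule Bochner_Integration.integrable_bound)
    show "integrable nu (\<lambda>x. B\<^sup>2 * (f x)\<^sup>2)" using assms by (auto simp: sqint_def)
    show "AE x in nu. norm ((g x)\<^sup>2) \<le> norm (B\<^sup>2 * (f x)\<^sup>2)"
      using assms(3)
    proof eventually_elim
      case (elim x)
      then have "\<bar>g x\<bar>\<^sup>2 \<le> (B * \<bar>f x\<bar>)\<^sup>2" by (intro power_mono) auto
      then show ?case by (simp add: power_mult_distrib)
    qed
  qed (use assms in auto)
  then show ?thesis using assms by (simp add: sqint_def)
qed

lemma nrm_mono:
  assumes "sqint f" "g \<in> borel_measurable borel" "AE x in nu. \<bar>g x\<bar> \<le> B * \<bar>f x\<bar>" "0 \<le> B"
  shows "nrm g \<le> B * nrm f"
proof -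
  have "sqint g" by (rule sqint_cong_AE[OF assms(1-3)])
  have "(\<integral>x. (g x)\<^sup>2 \<partial>nu) \<le> (\<integral>x. B\<^sup>2 * (f x)\<^sup>2 \<partial>nu)"
  proof (rule integral_mono_AE)
    show "AE x in nu. (g x)\<^sup>2 \<le> B\<^sup>2 * (f x)\<^sup>2"
      using assms(3)
    proof eventually_elim
      case (elim x)
      then have "\<bar>g x\<bar>\<^sup>2 \<le> (B * \<bar>f x\<bar>)\<^sup>2" by (intro power_mono) auto
      then show ?case by (simp add: power_mult_distrib)
    qed
  qed (use assms \<open>sqint g\<close> in \<open>auto simp: sqint_def\<close>)
  also have "\<dots> = (B * nrm f)\<^sup>2" by (simp add: nrm_sq power_mult_distrib)
  finally show ?thesis
    using assms(4) by (simp add: nrm_def[of g] real_le_lsqrt)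
qed

lemma sqint_add: assumes "sqint f" "sqint g" shows "sqint (\<lambda>x. f x + g x)"
proof -
  have "integrable nu (\<lambda>x. (f x)\<^sup>2 + (g x)\<^sup>2 + 2 * (f x * g x))"
    using assms sqint_mult_integrable[OF assms] by (auto simp: sqint_def)
  then show ?thesis using assms by (auto simp: sqint_def power2_sum mult.assoc)
qed

lemma sqint_cmult: "sqint f \<Longrightarrow> sqint (\<lambda>x. c * f x)"
  by (auto simp: sqint_def power_mult_distrib)

lemma sqint_diff: "sqint f \<Longrightarrow> sqint g \<Longrightarrow> sqint (\<lambda>x. f x - g x)"
  using sqint_add[OF _ sqint_cmult[of g "-1"], of f] by simp

lemma sqint_abs: "sqint f \<Longrightarrow> sqint (\<lambda>x. \<bar>f x\<bar>)"
  by (auto simp: sqint_def)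

lemma sqint_bounded:
  assumes [measurable]: "f \<in> borel_measurable borel" and "AE x in nu. \<bar>f x\<bar> \<le> B" shows "sqint f"
proof -
  have "sqint (\<lambda>x. 1)" by (simp add: sqint_def)
  then show ?thesis using assms by (intro sqint_cong_AE[of "\<lambda>x. 1" f B]) auto
qed

lemma sqint_const: "sqint (\<lambda>x. c)"
  by (simp add: sqint_def)

lemma sqint_integrable: "sqint f \<Longrightarrow> integrable nu f"
  using sqint_mult_integrable[of f "\<lambda>x. 1"] sqint_const by simp

lemma sqint_mult_bounded:
  assumes "sqint f" and [measurable]: "g \<in> borel_measurable borel" and "AE x in nu. \<bar>g x\<bar> \<le> B"
  shows "sqint (\<lambda>x. g x * f x)"
proof (rule sqint_cong_AE[OF assms(1)])
  show "AE x in nu. \<bar>g x * f x\<bar> \<le> B * \<bar>f x\<bar>"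
    using assms(3) by eventually_elim (auto simp: abs_mult intro: mult_right_mono)
qed (use assms(1) in measurable)

lemma nrm_mult_bounded:
  assumes "sqint f" and [measurable]: "g \<in> borel_measurable borel" and "AE x in nu. \<bar>g x\<bar> \<le> B" "0 \<le> B"
  shows "nrm (\<lambda>x. g x * f x) \<le> B * nrm f"
proof (rule nrm_mono[OF assms(1)])
  show "AE x in nu. \<bar>g x * f x\<bar> \<le> B * \<bar>f x\<bar>"
    using assms(3) by eventually_elim (auto simp: abs_mult intro: mult_right_mono)
qed (use assms in auto)

lemma ennreal_nrm_sq: "sqint f \<Longrightarrow> ennreal ((nrm f)\<^sup>2) = (\<integral>\<^sup>+x. ennreal ((f x)\<^sup>2) \<partial>nu)"
  by (simp add: nrm_sq sqint_def nn_integral_eq_integral)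

lemma sqint_nrm_leI:
  assumes [measurable]: "f \<in> borel_measurable borel" and le: "(\<integral>\<^sup>+x. ennreal ((f x)\<^sup>2) \<partial>nu) \<le> ennreal (N\<^sup>2)" and "0 \<le> N"
  shows "sqint f" "nrm f \<le> N"
proof -
  have "(\<integral>\<^sup>+x. ennreal ((f x)\<^sup>2) \<partial>nu) < \<infinity>"
    using le by (auto simp: less_top[symmetric] top_unique)
  then show "sqint f"
    by (simp add: sqint_def integrable_iff_bounded)
  from ennreal_nrm_sq[OF this] le have "ennreal ((nrm f)\<^sup>2) \<le> ennreal (N\<^sup>2)" by simp
  then have "(nrm f)\<^sup>2 \<le> N\<^sup>2" by (simp add: ennreal_le_iff)
  then show "nrm f \<le> N" using \<open>0 \<le> N\<close> by (rule power2_le_imp_le)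
qed

lemma nrm_Cauchy_Schwarz_abs:
  assumes "sqint f" "sqint g" shows "(\<integral>x. \<bar>f x * g x\<bar> \<partial>nu) \<le> nrm f * nrm g"
proof -
  note [measurable] = sqint_borel[OF assms(1)] sqint_borel[OF assms(2)]
  have "(\<integral>\<^sup>+x. ennreal \<bar>f x\<bar> * ennreal \<bar>g x\<bar> \<partial>nu)\<^sup>2
      \<le> (\<integral>\<^sup>+x. ennreal \<bar>f x\<bar> ^ 2 \<partial>nu) * (\<integral>\<^sup>+x. ennreal \<bar>g x\<bar> ^ 2 \<partial>nu)"
    by (rule Cauchy_Schwarz_nn_integral) auto
  also have "\<dots> = ennreal ((nrm f * nrm g)\<^sup>2)"
    using assms by (simp add: ennreal_power ennreal_nrm_sq[symmetric] ennreal_mult[symmetric] power_mult_distrib)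
  also have "(\<integral>\<^sup>+x. ennreal \<bar>f x\<bar> * ennreal \<bar>g x\<bar> \<partial>nu) = ennreal (\<integral>x. \<bar>f x * g x\<bar> \<partial>nu)"
    using sqint_mult_integrable[OF assms]
    by (subst nn_integral_eq_integral[symmetric])
      (auto simp: ennreal_mult[symmetric] abs_mult[symmetric])
  finally have "ennreal ((\<integral>x. \<bar>f x * g x\<bar> \<partial>nu)\<^sup>2) \<le> ennreal ((nrm f * nrm g)\<^sup>2)"
    by (simp add: ennreal_power)
  then have "(\<integral>x. \<bar>f x * g x\<bar> \<partial>nu)\<^sup>2 \<le> (nrm f * nrm g)\<^sup>2"
    by (simp add: ennreal_le_iff)
  then show ?thesis by (rule power2_le_imp_le) simp
qed

lemma nrm_Cauchy_Schwarz:
  assumes "sqint f" "sqint g" shows "\<bar>\<integral>x. f x * g x \<partial>nu\<bar> \<le> nrm f * nrm g"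
  using nrm_Cauchy_Schwarz_abs[OF assms] integral_abs_bound[of nu "\<lambda>x. f x * g x"] by linarith

lemma nrm_triangle:
  assumes "sqint f" "sqint g" shows "nrm (\<lambda>x. f x + g x) \<le> nrm f + nrm g"
proof -
  have "(nrm (\<lambda>x. f x + g x))\<^sup>2 = (\<integral>x. (f x)\<^sup>2 + (g x)\<^sup>2 + 2 * (f x * g x) \<partial>nu)"
    by (simp add: nrm_sq power2_sum mult.assoc)
  also have "\<dots> = (nrm f)\<^sup>2 + (nrm g)\<^sup>2 + 2 * (\<integral>x. f x * g x \<partial>nu)"
    using assms sqint_mult_integrable[OF assms] by (simp add: sqint_def nrm_sq)
  also have "\<dots> \<le> (nrm f + nrm g)\<^sup>2"
    using nrm_Cauchy_Schwarz[OF assms] by (simp add: power2_sum)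
  finally show ?thesis by (rule power2_le_imp_le) simp
qed

lemma nrm_cmult: "nrm (\<lambda>x. c * f x) = \<bar>c\<bar> * nrm f"
  by (simp add: nrm_def power_mult_distrib real_sqrt_mult)

lemma nrm_minus_commute: "nrm (\<lambda>x. f x - g x) = nrm (\<lambda>x. g x - f x)"
  by (simp add: nrm_def power2_commute)

lemma nrm_triangle_diff:
  assumes "sqint f" "sqint g" "sqint h" shows "nrm (\<lambda>x. f x - h x) \<le> nrm (\<lambda>x. f x - g x) + nrm (\<lambda>x. g x - h x)"
  using nrm_triangle[OF sqint_diff[OF assms(1,2)] sqint_diff[OF assms(2,3)]] by simp

lemma nrm_cong_AE:
  assumes [measurable]: "f \<in> borel_measurable borel" "g \<in> borel_measurable borel" and "AE x in nu. f x = g x"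
  shows "nrm f = nrm g"
  unfolding nrm_def using assms(3) by (intro arg_cong[where f = sqrt] integral_cong_AE) auto

lemma nrm_eq_0:
  assumes "sqint f" "nrm f = 0" shows "AE x in nu. f x = 0"
proof -
  have "(\<integral>x. (f x)\<^sup>2 \<partial>nu) = 0" using assms(2) by (simp add: nrm_def)
  then have "AE x in nu. (f x)\<^sup>2 = 0"
    using assms(1) by (subst (asm) integral_nonneg_eq_0_iff_AE) (auto simp: sqint_def)
  then show ?thesis by simp
qed

lemma nrm_tendsto_0:
  assumes [measurable]: "\<And>n. f n \<in> borel_measurable borel" and "sqint w"
    and "\<And>n. AE x in nu. \<bar>f n x\<bar> \<le> \<bar>w x\<bar>" and "AE x in nu. (\<lambda>n. f n x) \<longlonglongrightarrow> 0"
  shows "(\<lambda>n. nrm (f n)) \<longlonglongrightarrow> 0"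
proof -
  have "(\<lambda>n. \<integral>x. (f n x)\<^sup>2 \<partial>nu) \<longlonglongrightarrow> (\<integral>x. 0 \<partial>nu)"
  proof (rule integral_dominated_convergence[where w = "\<lambda>x. (w x)\<^sup>2"])
    show "AE x in nu. (\<lambda>n. (f n x)\<^sup>2) \<longlonglongrightarrow> 0"
      using assms(4) by eventually_elim (auto intro: tendsto_eq_intros)
    show "AE x in nu. norm ((f n x)\<^sup>2) \<le> (w x)\<^sup>2" for n
      using assms(3)[of n] by eventually_elim (simp add: abs_le_square_iff)
  qed (use assms in \<open>auto simp: sqint_def\<close>)
  then have "(\<lambda>n. sqrt (\<integral>x. (f n x)\<^sup>2 \<partial>nu)) \<longlonglongrightarrow> sqrt 0"
    by (intro tendsto_intros) simp
  then show ?thesis by (simp add: nrm_def)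
qed

section \<open>Test functions on strips and their closure in L2\<close>

definition strip :: "real \<Rightarrow> real \<Rightarrow> (real^3) set" where
  "strip a b = {x. a < x$3 \<and> x$3 < b}"

lemma sets_strip [measurable]: "strip a b \<in> sets borel"
  unfolding strip_def by measurable

text \<open>Strips inside the slab are needed twice: difference quotients shift a test function
  vertically and must not reach a face, and the bound for second order Sobolev functions treats a
  lower and an upper strip separately.\<close>

definition test_on :: "real \<Rightarrow> real \<Rightarrow> (real^3 \<Rightarrow> real) \<Rightarrow> bool" where
  "test_on a b \<phi> \<longleftrightarrow> smooth \<phi> \<and> periodic_on UNIV \<phi> \<and>
     (\<exists>\<epsilon>>0. \<forall>x. x$3 < a + \<epsilon> \<or> b - \<epsilon> < x$3 \<longrightarrow> \<phi> x = 0)"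

lemma test_function_iff: "test_function \<phi> \<longleftrightarrow> test_on 0 1 \<phi>"
  by (simp add: test_function_def test_on_def)

lemma test_on_outside:
  assumes "test_on a b \<phi>" "x \<notin> strip a b" shows "\<phi> x = 0"
proof -
  obtain e where e: "e > 0" "\<And>x. x$3 < a + e \<or> b - e < x$3 \<Longrightarrow> \<phi> x = 0"
    using assms by (auto simp: test_on_def)
  have "x$3 < a + e \<or> b - e < x$3"
    using assms(2) e(1) by (auto simp: strip_def)
  then show ?thesis by (rule e(2))
qed

lemma test_on_add:
  assumes "test_on a b f" "test_on a b g" shows "test_on a b (\<lambda>x. f x + g x)"
proof -
  obtain e1 e2 where "e1 > 0" "\<forall>x. x$3 < a + e1 \<or> b - e1 < x$3 \<longrightarrow> f x = 0"
    "e2 > 0" "\<forall>x. x$3 < a + e2 \<or> b - e2 < x$3 \<longrightarrow> g x = 0"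
    using assms by (auto simp: test_on_def)
  then have "\<exists>\<epsilon>>0. \<forall>x. x$3 < a + \<epsilon> \<or> b - \<epsilon> < x$3 \<longrightarrow> f x + g x = 0"
    by (intro exI[of _ "min e1 e2"]) auto
  then show ?thesis using assms by (auto simp: test_on_def smooth_add periodic_on_def)
qed

lemma test_on_mult:
  assumes "smooth f" "periodic_on UNIV f" "test_on a b g" shows "test_on a b (\<lambda>x. f x * g x)"
proof -
  obtain e2 where "e2 > 0" "\<forall>x. x$3 < a + e2 \<or> b - e2 < x$3 \<longrightarrow> g x = 0"
    using assms by (auto simp: test_on_def)
  then have "\<exists>\<epsilon>>0. \<forall>x. x$3 < a + \<epsilon> \<or> b - \<epsilon> < x$3 \<longrightarrow> f x * g x = 0"
    by (intro exI[of _ e2]) auto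
  then show ?thesis using assms by (auto simp: test_on_def smooth_mult periodic_on_def)
qed

lemma test_on_cmult: "test_on a b g \<Longrightarrow> test_on a b (\<lambda>x. c * g x)"
  by (rule test_on_mult) (auto simp: smooth_const periodic_on_def)

lemma test_on_0: "test_on a b (\<lambda>x. 0)"
  by (auto simp: test_on_def smooth_const periodic_on_def intro: exI[of _ 1])

lemma test_on_mono:
  assumes "test_on a b \<phi>" "a' \<le> a" "b \<le> b'" shows "test_on a' b' \<phi>"
proof -
  obtain e where e: "e > 0" "\<And>x. x$3 < a + e \<or> b - e < x$3 \<Longrightarrow> \<phi> x = 0"
    using assms by (auto simp: test_on_def)
  have "\<phi> x = 0" if "x$3 < a' + e \<or> b' - e < x$3" for x
    using that assms(2,3) by (intro e(2)) auto
  then show ?thesis using assms(1) e(1) by (auto simp: test_on_def)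
qed

lemma test_on_borel: "test_on a b \<phi> \<Longrightarrow> \<phi> \<in> borel_measurable borel"
  by (simp add: test_on_def smooth_borel)

lemma continuous_bounded_on_box:
  fixes f :: "real^3 \<Rightarrow> real"
  assumes "continuous_on UNIV f"
  shows "\<exists>B\<ge>0. \<forall>x. (\<forall>i. \<bar>x$i\<bar> \<le> R) \<longrightarrow> \<bar>f x\<bar> \<le> B"
proof -
  let ?K = "cbox (\<chi> i. - R) (\<chi> i. R) :: (real^3) set"
  have "compact (f ` ?K)"
    by (intro compact_continuous_image continuous_on_subset[OF assms]) auto
  then obtain B where "\<forall>y\<in>f ` ?K. norm y \<le> B"
    using bounded_iff compact_imp_bounded by metis
  moreover have "x \<in> ?K" if "\<forall>i. \<bar>x$i\<bar> \<le> R" for x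
    using that by (simp add: mem_box_cart abs_le_iff minus_le_iff)
  ultimately have "\<forall>x. (\<forall>i. \<bar>x$i\<bar> \<le> R) \<longrightarrow> \<bar>f x\<bar> \<le> max 0 B"
    by (simp add: le_max_iff_disj)
  then show ?thesis by (intro exI[of _ "max 0 B"]) auto
qed

lemma cell_bound: "x \<in> cell \<Longrightarrow> \<bar>x$i\<bar> \<le> 1"
  using exhaust_3[of i] by (auto simp: cell_def slab_def)

lemma smooth_sq: assumes "smooth f" shows "sqint f"
proof -
  obtain B where "\<forall>x. (\<forall>i. \<bar>x$i\<bar> \<le> 1) \<longrightarrow> \<bar>f x\<bar> \<le> B"
    using continuous_bounded_on_box[OF smooth_continuous[OF assms], of 1] by auto
  then show ?thesis
    using assms by (intro sqint_bounded[of f B] AE_nu_cell smooth_borel) (auto dest: cell_bound)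
qed

lemma test_on_sq: "test_on a b \<phi> \<Longrightarrow> sqint \<phi>"
  by (simp add: test_on_def smooth_sq)

text \<open>Being stable under limits, sums and multiples, this property reduces density to open
  sets: outer regularity leads from there to Borel sets, and simple functions to everything square
  integrable.\<close>

definition appr :: "real \<Rightarrow> real \<Rightarrow> (real^3 \<Rightarrow> real) \<Rightarrow> bool" where
  "appr a b k \<longleftrightarrow> sqint k \<and> (\<forall>e>0. \<exists>\<phi>. test_on a b \<phi> \<and> nrm (\<lambda>x. k x - \<phi> x) < e)"

lemma appr_test: "test_on a b \<phi> \<Longrightarrow> appr a b \<phi>"
  unfolding appr_def by (auto simp: test_on_sq nrm_def intro!: exI[of _ \<phi>])

lemma appr_limit:
  assumes k: "sqint k" and "\<And>n. appr a b (f n)" and "(\<lambda>n. nrm (\<lambda>x. k x - f n x)) \<longlonglongrightarrow> 0"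
  shows "appr a b k"
  unfolding appr_def
proof (intro conjI allI impI k)
  fix e :: real assume "e > 0"
  then have "\<forall>\<^sub>F n in sequentially. nrm (\<lambda>x. k x - f n x) < e / 2"
    by (intro order_tendstoD(2)[OF assms(3)]) simp
  then obtain n where n: "nrm (\<lambda>x. k x - f n x) < e / 2"
    by (auto simp: eventually_sequentially)
  obtain \<phi> where \<phi>: "test_on a b \<phi>" "nrm (\<lambda>x. f n x - \<phi> x) < e / 2"
    using assms(2)[of n] \<open>e > 0\<close> unfolding appr_def by (metis half_gt_zero)
  have "nrm (\<lambda>x. k x - \<phi> x) \<le> nrm (\<lambda>x. k x - f n x) + nrm (\<lambda>x. f n x - \<phi> x)"
    using assms(2)[of n] \<phi> k by (intro nrm_triangle_diff) (auto simp: appr_def test_on_sq)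
  then show "\<exists>\<phi>. test_on a b \<phi> \<and> nrm (\<lambda>x. k x - \<phi> x) < e"
    using n \<phi> by (intro exI[of _ \<phi>]) auto
qed

lemma appr_cong_AE:
  assumes "appr a b f" and [measurable]: "g \<in> borel_measurable borel" and "AE x in nu. f x = g x"
  shows "appr a b g"
proof (rule appr_limit[of g a b "\<lambda>_. f"])
  have [measurable]: "f \<in> borel_measurable borel" using assms(1) by (simp add: appr_def sqint_def)
  show "sqint g"
    using assms by (intro sqint_cong_AE[of f g 1]) (auto simp: appr_def)
  have "nrm (\<lambda>x. g x - f x) = nrm (\<lambda>x. 0)"
    using assms(3) by (intro nrm_cong_AE) auto
  then show "(\<lambda>n. nrm (\<lambda>x. g x - f x)) \<longlonglongrightarrow> 0" by (simp add: nrm_def)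
qed (rule assms(1))

lemma appr_add:
  assumes "appr a b f" "appr a b g" shows "appr a b (\<lambda>x. f x + g x)"
  unfolding appr_def
proof (intro conjI allI impI)
  show "sqint (\<lambda>x. f x + g x)" using assms by (auto simp: appr_def intro: sqint_add)
  fix e :: real assume "e > 0"
  obtain \<phi> where \<phi>: "test_on a b \<phi>" "nrm (\<lambda>x. f x - \<phi> x) < e / 2"
    using assms(1) \<open>e > 0\<close> unfolding appr_def by (metis half_gt_zero)
  obtain \<psi> where \<psi>: "test_on a b \<psi>" "nrm (\<lambda>x. g x - \<psi> x) < e / 2"
    using assms(2) \<open>e > 0\<close> unfolding appr_def by (metis half_gt_zero)
  have "nrm (\<lambda>x. (f x - \<phi> x) + (g x - \<psi> x)) \<le> nrm (\<lambda>x. f x - \<phi> x) + nrm (\<lambda>x. g x - \<psi> x)"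
    using assms \<phi> \<psi> by (intro nrm_triangle) (auto simp: appr_def intro: test_on_sq sqint_diff)
  then show "\<exists>\<phi>. test_on a b \<phi> \<and> nrm (\<lambda>x. f x + g x - \<phi> x) < e"
    using \<phi> \<psi> by (intro exI[of _ "\<lambda>x. \<phi> x + \<psi> x"]) (auto simp: test_on_add algebra_simps)
qed

lemma appr_cmult:
  assumes "appr a b f" shows "appr a b (\<lambda>x. c * f x)"
  unfolding appr_def
proof (intro conjI allI impI)
  show "sqint (\<lambda>x. c * f x)" using assms by (auto simp: appr_def intro: sqint_cmult)
  fix e :: real assume "e > 0"
  then have "e / (\<bar>c\<bar> + 1) > 0" by simp
  then obtain \<phi> where \<phi>: "test_on a b \<phi>" "nrm (\<lambda>x. f x - \<phi> x) < e / (\<bar>c\<bar> + 1)"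
    using assms(1) unfolding appr_def by blast
  have "nrm (\<lambda>x. c * f x - c * \<phi> x) = \<bar>c\<bar> * nrm (\<lambda>x. f x - \<phi> x)"
    using nrm_cmult[of c "\<lambda>x. f x - \<phi> x"] by (simp add: algebra_simps)
  also have "\<dots> \<le> (\<bar>c\<bar> + 1) * nrm (\<lambda>x. f x - \<phi> x)"
    by (intro mult_right_mono) auto
  also have "\<dots> < e" using \<phi>(2) by (simp add: pos_less_divide_eq mult.commute)
  finally show "\<exists>\<phi>. test_on a b \<phi> \<and> nrm (\<lambda>x. c * f x - \<phi> x) < e"
    using \<phi>(1) by (intro exI[of _ "\<lambda>x. c * \<phi> x"]) (auto simp: test_on_cmult)
qed

lemma appr_sum:
  "finite I \<Longrightarrow> (\<And>i. i \<in> I \<Longrightarrow> appr a b (f i)) \<Longrightarrow> appr a b (\<lambda>x. \<Sum>i\<in>I. f i x)"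
  by (induction I rule: finite_induct) (auto intro: appr_add appr_test test_on_0)

section \<open>Periodic bumps for boxes and approximation of indicators\<close>

text \<open>
  Changes sign under a unit shift in each factor, hence is 1-periodic, and on \<open>[0,1)\<close> it is positive
  exactly on \<open>(p,q)\<close> if \<open>0 \<le> p < q \<le> 1\<close>: this yields periodic bumps without summing over translates.
\<close>

definition sin_gap :: "real \<Rightarrow> real \<Rightarrow> real \<Rightarrow> real" where
  "sin_gap p q y = sin (pi * (y - p)) * sin (pi * (q - y))"

lemma sin_gap_periodic: "sin_gap p q (y + 1) = sin_gap p q y"
proof -
  have "sin (pi * (y + 1 - p)) = - sin (pi * (y - p))"
    using sin_periodic_pi[of "pi * (y - p)"] by (simp add: algebra_simps)
  moreover have "sin (pi * (q - (y + 1))) = - sin (pi * (q - y))"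
    using sin_minus_pi[of "pi * (q - y)"] by (simp add: algebra_simps)
  ultimately show ?thesis by (simp add: sin_gap_def)
qed

lemma sin_gap_pos:
  assumes "0 \<le> p" "q \<le> 1" "p < y" "y < q" shows "sin_gap p q y > 0"
proof -
  have "0 < pi * (y - p)" "0 < pi * (q - y)" using assms by auto
  moreover have "pi * (y - p) < pi * 1" "pi * (q - y) < pi * 1"
    using assms by (intro mult_strict_left_mono; simp)+
  ultimately show ?thesis unfolding sin_gap_def using assms by (intro mult_pos_pos sin_gt_zero) auto
qed

lemma sin_gap_nonpos:
  assumes "0 \<le> p" "p < q" "q \<le> 1" "0 \<le> y" "y < 1" "y \<le> p \<or> q \<le> y" shows "sin_gap p q y \<le> 0"
proof -
  have pos: "0 \<le> sin (pi * t)" if "0 \<le> t" "t \<le> 1" for t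
    using that by (intro sin_ge_zero) (auto intro: mult_left_le)
  have neg: "sin (pi * t) \<le> 0" if "t \<le> 0" "-1 \<le> t" for t
    using pos[of "-t"] that by simp
  show ?thesis
    unfolding sin_gap_def
  proof (cases "y \<le> p")
    case True
    then show "sin (pi * (y - p)) * sin (pi * (q - y)) \<le> 0"
      using assms by (intro mult_nonpos_nonneg neg pos) auto
  next
    case False
    then show "sin (pi * (y - p)) * sin (pi * (q - y)) \<le> 0"
      using assms by (intro mult_nonneg_nonpos neg pos) auto
  qed
qed

lemma smooth_sin_gap: "smooth (\<lambda>x. sin_gap p q (x$i))"
  unfolding sin_gap_def by (intro smooth_mult smooth_sin smooth_diff smooth_const smooth_nth)

lemma bump_tendsto_1:
  assumes "filterlim f at_top F" shows "((\<lambda>n. bump (f n)) \<longlongrightarrow> 1) F"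
proof -
  have "((\<lambda>n. exp (- inverse (f n))) \<longlongrightarrow> exp (- 0)) F"
    by (intro tendsto_intros tendsto_inverse_0_at_top assms)
  moreover have "\<forall>\<^sub>F n in F. f n > 0"
    using assms by (auto simp: filterlim_at_top_dense)
  ultimately show ?thesis
    by (auto elim!: Lim_transform_eventually eventually_mono simp: bump_eq inverse_eq_divide)
qed

lemma filterlim_scale_at_top:
  assumes "c > 0" shows "filterlim (\<lambda>n. real n * c + d) at_top sequentially"
proof -
  have "filterlim (\<lambda>n. real n * c) at_top sequentially"
    by (rule filterlim_at_top_mult_tendsto_pos[OF tendsto_const assms filterlim_real_sequentially])
  from filterlim_tendsto_add_at_top[OF tendsto_const[of d] this]
  show ?thesis by (simp add: add.commute)
qed

definition open_cell :: "real \<Rightarrow> real \<Rightarrow> (real^3) set" where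
  "open_cell a b = {x. 0 < x$1 \<and> x$1 < 1 \<and> 0 < x$2 \<and> x$2 < 1 \<and> a < x$3 \<and> x$3 < b}"

definition bumps_to :: "real \<Rightarrow> real \<Rightarrow> (real^3) set \<Rightarrow> (nat \<Rightarrow> real^3 \<Rightarrow> real) \<Rightarrow> bool" where
  "bumps_to a b S \<beta> \<longleftrightarrow> (\<forall>n. test_on a b (\<beta> n)) \<and> (\<forall>n x. 0 \<le> \<beta> n x \<and> \<beta> n x \<le> 1) \<and>
    (\<forall>x\<in>cell - S. \<forall>n. \<beta> n x = 0) \<and> (\<forall>x\<in>S. (\<lambda>n. \<beta> n x) \<longlonglongrightarrow> 1)"

text \<open>\<open>bump (n * y)\<close> tends to 1 where \<open>y > 0\<close> and is 0 elsewhere, so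
  a product of such factors, one for each side condition, increases the contrast with
  \<open>n\<close> and converges to the indicator of the box.\<close>

lemma bump_box:
  assumes "box l u \<subseteq> open_cell a b"
  shows "\<exists>\<beta>. bumps_to a b (box l u) \<beta>"
proof (cases "box l u = {}")
  case True
  then show ?thesis by (intro exI[of _ "\<lambda>_ _. 0"]) (auto simp: test_on_0 bumps_to_def)
next
  case False
  then obtain y where "y \<in> box l u" by blast
  then have lu: "l$i < u$i" for i
    using less_trans[of "l$i" "y$i" "u$i"] by (auto simp: mem_box_cart)
  have oc: "open_cell a b = box (vector [0,0,a]) (vector [1,1,b])"
    by (auto simp: open_cell_def mem_box_cart forall_3)
  have "\<forall>i. (vector [0,0,a] :: real^3) $ i \<le> l$i \<and> u$i \<le> (vector [1,1,b] :: real^3) $ i"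
  proof -
    have "\<forall>k\<in>Basis. l \<bullet> k < u \<bullet> k"
      using lu by (auto simp: Basis_vec_def inner_axis_nth)
    then have "\<forall>k\<in>Basis. vector [0,0,a] \<bullet> k \<le> l \<bullet> k \<and> u \<bullet> k \<le> vector [1,1,b] \<bullet> k"
      using assms unfolding oc subset_box by blast
    then have "\<forall>i. (vector [0,0,a] :: real^3) \<bullet> axis i 1 \<le> l \<bullet> axis i 1 \<and> u \<bullet> axis i 1 \<le> (vector [1,1,b] :: real^3) \<bullet> axis i 1"
      by (simp add: axis_in_Basis_iff)
    then show ?thesis by (simp add: inner_axis_nth)
  qed
  then have bd: "0 \<le> l$1" "u$1 \<le> 1" "0 \<le> l$2" "u$2 \<le> 1" "a \<le> l$3" "u$3 \<le> b"
    by (auto simp: forall_3)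
  \<comment> \<open>The summand \<open>-1\<close> makes the vertical factors vanish already within
    distance 1 / n of the faces of the box, the margin that a test function needs. Horizontally
    periodicity takes care of everything.\<close>
  define \<beta> where "\<beta> n x = bump (real n * sin_gap (l$1) (u$1) (x$1)) * bump (real n * sin_gap (l$2) (u$2) (x$2))
    * (bump (real n * (x$3 - l$3) + (-1)) * bump (real n * (u$3 - x$3) + (-1)))" for n and x :: "real^3"
  have "test_on a b (\<beta> n)" for n
    unfolding test_on_def
  proof (intro conjI)
    show "smooth (\<beta> n)"
      unfolding \<beta>_def
      by (intro smooth_mult smooth_bump smooth_add smooth_diff smooth_const smooth_nth smooth_sin_gap)
    show "periodic_on UNIV (\<beta> n)"
      by (simp add: periodic_on_def \<beta>_def sin_gap_periodic)
    \<comment> \<open>The denominator \<open>real n + 1\<close> gives a margin that also makes sense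
      for \<open>n = 0\<close>.\<close>
    have "\<beta> n x = 0" if "x$3 < a + 1 / (real n + 1) \<or> b - 1 / (real n + 1) < x$3" for x
    proof -
      have *: "real n * t \<le> 1" if "t < 1 / (real n + 1)" for t
      proof (cases "t \<le> 0")
        case False
        then have "real n * t \<le> (real n + 1) * t" by simp
        also have "\<dots> < 1" using that by (simp add: field_simps)
        finally show ?thesis by simp
      qed (use mult_nonneg_nonpos[of "real n" t] in auto)
      from that have "x$3 - l$3 < 1 / (real n + 1) \<or> u$3 - x$3 < 1 / (real n + 1)"
        using bd by auto
      then have "real n * (x$3 - l$3) \<le> 1 \<or> real n * (u$3 - x$3) \<le> 1"
        using * by blast
      then show ?thesis by (auto simp: \<beta>_def bump_eq)
    qed
    then show "\<exists>\<epsilon>>0. \<forall>x. x$3 < a + \<epsilon> \<or> b - \<epsilon> < x$3 \<longrightarrow> \<beta> n x = 0"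
      by (intro exI[of _ "1 / (real n + 1)"]) auto
  qed
  moreover have "0 \<le> \<beta> n x \<and> \<beta> n x \<le> 1" for n x
    unfolding \<beta>_def by (intro conjI mult_nonneg_nonneg mult_le_one bump_nonneg bump_le_1)
  moreover have "\<beta> n x = 0" if "x \<in> cell - box l u" for n x
  proof -
    have c: "0 \<le> x$1" "x$1 < 1" "0 \<le> x$2" "x$2 < 1" using that by (auto simp: cell_def)
    have sg: "bump (real n * sin_gap p q y) = 0" if "sin_gap p q y \<le> 0" for p q y
      using mult_nonneg_nonpos[of "real n", OF _ that] by (auto simp: bump_eq)
    have z: "bump (real n * t + (-1)) = 0" if "t \<le> 0" for t
      using mult_nonneg_nonpos[of "real n", OF _ that] by (auto simp: bump_eq)
    from that have "(x$1 \<le> l$1 \<or> u$1 \<le> x$1) \<or> (x$2 \<le> l$2 \<or> u$2 \<le> x$2) \<or> x$3 - l$3 \<le> 0 \<or> u$3 - x$3 \<le> 0"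
      by (auto simp: mem_box_cart forall_3 not_less)
    then consider "x$1 \<le> l$1 \<or> u$1 \<le> x$1" | "x$2 \<le> l$2 \<or> u$2 \<le> x$2"
      | "x$3 - l$3 \<le> 0" | "u$3 - x$3 \<le> 0" by blast
    then show ?thesis
    proof cases
      case 1
      then have "sin_gap (l$1) (u$1) (x$1) \<le> 0" using bd c lu by (intro sin_gap_nonpos) auto
      from sg[OF this] show ?thesis by (simp add: \<beta>_def)
    next
      case 2
      then have "sin_gap (l$2) (u$2) (x$2) \<le> 0" using bd c lu by (intro sin_gap_nonpos) auto
      from sg[OF this] show ?thesis by (simp add: \<beta>_def)
    next
      case 3
      from z[OF this] show ?thesis by (simp add: \<beta>_def)
    next
      case 4
      from z[OF this] show ?thesis by (simp add: \<beta>_def)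
    qed
  qed
  moreover have "(\<lambda>n. \<beta> n x) \<longlonglongrightarrow> 1" if "x \<in> box l u" for x
  proof -
    have x: "l$i < x$i" "x$i < u$i" for i using that by (auto simp: mem_box_cart)
    have "(\<lambda>n. \<beta> n x) \<longlonglongrightarrow> 1 * 1 * (1 * 1)"
      unfolding \<beta>_def
      using x bd filterlim_scale_at_top[of "sin_gap (l$1) (u$1) (x$1)" 0] filterlim_scale_at_top[of "sin_gap (l$2) (u$2) (x$2)" 0]
      by (intro tendsto_mult bump_tendsto_1 filterlim_scale_at_top) (auto simp: sin_gap_pos)
    then show ?thesis by simp
  qed
  ultimately have "bumps_to a b (box l u) \<beta>" unfolding bumps_to_def by blast
  then show ?thesis by blast
qed

lemma sets_open_cell [measurable]: "open_cell a b \<in> sets borel"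
  unfolding open_cell_def by measurable

text \<open>
  The indicator of a union of boxes is the limit of \<open>1 - (1 - \<beta>\<^sub>1) \<dots> (1 - \<beta>\<^sub>n)\<close>, with bumps \<open>\<beta>\<^sub>j\<close> for the
  single boxes.
\<close>

lemma appr_open:
  assumes U: "open U" "U \<subseteq> open_cell a b" and ab: "0 \<le> a" "b \<le> 1"
  shows "appr a b (indicator U)"
proof -
  obtain \<D> where D: "countable \<D>" "\<D> \<subseteq> Pow U" "\<And>X. X \<in> \<D> \<Longrightarrow> \<exists>l u. X = box l u" "\<Union>\<D> = U"
    using open_countable_Union_open_box[OF U(1)] by blast
  show ?thesis
  proof (cases "\<D> = {}")
    case True
    then have "U = {}" using D by auto
    then show ?thesis using appr_test[OF test_on_0] by (simp add: indicator_def[abs_def])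
  next
    case False
    define B where "B = from_nat_into \<D>"
    have rB: "range B = \<D>" using False D(1) by (simp add: B_def range_from_nat_into)
    have UB: "y \<in> U \<longleftrightarrow> (\<exists>j. y \<in> B j)" for y
      unfolding D(4)[symmetric] rB[symmetric] by blast
    have "\<exists>\<beta>. bumps_to a b (B j) \<beta>" for j
    proof -
      have "B j \<in> \<D>" using rB by auto
      then obtain l u where "B j = box l u" "box l u \<subseteq> open_cell a b"
        using D(2,3) U(2) by (metis Pow_iff subset_iff)
      then show ?thesis using bump_box by simp
    qed
    then obtain \<beta> where "\<And>j. bumps_to a b (B j) (\<beta> j)" by metis
    then have b1: "test_on a b (\<beta> j n)" and b2: "0 \<le> \<beta> j n x" and b3: "\<beta> j n x \<le> 1"
      and b4: "x \<in> cell - B j \<Longrightarrow> \<beta> j n x = 0" and b5: "x \<in> B j \<Longrightarrow> (\<lambda>n. \<beta> j n x) \<longlonglongrightarrow> 1" for j n x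
      unfolding bumps_to_def by simp_all
    define \<phi> where "\<phi> = (\<lambda>n x. 1 - (\<Prod>j<n. 1 - \<beta> j n x))"
    have tp: "test_on a b (\<lambda>x. 1 - (\<Prod>j<m. 1 - \<beta> j n x))" for m n
    proof (induction m)
      case 0 then show ?case by (simp add: test_on_0)
    next
      case (Suc m)
      \<comment> \<open>One more factor in the product adds the old product times
        \<open>\<beta> m n\<close>: a smooth periodic function times a test function, although the
        product itself is not a test function.\<close>
      have "test_on a b (\<lambda>x. (1 - (\<Prod>j<m. 1 - \<beta> j n x)) + (\<Prod>j<m. 1 - \<beta> j n x) * \<beta> m n x)"
      proof (intro test_on_add Suc test_on_mult b1)
        show "smooth (\<lambda>x. \<Prod>j<m. 1 - \<beta> j n x)"
          using b1 by (intro smooth_prod smooth_diff smooth_const) (simp_all add: test_on_def)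
        have "periodic_on UNIV (\<beta> j n)" for j using b1 by (simp add: test_on_def)
        then show "periodic_on UNIV (\<lambda>x. \<Prod>j<m. 1 - \<beta> j n x)"
          by (simp add: periodic_on_def)
      qed
      then show ?case by (simp add: algebra_simps)
    qed
    have p01: "0 \<le> (\<Prod>j<n. 1 - \<beta> j n x)" "(\<Prod>j<n. 1 - \<beta> j n x) \<le> 1" for n x
      by (intro prod_nonneg; simp add: b3) (intro prod_le_1; simp add: b2 b3)
    have conv: "(\<lambda>n. indicator U x - \<phi> n x) \<longlonglongrightarrow> 0" if "x \<in> cell" for x
    proof (cases "x \<in> U")
      case True
      then obtain j where j: "x \<in> B j" using UB by blast
      \<comment> \<open>A single box containing \<open>x\<close> is enough: its factor tends to 0
        and the other factors lie between 0 and 1.\<close>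
      have "(\<Prod>j<n. 1 - \<beta> j n x) \<le> 1 - \<beta> j n x" if "n > j" for n
      proof -
        have "(\<Prod>j<n. 1 - \<beta> j n x) = (1 - \<beta> j n x) * (\<Prod>j\<in>{..<n} - {j}. 1 - \<beta> j n x)"
          using that by (intro prod.remove) auto
        also have "\<dots> \<le> (1 - \<beta> j n x) * 1"
          using b2 b3 by (intro mult_left_mono prod_le_1) auto
        finally show ?thesis by simp
      qed
      then have up: "\<forall>\<^sub>F n in sequentially. (\<Prod>j<n. 1 - \<beta> j n x) \<le> 1 - \<beta> j n x"
        using eventually_gt_at_top[of j] by (rule eventually_mono[rotated])
      have lo: "\<forall>\<^sub>F n in sequentially. 0 \<le> (\<Prod>j<n. 1 - \<beta> j n x)"
        by (intro always_eventually allI p01)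
      have "(\<lambda>n. 1 - \<beta> j n x) \<longlonglongrightarrow> 1 - 1"
        by (intro tendsto_diff tendsto_const b5 j)
      then have "(\<lambda>n. 1 - \<beta> j n x) \<longlonglongrightarrow> 0" by (simp only: diff_self)
      from tendsto_sandwich[OF lo up tendsto_const this]
      have "(\<lambda>n. \<Prod>j<n. 1 - \<beta> j n x) \<longlonglongrightarrow> 0" .
      then show ?thesis using True by (simp add: \<phi>_def)
    next
      case False
      then have "x \<in> cell - B j" for j using UB that by blast
      then show ?thesis using False b4 by (simp add: \<phi>_def)
    qed
    have ap: "appr a b (\<phi> n)" for n unfolding \<phi>_def by (rule appr_test[OF tp])
    have [measurable]: "U \<in> sets borel" using U(1) by simp
    have [measurable]: "\<phi> n \<in> borel_measurable borel" for n
      using ap by (simp add: appr_def sqint_def)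
    have lim: "(\<lambda>n. nrm (\<lambda>x. indicator U x - \<phi> n x)) \<longlonglongrightarrow> 0"
    proof (rule nrm_tendsto_0[where w = "\<lambda>x. 1"])
      show "AE x in nu. \<bar>indicator U x - \<phi> n x\<bar> \<le> \<bar>1\<bar>" for n
        using p01[of n] by (intro AE_I2) (simp add: \<phi>_def indicator_def)
      show "AE x in nu. (\<lambda>n. indicator U x - \<phi> n x) \<longlonglongrightarrow> 0"
        using conv by (rule AE_nu_cell)
    qed (simp_all add: sqint_const)
    have "sqint (indicator U)" by (rule sqint_bounded[of _ 1]) auto
    then show ?thesis using ap lim by (rule appr_limit)
  qed
qed

lemma AE_nth_neq_0: "AE x::real^3 in lborel. x$i \<noteq> 0"
proof -
  have "{x::real^3. x$i = 0} \<in> null_sets lebesgue"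
    using negligible_standard_hyperplane_cart[of i] by (simp add: negligible_iff_null_sets)
  then have "AE x::real^3 in lebesgue. x \<notin> {x. x$i = 0}" by (rule AE_not_in)
  then show ?thesis by (simp add: AE_completion_iff)
qed

text \<open>The cell contains its faces at \<open>x$1 = 0\<close> and \<open>x$2 = 0\<close>, which
  open sets inside \<open>open_cell\<close> cannot cover; they are null sets.\<close>

lemma AE_open_cell: "AE x in nu. x \<in> strip a b \<longrightarrow> x \<in> open_cell a b"
  unfolding AE_nu_iff using AE_nth_neq_0[of 1] AE_nth_neq_0[of 2]
  by eventually_elim (auto simp: strip_def open_cell_def cell_def)

lemma open_open_cell: "open (open_cell a b)"
  unfolding open_cell_def by (intro open_Collect_conj open_Collect_less continuous_intros)

lemma appr_indicator:
  assumes [measurable]: "A \<in> sets borel" and ab: "0 \<le> a" "b \<le> 1"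
  shows "appr a b (indicator (A \<inter> strip a b))"
proof -
  define A' where "A' = A \<inter> open_cell a b"
  have [measurable]: "A' \<in> sets borel" unfolding A'_def by measurable
  have "\<exists>U. open U \<and> A' \<subseteq> U \<and> U \<subseteq> open_cell a b \<and> measure nu (U - A') \<le> 1 / real (Suc n)" for n
  proof -
    \<comment> \<open>Outer regularity of the finite measure \<open>nu\<close>; afterwards the open
      set is intersected with the open cell, which contains \<open>A'\<close>, so that
      \<open>appr_open\<close> applies.\<close>
    have "(INF U \<in> {U. A' \<subseteq> U \<and> open U}. emeasure nu U) < emeasure nu A' + ennreal (1 / real (Suc n))"
      unfolding outer_regular[OF sets_nu nu.emeasure_finite[of "space nu", simplified infinity_ennreal_def[symmetric]] \<open>A' \<in> sets borel\<close>, symmetric]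
      by (simp add: nu.emeasure_eq_measure ennreal_plus[symmetric] ennreal_less_iff del: ennreal_plus)
    then obtain U where U: "A' \<subseteq> U" "open U" "emeasure nu U < emeasure nu A' + ennreal (1 / real (Suc n))"
      by (auto simp: INF_less_iff)
    have [measurable]: "U \<in> sets borel" using U by simp
    have "ennreal (measure nu U) < ennreal (measure nu A' + 1 / real (Suc n))"
      using U(3) by (simp add: nu.emeasure_eq_measure ennreal_plus[symmetric] del: ennreal_plus)
    then have "measure nu U < measure nu A' + 1 / real (Suc n)"
      by (simp add: ennreal_less_iff ennreal_plus[symmetric] del: ennreal_plus)
    moreover have "measure nu (U - A') = measure nu U - measure nu A'"
      using U by (intro nu.finite_measure_Diff) auto
    moreover have "measure nu (U \<inter> open_cell a b - A') \<le> measure nu (U - A')"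
      by (intro nu.finite_measure_mono) auto
    ultimately show ?thesis
      using U open_open_cell by (intro exI[of _ "U \<inter> open_cell a b"]) (auto simp: A'_def)
  qed
  then obtain U where U: "\<And>n. open (U n)" "\<And>n. A' \<subseteq> U n" "\<And>n. U n \<subseteq> open_cell a b"
    "\<And>n. measure nu (U n - A') \<le> 1 / real (Suc n)" by metis
  have [measurable]: "U n \<in> sets borel" for n using U(1) by simp
  have "appr a b (indicator A')"
  proof (rule appr_limit[where f = "\<lambda>n. indicator (U n)"])
    show "sqint (indicator A')" by (rule sqint_bounded[of _ 1]) auto
    show "appr a b (indicator (U n))" for n using U ab by (intro appr_open)
    have "nrm (\<lambda>x. indicator A' x - indicator (U n) x) \<le> sqrt (1 / real (Suc n))" for n
    proof -
      have "(\<integral>x. (indicator A' x - indicator (U n) x)\<^sup>2 \<partial>nu) = (\<integral>x. (indicator (U n - A') x :: real) \<partial>nu)"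
        using U(2)[of n] by (intro Bochner_Integration.integral_cong) (auto simp: indicator_def)
      also have "\<dots> = measure nu (U n - A')" by simp
      finally show ?thesis using U(4)[of n] unfolding nrm_def by simp
    qed
    then have bd: "\<forall>\<^sub>F n in sequentially. norm (nrm (\<lambda>x. indicator A' x - indicator (U n) x)) \<le> sqrt (1 / real (Suc n))"
      by (intro always_eventually allI) simp
    have "(\<lambda>n. sqrt (inverse (real (Suc n)))) \<longlonglongrightarrow> sqrt 0"
      by (intro tendsto_real_sqrt LIMSEQ_inverse_real_of_nat)
    then have "(\<lambda>n. sqrt (1 / real (Suc n))) \<longlonglongrightarrow> 0"
      by (simp only: inverse_eq_divide real_sqrt_zero)
    from Lim_null_comparison[OF bd this]
    show "(\<lambda>n. nrm (\<lambda>x. indicator A' x - indicator (U n) x)) \<longlonglongrightarrow> 0" .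
  qed
  then show ?thesis
  proof (rule appr_cong_AE)
    show "AE x in nu. indicator A' x = (indicator (A \<inter> strip a b) x :: real)"
      using AE_open_cell[of a b]
      by eventually_elim (auto simp: A'_def indicator_def open_cell_def strip_def)
  qed (measurable)
qed

lemma appr_all:
  assumes k: "sqint k" "\<And>x. x \<in> cell \<Longrightarrow> x \<notin> strip a b \<Longrightarrow> k x = 0" and ab: "0 \<le> a" "b \<le> 1"
  shows "appr a b k"
proof -
  have [measurable]: "k \<in> borel_measurable borel" using k by (simp add: sqint_def)
  then have "k \<in> borel_measurable nu" by simp
  from borel_measurable_implies_sequence_metric[OF this, of 0]
  obtain s where s: "\<And>i. simple_function nu (s i)" "\<And>x. (\<lambda>i. s i x) \<longlonglongrightarrow> k x"
    "\<And>i x. \<bar>s i x\<bar> \<le> 2 * \<bar>k x\<bar>" by auto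
  have [measurable]: "s i \<in> borel_measurable borel" for i
    using borel_measurable_simple_function[OF s(1)] by simp
  have "appr a b (s i)" for i
  proof -
    have fin: "finite (range (s i))" using simple_functionD(1)[OF s(1), of i] by simp
    have "s i -` {y} \<in> sets borel" for y
      using measurable_sets[of "s i" borel borel "{y}"] by simp
    then have "appr a b (\<lambda>x. \<Sum>y\<in>range (s i). y * indicator (s i -` {y} \<inter> strip a b) x)"
      using ab by (intro appr_sum appr_cmult appr_indicator fin) auto
    then show ?thesis
    proof (rule appr_cong_AE)
      have "(\<Sum>y\<in>range (s i). y * indicator (s i -` {y} \<inter> strip a b) x) = s i x" if x: "x \<in> cell" for x
      proof (cases "x \<in> strip a b")
        case True
        then have "(\<Sum>y\<in>range (s i). y * indicator (s i -` {y} \<inter> strip a b) x)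
           = (\<Sum>y\<in>range (s i). indicator (s i -` {y} \<inter> UNIV) x *\<^sub>R y)"
          by (intro sum.cong) (auto simp: indicator_def)
        also have "\<dots> = s i x"
          by (rule simple_function_indicator_representation_banach[OF s(1), of x i, unfolded space_nu, OF UNIV_I, symmetric])
        finally show ?thesis .
      next
        case False
        \<comment> \<open>The bound by twice \<open>k\<close> forces the simple functions to vanish
          wherever \<open>k\<close> does, hence off the strip.\<close>
        then have "s i x = 0" using s(3)[of i x] k(2)[OF x] by simp
        then show ?thesis using False by simp
      qed
      then show "AE x in nu. (\<Sum>y\<in>range (s i). y * indicator (s i -` {y} \<inter> strip a b) x) = s i x"
        by (rule AE_nu_cell)
    qed (measurable)
  qed
  moreover have "(\<lambda>i. nrm (\<lambda>x. k x - s i x)) \<longlonglongrightarrow> 0"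
  proof (rule nrm_tendsto_0[where w = "\<lambda>x. 3 * k x"])
    show "AE x in nu. \<bar>k x - s i x\<bar> \<le> \<bar>3 * k x\<bar>" for i
    proof (rule AE_I2)
      fix x show "\<bar>k x - s i x\<bar> \<le> \<bar>3 * k x\<bar>"
        using s(3)[of i x] by (simp add: abs_if split: if_splits)
    qed
    show "AE x in nu. (\<lambda>i. k x - s i x) \<longlonglongrightarrow> 0"
    proof (rule AE_I2)
      fix x show "(\<lambda>i. k x - s i x) \<longlonglongrightarrow> 0"
        using tendsto_diff[OF tendsto_const[of "k x"] s(2)[of x]] by (simp only: diff_self)
    qed
  qed (simp_all add: sqint_cmult k(1))
  ultimately show ?thesis by (rule appr_limit[OF k(1)])
qed

lemma appr_seq:
  assumes "appr a b k"
  obtains \<phi> where "\<And>n. test_on a b (\<phi> n)" "(\<lambda>n. nrm (\<lambda>x. k x - \<phi> n x)) \<longlonglongrightarrow> 0"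
proof -
  have "\<exists>\<phi>. test_on a b \<phi> \<and> nrm (\<lambda>x. k x - \<phi> x) < 1 / real (Suc n)" for n
    using assms by (simp add: appr_def)
  then obtain \<phi> where \<phi>: "\<And>n. test_on a b (\<phi> n)" "\<And>n. nrm (\<lambda>x. k x - \<phi> n x) < 1 / real (Suc n)"
    by metis
  have "(\<lambda>n. 1 / real (Suc n)) \<longlonglongrightarrow> 0"
    using LIMSEQ_inverse_real_of_nat by (simp add: inverse_eq_divide)
  then have "(\<lambda>n. nrm (\<lambda>x. k x - \<phi> n x)) \<longlonglongrightarrow> 0"
    using \<phi>(2) by (intro Lim_null_comparison[of "\<lambda>n. nrm (\<lambda>x. k x - \<phi> n x)"] always_eventually)
      (simp_all add: less_imp_le)
  with \<phi>(1) show ?thesis by (rule that)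
qed

section \<open>Estimates by duality with test functions\<close>

lemma integral_mult_tendsto:
  assumes "sqint v" "sqint k" "\<And>n. sqint (f n)" "((\<lambda>n. nrm (\<lambda>x. k x - f n x)) \<longlongrightarrow> 0) F"
  shows "((\<lambda>n. \<integral>x. v x * f n x \<partial>nu) \<longlongrightarrow> (\<integral>x. v x * k x \<partial>nu)) F"
proof (rule Lim_transform2[OF tendsto_const])
  have "\<bar>(\<integral>x. v x * k x \<partial>nu) - (\<integral>x. v x * f n x \<partial>nu)\<bar> \<le> nrm v * nrm (\<lambda>x. k x - f n x)" for n
  proof -
    have "(\<integral>x. v x * k x \<partial>nu) - (\<integral>x. v x * f n x \<partial>nu) = (\<integral>x. v x * (k x - f n x) \<partial>nu)"
      using assms by (subst Bochner_Integration.integral_diff[symmetric]) (auto intro: sqint_mult_integrable simp: algebra_simps)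
    then show ?thesis using assms by (simp add: nrm_Cauchy_Schwarz sqint_diff)
  qed
  moreover have "((\<lambda>n. nrm v * nrm (\<lambda>x. k x - f n x)) \<longlongrightarrow> 0) F"
    using tendsto_mult_left[OF assms(4), of "nrm v"] by simp
  ultimately show "((\<lambda>n. (\<integral>x. v x * k x \<partial>nu) - (\<integral>x. v x * f n x \<partial>nu)) \<longlongrightarrow> 0) F"
    by (intro Lim_null_comparison[where f = "\<lambda>n. (\<integral>x. v x * k x \<partial>nu) - (\<integral>x. v x * f n x \<partial>nu)"]) auto
qed

lemma dual_L2_bound:
  assumes "sqint v" "appr a b k" "\<And>\<phi>. test_on a b \<phi> \<Longrightarrow> \<bar>\<integral>x. v x * \<phi> x \<partial>nu\<bar> \<le> N * nrm \<phi>"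
  shows "\<bar>\<integral>x. v x * k x \<partial>nu\<bar> \<le> N * nrm k"
proof -
  obtain \<phi> where \<phi>: "\<And>n. test_on a b (\<phi> n)" "(\<lambda>n. nrm (\<lambda>x. k x - \<phi> n x)) \<longlonglongrightarrow> 0"
    using appr_seq[OF assms(2)] by blast
  have sqs: "sqint k" "sqint (\<phi> n)" for n
    using assms(2) test_on_sq[OF \<phi>(1)] by (simp_all add: appr_def)
  have 1: "(\<lambda>n. \<bar>\<integral>x. v x * \<phi> n x \<partial>nu\<bar>) \<longlonglongrightarrow> \<bar>\<integral>x. v x * k x \<partial>nu\<bar>"
    using assms \<phi> sqs by (intro tendsto_rabs integral_mult_tendsto)
  have "(\<lambda>n. nrm (\<phi> n)) \<longlonglongrightarrow> nrm k"
  proof (rule Lim_transform2[OF tendsto_const])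
    have "\<bar>nrm k - nrm (\<phi> n)\<bar> \<le> nrm (\<lambda>x. k x - \<phi> n x)" for n
      using nrm_triangle[OF sqs(2)[of n] sqint_diff[OF sqs(1) sqs(2)[of n]]]
        nrm_triangle[OF sqs(1) sqint_diff[OF sqs(2)[of n] sqs(1)]] nrm_minus_commute[of k "\<phi> n"]
      by simp
    then show "(\<lambda>n. nrm k - nrm (\<phi> n)) \<longlonglongrightarrow> 0"
      by (intro Lim_null_comparison[OF _ \<phi>(2)]) auto
  qed
  then have 2: "(\<lambda>n. N * nrm (\<phi> n)) \<longlonglongrightarrow> N * nrm k" by (intro tendsto_mult_left)
  show ?thesis using assms(3) \<phi>(1) by (intro LIMSEQ_le[OF 1 2]) auto
qed

text \<open>The restriction of \<open>v\<close> to the strip is itself a limit of test functions, so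
  testing with it gives the squared norm of \<open>v\<close> there.\<close>

lemma dual_L2_zero:
  assumes v: "sqint v" and ab: "0 \<le> a" "b \<le> 1" and 0: "\<And>\<phi>. test_on a b \<phi> \<Longrightarrow> (\<integral>x. v x * \<phi> x \<partial>nu) = 0"
  shows "AE x in nu. x \<in> strip a b \<longrightarrow> v x = 0"
proof -
  let ?k = "\<lambda>x. indicator (strip a b) x * v x"
  have k: "sqint ?k" by (rule sqint_mult_bounded[OF v, of _ 1]) auto
  have "appr a b ?k" using k ab by (intro appr_all) auto
  from dual_L2_bound[OF v this, of 0] 0 have "(\<integral>x. v x * ?k x \<partial>nu) = 0" by simp
  also have "(\<integral>x. v x * ?k x \<partial>nu) = (\<integral>x. (?k x)\<^sup>2 \<partial>nu)"
    by (intro Bochner_Integration.integral_cong) (auto simp: indicator_def power2_eq_square)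
  finally have "nrm ?k = 0" by (simp add: nrm_def)
  from nrm_eq_0[OF k this] show ?thesis by eventually_elim (auto simp: indicator_def)
qed

text \<open>Tested with the sign of \<open>v\<close> on the part of the strip where its modulus
  exceeds \<open>M\<close>, the assumption makes the integral of the excess nonpositive, so that
  this set is null. The sign is only an L2 limit of test functions, but L1 norms converge as well
  because \<open>nu\<close> is finite.\<close>

lemma dual_Linf_bound:
  assumes v: "sqint v" and ab: "0 \<le> a" "b \<le> 1" and M: "0 \<le> M"
    and bd: "\<And>\<phi>. test_on a b \<phi> \<Longrightarrow> \<bar>\<integral>x. v x * \<phi> x \<partial>nu\<bar> \<le> M * (\<integral>x. \<bar>\<phi> x\<bar> \<partial>nu)"
  shows "AE x in nu. x \<in> strip a b \<longrightarrow> \<bar>v x\<bar> \<le> M"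
proof -
  note [measurable] = sqint_borel[OF v]
  define S where "S = {x. \<bar>v x\<bar> > M} \<inter> strip a b"
  have [measurable]: "S \<in> sets borel" unfolding S_def by measurable
  define k where "k x = indicator S x * sgn (v x)" for x
  have k: "sqint k" unfolding k_def by (rule sqint_bounded[of _ 1]) (auto simp: indicator_def sgn_if)
  have "appr a b k" using k ab by (intro appr_all) (auto simp: k_def S_def)
  then obtain \<phi> where \<phi>: "\<And>n. test_on a b (\<phi> n)" "(\<lambda>n. nrm (\<lambda>x. k x - \<phi> n x)) \<longlonglongrightarrow> 0"
    using appr_seq by blast
  have sqs: "sqint (\<phi> n)" for n by (rule test_on_sq[OF \<phi>(1)])
  have 1: "(\<lambda>n. \<bar>\<integral>x. v x * \<phi> n x \<partial>nu\<bar>) \<longlonglongrightarrow> \<bar>\<integral>x. v x * k x \<partial>nu\<bar>"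
    using v k \<phi> sqs by (intro tendsto_rabs integral_mult_tendsto)
  have "(\<lambda>n. \<integral>x. 1 * \<bar>\<phi> n x\<bar> \<partial>nu) \<longlonglongrightarrow> (\<integral>x. 1 * \<bar>k x\<bar> \<partial>nu)"
  proof (rule integral_mult_tendsto[OF sqint_const sqint_abs[OF k] sqint_abs[OF sqs]])
    have "nrm (\<lambda>x. \<bar>k x\<bar> - \<bar>\<phi> n x\<bar>) \<le> 1 * nrm (\<lambda>x. k x - \<phi> n x)" for n
      using sqint_borel[OF k] sqint_borel[OF sqs] by (intro nrm_mono sqint_diff k sqs) auto
    then show "(\<lambda>n. nrm (\<lambda>x. \<bar>k x\<bar> - \<bar>\<phi> n x\<bar>)) \<longlonglongrightarrow> 0"
      by (intro Lim_null_comparison[OF _ \<phi>(2)]) auto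
  qed
  then have 2: "(\<lambda>n. M * (\<integral>x. \<bar>\<phi> n x\<bar> \<partial>nu)) \<longlonglongrightarrow> M * (\<integral>x. \<bar>k x\<bar> \<partial>nu)"
    by (intro tendsto_mult_left) simp
  have le: "\<bar>\<integral>x. v x * k x \<partial>nu\<bar> \<le> M * (\<integral>x. \<bar>k x\<bar> \<partial>nu)"
    using bd \<phi>(1) by (intro LIMSEQ_le[OF 1 2]) auto
  have int: "integrable nu (\<lambda>x. v x * k x)" "integrable nu (\<lambda>x. M * \<bar>k x\<bar>)"
    using v k by (auto intro: sqint_mult_integrable sqint_integrable)
  have nn: "0 \<le> v x * k x - M * \<bar>k x\<bar>" for x
    by (auto simp: k_def S_def indicator_def sgn_if)
  have "(\<integral>x. v x * k x - M * \<bar>k x\<bar> \<partial>nu) = (\<integral>x. v x * k x \<partial>nu) - M * (\<integral>x. \<bar>k x\<bar> \<partial>nu)"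
    using int by simp
  also have "\<dots> \<le> 0" using le by linarith
  finally have "(\<integral>x. v x * k x - M * \<bar>k x\<bar> \<partial>nu) = 0"
    using nn by (intro antisym integral_nonneg_AE) auto
  then have "AE x in nu. v x * k x - M * \<bar>k x\<bar> = 0"
    using nn int by (subst (asm) integral_nonneg_eq_0_iff_AE) auto
  then show ?thesis
  proof eventually_elim
    case (elim x)
    show ?case
    proof (rule impI, rule ccontr)
      assume "x \<in> strip a b" "\<not> \<bar>v x\<bar> \<le> M"
      then have "v x * k x - M * \<bar>k x\<bar> > 0"
        using M by (auto simp: k_def S_def indicator_def sgn_if)
      then show False using elim by simp
    qed
  qed
qed

section \<open>Weak derivatives and Sobolev functions\<close>

text \<open>
  Representatives of \<open>L\<^sup>2(\<Omega>)\<close> for which translation, dilation and Fubini arguments need no null-set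
  bookkeeping.
\<close>

definition slabL2 :: "(real^3 \<Rightarrow> real) \<Rightarrow> bool" where
  "slabL2 f \<longleftrightarrow> sqint f \<and> periodic_on UNIV f \<and> (\<forall>x. x \<notin> slab \<longrightarrow> f x = 0)"

lemma slabL2_sq: "slabL2 f \<Longrightarrow> sqint f" by (simp add: slabL2_def)
lemma slabL2_borel [measurable_dest]: "slabL2 f \<Longrightarrow> f \<in> borel_measurable borel" by (simp add: slabL2_def sqint_def)
lemma slabL2_outside: "slabL2 f \<Longrightarrow> x \<notin> slab \<Longrightarrow> f x = 0" by (simp add: slabL2_def)
lemma slabL2_per: "slabL2 f \<Longrightarrow> periodic_on UNIV f" by (simp add: slabL2_def)

lemma slabL2_add: "slabL2 f \<Longrightarrow> slabL2 g \<Longrightarrow> slabL2 (\<lambda>x. f x + g x)"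
  by (auto simp: slabL2_def sqint_add periodic_on_def)

lemma slabL2_cmult: "slabL2 f \<Longrightarrow> slabL2 (\<lambda>x. c * f x)"
  by (auto simp: slabL2_def sqint_cmult periodic_on_def)

lemma slabL2_abs: "slabL2 f \<Longrightarrow> slabL2 (\<lambda>x. \<bar>f x\<bar>)"
  by (auto simp: slabL2_def sqint_abs periodic_on_def)

lemma slab_plus_axis [simp]: "x + axis 1 1 \<in> slab \<longleftrightarrow> x \<in> slab" "x + axis 2 1 \<in> slab \<longleftrightarrow> x \<in> slab"
  by (simp_all add: slab_def)

lemma slabL2_smooth_slab:
  assumes "smooth w" "periodic_on UNIV w"
  shows "slabL2 (\<lambda>x. indicator slab x * w x)"
  unfolding slabL2_def
proof (intro conjI)
  show "sqint (\<lambda>x. indicator slab x * w x)"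
    by (rule sqint_mult_bounded[OF smooth_sq[OF assms(1)], of _ 1]) (auto simp: indicator_def)
  show "periodic_on UNIV (\<lambda>x. indicator slab x * w x)"
    using assms(2) by (simp add: periodic_on_def indicator_def)
qed auto

lemma AE_nu_lebesgue: "(AE x in nu. P x) \<longleftrightarrow> (AE x in lebesgue_on cell. P x)"
  by (simp add: AE_nu_iff AE_restrict_space_iff AE_completion_iff)

lemma integral_cell:
  fixes g :: "real^3 \<Rightarrow> real"
  assumes [measurable]: "g \<in> borel_measurable borel"
  shows "integral\<^sup>L (lebesgue_on cell) g = integral\<^sup>L nu g"
    and "integrable (lebesgue_on cell) g \<longleftrightarrow> integrable nu g"
proof -
  have nu: "nu = density lborel (\<lambda>x. ennreal (indicator cell x))"
    by (simp add: nu_def ennreal_indicator)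
  have "integral\<^sup>L (lebesgue_on cell) g = (\<integral>x. indicator cell x *\<^sub>R g x \<partial>lebesgue)"
    by (subst integral_restrict_space) auto
  also have "\<dots> = (\<integral>x. indicator cell x *\<^sub>R g x \<partial>lborel)"
    by (rule integral_completion) measurable
  also have "\<dots> = integral\<^sup>L nu g"
    unfolding nu by (subst integral_density) auto
  finally show "integral\<^sup>L (lebesgue_on cell) g = integral\<^sup>L nu g" .
  have "integrable (lebesgue_on cell) g \<longleftrightarrow> integrable lebesgue (\<lambda>x. indicator cell x *\<^sub>R g x)"
    by (subst integrable_restrict_space) auto
  also have "\<dots> \<longleftrightarrow> integrable lborel (\<lambda>x. indicator cell x *\<^sub>R g x)"
    by (rule integrable_completion) measurable
  also have "\<dots> \<longleftrightarrow> integrable nu g"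
    unfolding nu by (subst integrable_density) auto
  finally show "integrable (lebesgue_on cell) g \<longleftrightarrow> integrable nu g" .
qed

lemma borel_lebesgue_on_cell: "g \<in> borel_measurable borel \<Longrightarrow> g \<in> borel_measurable (lebesgue_on cell)"
  by (intro measurable_restrict_space1 measurable_completion) simp

lemma integral_cell_AE:
  fixes f g :: "real^3 \<Rightarrow> real"
  assumes "f \<in> borel_measurable (lebesgue_on cell)" "g \<in> borel_measurable borel" "AE x in nu. f x = g x"
  shows "integral\<^sup>L (lebesgue_on cell) f = integral\<^sup>L nu g"
    and "integrable (lebesgue_on cell) f \<longleftrightarrow> integrable nu g"
proof -
  note ae = assms(3)[unfolded AE_nu_lebesgue]
  have g: "g \<in> borel_measurable (lebesgue_on cell)" using assms(2) by (rule borel_lebesgue_on_cell)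
  show "integral\<^sup>L (lebesgue_on cell) f = integral\<^sup>L nu g"
    using integral_cong_AE[OF assms(1) g ae] integral_cell(1)[OF assms(2)] by simp
  show "integrable (lebesgue_on cell) f \<longleftrightarrow> integrable nu g"
    using integrable_cong_AE[OF assms(1) g ae] integral_cell(2)[OF assms(2)] by simp
qed

lemma slabL2_L2: assumes "slabL2 f" shows "f \<in> L2"
proof -
  have f[measurable]: "f \<in> borel_measurable borel" using assms by (rule slabL2_borel)
  have "integrable (lebesgue_on cell) (\<lambda>x. (f x)\<^sup>2)"
    using assms by (subst integral_cell(2)) (auto simp: slabL2_def sqint_def)
  then show ?thesis using borel_lebesgue_on_cell[OF f] assms
    by (simp add: L2_def slabL2_def periodic_on_def)
qed

text \<open>A Borel version on the cell is obtained from the completion, extended periodically and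
  set to 0 outside the slab. The changes on the cell are confined to a null set.\<close>

lemma L2_rep: assumes "f \<in> L2" shows "\<exists>f'. slabL2 f' \<and> (AE x in nu. f x = f' x)"
proof -
  have fm: "f \<in> borel_measurable (lebesgue_on cell)" using assms by (simp add: L2_def)
  then have "(\<lambda>x. if x \<in> cell then f x else 0) \<in> borel_measurable lebesgue"
    by (rule borel_measurable_if_I) simp
  from completion_ex_borel_measurable_real[OF this]
  obtain g where g[measurable]: "g \<in> borel_measurable lborel" "AE x in lborel. (if x \<in> cell then f x else 0) = g x"
    by blast
  \<comment> \<open>Subtracting integer parts moves a point horizontally into the period square, so
    composition with \<open>r\<close> is the periodic extension.\<close>
  define r where "r x = x - real_of_int \<lfloor>x$1\<rfloor> *\<^sub>R axis 1 1 - real_of_int \<lfloor>x$2\<rfloor> *\<^sub>R axis 2 1" for x :: "real^3"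
  define f' where "f' x = indicator slab x * g (r x)" for x
  have [measurable]: "r \<in> borel_measurable borel" unfolding r_def by measurable
  have [measurable]: "g \<in> borel_measurable borel" using g(1) by simp
  have f'm: "f' \<in> borel_measurable borel" unfolding f'_def by measurable
  have "r x = x" if "x \<in> cell" for x
  proof -
    have "\<lfloor>x$1\<rfloor> = 0" "\<lfloor>x$2\<rfloor> = 0" using that by (auto simp: cell_def floor_eq_iff)
    then show ?thesis by (simp add: r_def)
  qed
  then have c: "f' x = g x" if "x \<in> cell" for x
    using that by (simp add: f'_def cell_def)
  have ae: "AE x in nu. f x = f' x"
    unfolding AE_nu_iff using g(2) by eventually_elim (auto simp: c)
  have "r (x + axis 1 1) = r x" "r (x + axis 2 1) = r x" for x
    by (simp_all add: r_def algebra_simps)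
  then have "periodic_on UNIV f'" by (simp add: periodic_on_def f'_def indicator_def)
  moreover have "integrable nu (\<lambda>x. (f' x)\<^sup>2)"
  proof -
    have "AE x in nu. (f x)\<^sup>2 = (f' x)\<^sup>2" using ae by eventually_elim simp
    from integral_cell_AE(2)[OF _ _ this] fm f'm assms show ?thesis by (simp add: L2_def)
  qed
  ultimately have "slabL2 f'" using f'm by (simp add: slabL2_def sqint_def f'_def)
  with ae show ?thesis by blast
qed

text \<open>Weak differentiation by a single derivative. Higher regularity is expressed as a chain
  of such steps, so that product rule, reciprocals and averages need to be treated for one
  derivative only.\<close>

definition wd :: "3 \<Rightarrow> (real^3 \<Rightarrow> real) \<Rightarrow> (real^3 \<Rightarrow> real) \<Rightarrow> bool" where
  "wd i f v \<longleftrightarrow> (\<forall>\<phi>. test_function \<phi> \<longrightarrow>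
     (\<integral>x. f x * partial_deriv i \<phi> x \<partial>nu) = - (\<integral>x. v x * \<phi> x \<partial>nu))"

definition wdm :: "nat^3 \<Rightarrow> (real^3 \<Rightarrow> real) \<Rightarrow> (real^3 \<Rightarrow> real) \<Rightarrow> bool" where
  "wdm \<alpha> f v \<longleftrightarrow> (\<forall>\<phi>. test_function \<phi> \<longrightarrow>
     (\<integral>x. f x * multi_deriv \<alpha> \<phi> x \<partial>nu) = (-1) ^ mi_order \<alpha> * (\<integral>x. v x * \<phi> x \<partial>nu))"

lemma partial_deriv_periodic:
  assumes "smooth f" "periodic_on UNIV f" shows "periodic_on UNIV (partial_deriv i f)"
proof -
  have "partial_deriv i f (x + e) = partial_deriv i f x" if "\<And>x. f (x + e) = f x" for x e
  proof -
    have sh: "diag_affine e (\<chi> i. 1) y = y + e" for y by (simp add: vec_eq_iff)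
    have "partial_deriv i (\<lambda>x. f (diag_affine e (\<chi> i. 1) x)) x = partial_deriv i f (x + e)"
      using smooth_differentiable[OF assms(1)] by (subst partial_deriv_diag_affine) (simp_all add: sh)
    then show ?thesis using that by (simp add: sh)
  qed
  then show ?thesis using assms(2) by (simp add: periodic_on_def)
qed

lemma partial_deriv_eq_0:
  assumes "open S" "x \<in> S" "\<And>y. y \<in> S \<Longrightarrow> f y = 0" shows "partial_deriv i f x = 0"
proof -
  have "((\<lambda>x. 0) has_derivative (\<lambda>x. 0)) (at x)" by simp
  then have "(f has_derivative (\<lambda>x. 0)) (at x)"
    by (rule has_derivative_transform_within_open[OF _ assms(1,2)]) (simp add: assms(3))
  from partial_deriv_eq[OF this] show ?thesis by simp
qed

lemma test_on_partial_deriv: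
  assumes "test_on a b \<phi>" shows "test_on a b (partial_deriv i \<phi>)"
proof -
  obtain e where e: "e > 0" "\<And>x. x$3 < a + e \<or> b - e < x$3 \<Longrightarrow> \<phi> x = 0"
    using assms by (auto simp: test_on_def)
  have "open {x::real^3. x$3 < a + e \<or> b - e < x$3}"
    by (intro open_Collect_disj open_Collect_less continuous_intros)
  then have "partial_deriv i \<phi> x = 0" if "x$3 < a + e \<or> b - e < x$3" for x
    using that by (intro partial_deriv_eq_0[of "{x. x$3 < a + e \<or> b - e < x$3}"]) (auto simp: e(2))
  then show ?thesis using assms e(1)
    by (auto simp: test_on_def smooth_partial_deriv partial_deriv_periodic)
qed

lemma test_partial_deriv: "test_function \<phi> \<Longrightarrow> test_function (partial_deriv i \<phi>)"
  by (simp add: test_function_iff test_on_partial_deriv)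

lemma test_partial_deriv_pow: "test_function \<phi> \<Longrightarrow> test_function ((partial_deriv i ^^ n) \<phi>)"
  by (induction n) (simp_all add: test_partial_deriv)

lemma test_multi_deriv: "test_function \<phi> \<Longrightarrow> test_function (multi_deriv \<alpha> \<phi>)"
  by (simp add: multi_deriv_def test_partial_deriv_pow)

lemma smooth_partial_deriv_pow: "smooth \<phi> \<Longrightarrow> smooth ((partial_deriv i ^^ n) \<phi>)"
  by (induction n) (simp_all add: smooth_partial_deriv)

lemma partial_deriv_pow_commute:
  "smooth \<phi> \<Longrightarrow> partial_deriv j ((partial_deriv i ^^ n) \<phi>) = (partial_deriv i ^^ n) (partial_deriv j \<phi>)"
proof (induction n)
  case (Suc n)
  have "partial_deriv j ((partial_deriv i ^^ Suc n) \<phi>) = partial_deriv i (partial_deriv j ((partial_deriv i ^^ n) \<phi>))"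
    using partial_deriv_commute[OF smooth_partial_deriv_pow[OF Suc.prems]] by simp
  then show ?case using Suc by simp
qed simp

definition unit_mi :: "3 \<Rightarrow> nat^3" where "unit_mi i = axis i 1"

lemma unit_mi_nth [simp]: "unit_mi i $ j = (if i = j then 1 else 0)"
  by (simp add: unit_mi_def axis_def)

text \<open>\<open>multi_deriv\<close> applies the derivatives in a fixed order; bringing an
  additional one to the outside uses the symmetry of mixed derivatives.\<close>

lemma multi_deriv_Suc:
  assumes "smooth \<phi>" shows "multi_deriv (\<beta> + unit_mi i) \<phi> = partial_deriv i (multi_deriv \<beta> \<phi>)"
proof -
  note s = smooth_partial_deriv_pow
  consider "i = 1" | "i = 2" | "i = 3" using exhaust_3[of i] by blast
  then show ?thesis
  proof cases
    case 1 then show ?thesis by (simp add: multi_deriv_def)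
  next
    case 2
    show ?thesis unfolding multi_deriv_def
      by (simp add: 2 partial_deriv_pow_commute[OF s[OF s[OF assms]]])
  next
    case 3
    show ?thesis unfolding multi_deriv_def
      by (simp add: 3 partial_deriv_pow_commute[OF s[OF s[OF assms]]] partial_deriv_pow_commute[OF s[OF assms]])
  qed
qed

lemma mi_order_Suc: "mi_order (\<beta> + unit_mi i) = Suc (mi_order \<beta>)"
  unfolding mi_order_def vector_add_component unit_mi_nth by (simp add: sum.distrib)

lemma mi_order_0: "mi_order \<alpha> = 0 \<longleftrightarrow> \<alpha> = 0"
  by (auto simp: mi_order_def vec_eq_iff)

lemma mi_order_SucE:
  assumes "mi_order \<alpha> = Suc k" obtains \<beta> i where "\<alpha> = \<beta> + unit_mi i" "mi_order \<beta> = k"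
proof -
  have "\<alpha> \<noteq> 0" using assms mi_order_0[of \<alpha>] by auto
  then obtain i where i: "\<alpha>$i \<noteq> 0" by (auto simp: vec_eq_iff)
  define \<beta> where "\<beta> = \<alpha> - unit_mi i"
  have "\<alpha> = \<beta> + unit_mi i" using i by (auto simp: vec_eq_iff \<beta>_def)
  with assms mi_order_Suc[of \<beta> i] that show ?thesis by simp
qed

lemma multi_deriv_0: "multi_deriv 0 \<phi> = \<phi>"
  by (simp add: multi_deriv_def)

lemma test_smooth: "test_function \<phi> \<Longrightarrow> smooth \<phi>"
  by (simp add: test_function_def)

lemma wdm_0: "wdm 0 f f"
  by (simp add: wdm_def multi_deriv_0 mi_order_def)

lemma wdm_axis: "wdm (unit_mi i) f v \<longleftrightarrow> wd i f v"
proof -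
  have "multi_deriv (unit_mi i) \<phi> = partial_deriv i \<phi>" if "smooth \<phi>" for \<phi>
    using multi_deriv_Suc[OF that, of 0 i] by (simp add: multi_deriv_0)
  moreover have "mi_order (unit_mi i) = 1" using mi_order_Suc[of 0 i] by (simp add: mi_order_def)
  ultimately show ?thesis by (auto simp: wdm_def wd_def test_smooth)
qed

text \<open>The outermost derivative on the test function is moved over first and turns
  \<open>f\<close> into \<open>v\<close>; \<open>multi_deriv \<beta> \<phi>\<close> serves as the
  test function in this step. The two signs from the order and from \<open>wd\<close> match.\<close>

lemma wdm_step: assumes "wd i f v" shows "wdm (\<beta> + unit_mi i) f w \<longleftrightarrow> wdm \<beta> v w"
proof -
  have "(\<integral>x. f x * multi_deriv (\<beta> + unit_mi i) \<phi> x \<partial>nu) = - (\<integral>x. v x * multi_deriv \<beta> \<phi> x \<partial>nu)"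
    if "test_function \<phi>" for \<phi>
    using assms test_multi_deriv[OF that, of \<beta>]
    by (simp add: multi_deriv_Suc[OF test_smooth[OF that]] wd_def)
  then show ?thesis by (simp add: wdm_def mi_order_Suc)
qed

section \<open>Sobolev regularity with explicit bounds\<close>

text \<open>
  \<open>sob k m K f\<close>: all weak derivatives of order at most \<open>k\<close> have \<open>L\<^sup>2\<close> norm at most \<open>K\<close>, and those of order
  less than \<open>m\<close> (and at most \<open>k\<close>) are in addition bounded by \<open>K\<close>.
\<close>

primrec sob :: "nat \<Rightarrow> nat \<Rightarrow> real \<Rightarrow> (real^3 \<Rightarrow> real) \<Rightarrow> bool" where
  "sob 0 m K f \<longleftrightarrow> slabL2 f \<and> nrm f \<le> K \<and> (0 < m \<longrightarrow> (AE x in nu. \<bar>f x\<bar> \<le> K))"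
| "sob (Suc k) m K f \<longleftrightarrow> slabL2 f \<and> nrm f \<le> K \<and> (0 < m \<longrightarrow> (AE x in nu. \<bar>f x\<bar> \<le> K)) \<and>
     (\<forall>i. \<exists>v. wd i f v \<and> sob k (m - 1) K v)"

lemma sob_good: "sob k m K f \<Longrightarrow> slabL2 f"
  and sob_nrm: "sob k m K f \<Longrightarrow> nrm f \<le> K"
  and sob_bounded: "sob k m K f \<Longrightarrow> 0 < m \<Longrightarrow> AE x in nu. \<bar>f x\<bar> \<le> K"
  by (cases k; simp)+

lemma sob_nonneg: "sob k m K f \<Longrightarrow> 0 \<le> K"
  using sob_nrm[of k m K f] nrm_nonneg[of f] by linarith

lemma sob_imp_wdm: "sob k m K f \<Longrightarrow> mi_order \<alpha> \<le> k \<Longrightarrow> \<exists>v. slabL2 v \<and> nrm v \<le> K \<and> wdm \<alpha> f v"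
proof (induction k arbitrary: m f \<alpha>)
  case 0
  then show ?case using wdm_0[of f] by (auto simp: mi_order_0)
next
  case (Suc k)
  show ?case
  proof (cases "mi_order \<alpha>")
    case 0
    then show ?thesis using Suc.prems wdm_0[of f] by (auto simp: mi_order_0)
  next
    case (Suc l)
    then obtain \<beta> i where \<beta>: "\<alpha> = \<beta> + unit_mi i" "mi_order \<beta> = l" by (rule mi_order_SucE)
    obtain v where v: "wd i f v" "sob k (m - 1) K v" using Suc.prems by auto
    have "mi_order \<beta> \<le> k" using Suc \<beta> Suc.prems by simp
    from Suc.IH[OF v(2) this] show ?thesis using wdm_step[OF v(1)] \<beta> by auto
  qed
qed

text \<open>By \<open>wdm_step\<close> the derivatives of the chosen first derivative are
  derivatives of \<open>f\<close>, whatever the choice. The norm of \<open>f\<close> is assumed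
  separately because the function supplied for order zero need only agree with \<open>f\<close>
  almost everywhere.\<close>

lemma wdm_imp_sob:
  assumes "slabL2 f" "\<And>\<alpha>. mi_order \<alpha> \<le> k \<Longrightarrow> \<exists>v. slabL2 v \<and> nrm v \<le> K \<and> wdm \<alpha> f v" "nrm f \<le> K"
  shows "sob k 0 K f"
  using assms
proof (induction k arbitrary: f)
  case (Suc k)
  have "\<exists>v. wd i f v \<and> sob k 0 K v" for i
  proof -
    have "mi_order (unit_mi i) \<le> Suc k" using mi_order_Suc[of 0 i] by (simp add: mi_order_def)
    then obtain v where v: "slabL2 v" "nrm v \<le> K" "wd i f v"
      using Suc.prems(2)[of "unit_mi i"] unfolding wdm_axis by blast
    have "\<exists>w. slabL2 w \<and> nrm w \<le> K \<and> wdm \<beta> v w" if "mi_order \<beta> \<le> k" for \<beta>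
      using Suc.prems(2)[of "\<beta> + unit_mi i"] that by (simp add: mi_order_Suc wdm_step[OF v(3)])
    from Suc.IH[OF v(1) this v(2)] v(3) show ?thesis by auto
  qed
  then show ?case using Suc.prems by auto
qed simp

lemma integral_L2_test:
  assumes "f \<in> L2" "slabL2 f'" "AE x in nu. f x = f' x" "smooth \<phi>"
  shows "(\<integral>x. f x * \<phi> x \<partial>lebesgue_on cell) = (\<integral>x. f' x * \<phi> x \<partial>nu)"
proof (rule integral_cell_AE(1))
  have "f \<in> borel_measurable (lebesgue_on cell)" using assms by (simp add: L2_def)
  then show "(\<lambda>x. f x * \<phi> x) \<in> borel_measurable (lebesgue_on cell)"
    using borel_lebesgue_on_cell[OF smooth_borel[OF assms(4)]] by simp
  show "(\<lambda>x. f' x * \<phi> x) \<in> borel_measurable borel"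
    using slabL2_borel[OF assms(2)] smooth_borel[OF assms(4)] by simp
  show "AE x in nu. f x * \<phi> x = f' x * \<phi> x" using assms(3) by eventually_elim simp
qed

lemma is_weak_deriv_iff_wdm:
  assumes "f \<in> L2" "slabL2 f'" "AE x in nu. f x = f' x" "v \<in> L2" "slabL2 v'" "AE x in nu. v x = v' x"
  shows "is_weak_deriv \<alpha> f v \<longleftrightarrow> wdm \<alpha> f' v'"
proof -
  have "(\<integral>x. f x * multi_deriv \<alpha> \<phi> x \<partial>lebesgue_on cell) = (\<integral>x. f' x * multi_deriv \<alpha> \<phi> x \<partial>nu)"
    "(\<integral>x. v x * \<phi> x \<partial>lebesgue_on cell) = (\<integral>x. v' x * \<phi> x \<partial>nu)" if "test_function \<phi>" for \<phi>
    using that by (auto intro!: integral_L2_test assms test_smooth test_multi_deriv)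
  then show ?thesis unfolding is_weak_deriv_def wdm_def by simp
qed

lemma wdm_unique:
  assumes "wdm \<alpha> f v" "wdm \<alpha> f w" "slabL2 v" "slabL2 w" shows "AE x in nu. v x = w x"
proof -
  have sqint: "sqint (\<lambda>x. v x - w x)" using assms by (intro sqint_diff slabL2_sq)
  have "AE x in nu. x \<in> strip 0 1 \<longrightarrow> v x - w x = 0"
  proof (rule dual_L2_zero[OF sqint])
    fix \<phi> assume \<phi>: "test_on 0 1 \<phi>"
    then have "(-1) ^ mi_order \<alpha> * (\<integral>x. v x * \<phi> x \<partial>nu) = (-1) ^ mi_order \<alpha> * (\<integral>x. w x * \<phi> x \<partial>nu)"
      using assms(1,2) unfolding wdm_def test_function_iff by metis
    then have "(\<integral>x. v x * \<phi> x \<partial>nu) = (\<integral>x. w x * \<phi> x \<partial>nu)" by simp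
    moreover have "integrable nu (\<lambda>x. v x * \<phi> x)" "integrable nu (\<lambda>x. w x * \<phi> x)"
      using assms(3,4) test_on_sq[OF \<phi>] by (auto intro!: sqint_mult_integrable slabL2_sq)
    ultimately show "(\<integral>x. (v x - w x) * \<phi> x \<partial>nu) = 0" by (simp add: left_diff_distrib)
  qed auto
  moreover have "AE x in nu. x \<in> strip 0 1" by (rule AE_nu_cell) (simp add: cell_def slab_def strip_def)
  ultimately show ?thesis by eventually_elim simp
qed

lemma wd_unique: "wd i f v \<Longrightarrow> wd i f w \<Longrightarrow> slabL2 v \<Longrightarrow> slabL2 w \<Longrightarrow> AE x in nu. v x = w x"
  unfolding wdm_axis[symmetric] by (rule wdm_unique)

lemma L2_sqnorm:
  assumes "v \<in> L2" "slabL2 v'" "AE x in nu. v x = v' x"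
  shows "(\<integral>x. (v x)\<^sup>2 \<partial>lebesgue_on cell) = (nrm v')\<^sup>2"
  unfolding nrm_sq
proof (rule integral_cell_AE(1))
  have "v \<in> borel_measurable (lebesgue_on cell)" using assms by (simp add: L2_def)
  then show "(\<lambda>x. (v x)\<^sup>2) \<in> borel_measurable (lebesgue_on cell)" by simp
  show "(\<lambda>x. (v' x)\<^sup>2) \<in> borel_measurable borel" using slabL2_borel[OF assms(2)] by simp
  show "AE x in nu. (v x)\<^sup>2 = (v' x)\<^sup>2" using assms(3) by eventually_elim simp
qed

lemma weak_deriv_SOME:
  assumes "v \<in> L2" "is_weak_deriv \<alpha> u v"
  shows "weak_deriv \<alpha> u \<in> L2" "is_weak_deriv \<alpha> u (weak_deriv \<alpha> u)"
  unfolding weak_deriv_def using someI[of "\<lambda>v. v \<in> L2 \<and> is_weak_deriv \<alpha> u v" v] assms by auto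

text \<open>Each weak derivative contributes one nonnegative summand to the squared Sobolev norm.
  The derivative of order zero picked by \<open>weak_deriv\<close> agrees with \<open>u'\<close>
  almost everywhere, which bounds \<open>u'\<close> itself.\<close>

lemma sobolev_imp_sob:
  assumes "u \<in> sobolev s" "slabL2 u'" "AE x in nu. u x = u' x"
  shows "sob s 0 (sobolev_norm s u) u'"
proof -
  have uL: "u \<in> L2" using assms by (simp add: sobolev_def)
  have *: "\<exists>v. slabL2 v \<and> nrm v \<le> sobolev_norm s u \<and> wdm \<alpha> u' v" if \<alpha>: "mi_order \<alpha> \<le> s" for \<alpha>
  proof -
    obtain v where "v \<in> L2" "is_weak_deriv \<alpha> u v" using assms(1) \<alpha> by (auto simp: sobolev_def)
    note w = weak_deriv_SOME[OF this]
    obtain w' where w': "slabL2 w'" "AE x in nu. weak_deriv \<alpha> u x = w' x" using L2_rep[OF w(1)] by blast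
    have "(nrm w')\<^sup>2 = (\<integral>x. (weak_deriv \<alpha> u x)\<^sup>2 \<partial>lebesgue_on cell)"
      using L2_sqnorm[OF w(1) w'] by simp
    also have "\<dots> \<le> (\<Sum>\<alpha> | mi_order \<alpha> \<le> s. \<integral>x. (weak_deriv \<alpha> u x)\<^sup>2 \<partial>lebesgue_on cell)"
      using \<alpha> by (intro member_le_sum) (auto simp: finite_mi_order_le)
    finally have "nrm w' \<le> sobolev_norm s u" unfolding sobolev_norm_def by (rule real_le_rsqrt)
    moreover have "wdm \<alpha> u' w'"
      using w(2) is_weak_deriv_iff_wdm[OF uL assms(2,3) w(1) w'] by simp
    ultimately show ?thesis using w'(1) by blast
  qed
  obtain v where v: "slabL2 v" "nrm v \<le> sobolev_norm s u" "wdm 0 u' v"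
    using *[of 0] by (auto simp: mi_order_def)
  have "nrm u' = nrm v"
    using wdm_unique[OF wdm_0 v(3) assms(2) v(1)] slabL2_borel assms(2) v(1) by (intro nrm_cong_AE) auto
  with v have "nrm u' \<le> sobolev_norm s u" by simp
  with * show ?thesis using assms(2) by (intro wdm_imp_sob)
qed

text \<open>The square root of the number of multi-indices appears because every summand of the
  squared norm is bounded by \<open>K\<^sup>2\<close>.\<close>

lemma sob_imp_sobolev:
  assumes f: "f \<in> L2" "AE x in nu. f x = f' x" and sob: "sob k m K f'"
  shows "f \<in> sobolev k" "sobolev_norm k f \<le> sqrt (real (card {\<alpha>. mi_order \<alpha> \<le> k})) * K"
proof -
  have g: "slabL2 f'" using sob by (rule sob_good)
  have *: "\<exists>v. v \<in> L2 \<and> is_weak_deriv \<alpha> f v \<and> slabL2 v \<and> nrm v \<le> K \<and> wdm \<alpha> f' v" if \<alpha>: "mi_order \<alpha> \<le> k" for \<alpha>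
  proof -
    obtain v where v: "slabL2 v" "nrm v \<le> K" "wdm \<alpha> f' v" using sob_imp_wdm[OF sob \<alpha>] by blast
    moreover have "is_weak_deriv \<alpha> f v"
      using is_weak_deriv_iff_wdm[OF f(1) g f(2) slabL2_L2[OF v(1)] v(1)] v(3) by simp
    ultimately show ?thesis using slabL2_L2 by blast
  qed
  then show "f \<in> sobolev k" using f(1) unfolding sobolev_def by blast
  have "(\<integral>x. (weak_deriv \<alpha> f x)\<^sup>2 \<partial>lebesgue_on cell) \<le> K\<^sup>2" if \<alpha>: "mi_order \<alpha> \<le> k" for \<alpha>
  proof -
    obtain v where v: "v \<in> L2" "is_weak_deriv \<alpha> f v" "slabL2 v" "nrm v \<le> K" "wdm \<alpha> f' v" using *[OF \<alpha>] by blast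
    note w = weak_deriv_SOME[OF v(1,2)]
    obtain w' where w': "slabL2 w'" "AE x in nu. weak_deriv \<alpha> f x = w' x" using L2_rep[OF w(1)] by blast
    have "wdm \<alpha> f' w'" using w(2) is_weak_deriv_iff_wdm[OF f(1) g f(2) w(1) w'] by simp
    from wdm_unique[OF this v(5) w'(1) v(3)] have "nrm w' = nrm v"
      using slabL2_borel w'(1) v(3) by (intro nrm_cong_AE) auto
    then have "(nrm w')\<^sup>2 \<le> K\<^sup>2" using v(4) by (simp add: power_mono)
    then show ?thesis using L2_sqnorm[OF w(1) w'] by simp
  qed
  then have "(\<Sum>\<alpha> | mi_order \<alpha> \<le> k. \<integral>x. (weak_deriv \<alpha> f x)\<^sup>2 \<partial>lebesgue_on cell) \<le> (\<Sum>\<alpha> | mi_order \<alpha> \<le> k. K\<^sup>2)"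
    by (intro sum_mono) auto
  then have "sobolev_norm k f \<le> sqrt (real (card {\<alpha>. mi_order \<alpha> \<le> k}) * K\<^sup>2)"
    unfolding sobolev_norm_def by simp
  then show "sobolev_norm k f \<le> sqrt (real (card {\<alpha>. mi_order \<alpha> \<le> k})) * K"
    using sob_nonneg[OF sob] by (simp add: real_sqrt_mult)
qed

lemma sob_mono: "sob k m K f \<Longrightarrow> k' \<le> k \<Longrightarrow> m' \<le> m \<Longrightarrow> K \<le> K' \<Longrightarrow> sob k' m' K' f"
proof (induction k arbitrary: k' m m' f)
  case 0
  then show ?case by (auto elim: eventually_mono)
next
  case (Suc k)
  have bd: "0 < m' \<Longrightarrow> AE x in nu. \<bar>f x\<bar> \<le> K'"
    using sob_bounded[OF Suc.prems(1)] Suc.prems(3,4) by (auto elim: eventually_mono)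
  show ?case
  proof (cases k')
    case 0
    then show ?thesis using Suc.prems bd by auto
  next
    case (Suc l)
    have "\<exists>v. wd i f v \<and> sob l (m' - 1) K' v" for i
    proof -
      obtain v where v: "wd i f v" "sob k (m - 1) K v" using Suc.prems by auto
      have "sob l (m' - 1) K' v" using Suc Suc.prems by (intro Suc.IH[OF v(2)]) auto
      with v show ?thesis by blast
    qed
    then show ?thesis using Suc Suc.prems bd by auto
  qed
qed

lemma wd_add:
  assumes "wd i f v" "wd i g w" "slabL2 f" "slabL2 v" "slabL2 g" "slabL2 w"
  shows "wd i (\<lambda>x. f x + g x) (\<lambda>x. v x + w x)"
  unfolding wd_def
proof (intro allI impI)
  fix \<phi> assume \<phi>: "test_function \<phi>"
  have sqint: "sqint \<phi>" "sqint (partial_deriv i \<phi>)"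
    using \<phi> test_partial_deriv[OF \<phi>] by (auto simp: test_function_iff intro: test_on_sq)
  have int: "integrable nu (\<lambda>x. h x * \<phi> x)" "integrable nu (\<lambda>x. h x * partial_deriv i \<phi> x)" if "slabL2 h" for h
    using that sqint by (auto intro!: sqint_mult_integrable slabL2_sq)
  show "(\<integral>x. (f x + g x) * partial_deriv i \<phi> x \<partial>nu) = - (\<integral>x. (v x + w x) * \<phi> x \<partial>nu)"
    using assms(1,2) \<phi> int[OF assms(3)] int[OF assms(4)] int[OF assms(5)] int[OF assms(6)]
    by (simp add: wd_def distrib_right)
qed

lemma wd_cmult: "wd i f v \<Longrightarrow> wd i (\<lambda>x. c * f x) (\<lambda>x. c * v x)"
  by (simp add: wd_def mult.assoc)

lemma sob_add: "sob k m K f \<Longrightarrow> sob k m L g \<Longrightarrow> sob k m (K + L) (\<lambda>x. f x + g x)"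
proof (induction k arbitrary: m f g)
  case 0
  then show ?case
    using nrm_triangle[of f g] by (auto simp: slabL2_add slabL2_sq)
next
  case (Suc k)
  have "\<exists>v. wd i (\<lambda>x. f x + g x) v \<and> sob k (m - 1) (K + L) v" for i
  proof -
    obtain v w where "wd i f v" "sob k (m - 1) K v" "wd i g w" "sob k (m - 1) L w"
      using Suc.prems unfolding sob.simps by blast
    with Suc.IH Suc.prems show ?thesis by (intro exI[of _ "\<lambda>x. v x + w x"]) (auto intro: wd_add sob_good)
  qed
  moreover have "0 < m \<Longrightarrow> AE x in nu. \<bar>f x + g x\<bar> \<le> K + L"
    using sob_bounded[OF Suc.prems(1)] sob_bounded[OF Suc.prems(2)] by auto
  ultimately show ?case using Suc.prems nrm_triangle[of f g] by (auto simp: slabL2_add slabL2_sq)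
qed

lemma sob_cmult: "sob k m K f \<Longrightarrow> sob k m (\<bar>c\<bar> * K) (\<lambda>x. c * f x)"
proof (induction k arbitrary: m f)
  case 0
  then show ?case
    by (auto simp: slabL2_cmult nrm_cmult abs_mult mult_left_mono elim!: eventually_mono)
next
  case (Suc k)
  have "\<exists>v. wd i (\<lambda>x. c * f x) v \<and> sob k (m - 1) (\<bar>c\<bar> * K) v" for i
  proof -
    obtain v where "wd i f v" "sob k (m - 1) K v" using Suc.prems by auto
    with Suc.IH show ?thesis by (intro exI[of _ "\<lambda>x. c * v x"]) (auto intro: wd_cmult)
  qed
  then show ?case using Suc.prems
    by (auto simp: slabL2_cmult nrm_cmult abs_mult mult_left_mono elim!: eventually_mono)
qed

lemma wd_cong_AE:
  assumes "wd i f v" "AE x in nu. f x = f' x" "slabL2 f" "slabL2 f'" shows "wd i f' v"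
proof -
  have "(\<integral>x. f' x * partial_deriv i \<phi> x \<partial>nu) = (\<integral>x. f x * partial_deriv i \<phi> x \<partial>nu)" if "test_function \<phi>" for \<phi>
    using assms(2) slabL2_borel[OF assms(3)] slabL2_borel[OF assms(4)]
      smooth_borel[OF test_smooth[OF test_partial_deriv[OF that]], of i]
    by (intro integral_cong_AE) auto
  then show ?thesis using assms(1) by (simp add: wd_def)
qed

lemma sob_cong_AE:
  assumes "sob k m K f" "slabL2 f'" "AE x in nu. f x = f' x" shows "sob k m K f'"
proof -
  have "nrm f' = nrm f"
    using assms(3) slabL2_borel[OF assms(2)] slabL2_borel[OF sob_good[OF assms(1)]] by (intro nrm_cong_AE) auto
  moreover have "AE x in nu. \<bar>f' x\<bar> \<le> K" if "0 < m"
    using sob_bounded[OF assms(1) that] assms(3) by eventually_elim simp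
  moreover have "wd i f v \<Longrightarrow> wd i f' v" for i v
    using wd_cong_AE[OF _ assms(3) sob_good[OF assms(1)] assms(2)] .
  ultimately show ?thesis using assms(1,2) by (cases k) (simp_all, blast)
qed

section \<open>Difference quotients and the product rule\<close>

lemma smooth_shift: "smooth k \<Longrightarrow> smooth (\<lambda>x. k (x - v))"
  and partial_deriv_shift: "smooth k \<Longrightarrow> partial_deriv i (\<lambda>x. k (x - v)) = (\<lambda>x. partial_deriv i k (x - v))"
proof -
  assume k: "smooth k"
  have e: "(\<lambda>x. k (x - v)) = (\<lambda>x. k (diag_affine (- v) (\<chi> i. 1) x))"
    by (intro ext arg_cong[of _ _ k]) (simp add: vec_eq_iff)
  show "smooth (\<lambda>x. k (x - v))" unfolding e using k by (rule smooth_diag_affine)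
  have d: "diag_affine (- v) (\<chi> i. 1) x = x - v" for x by (simp add: vec_eq_iff)
  show "partial_deriv i (\<lambda>x. k (x - v)) = (\<lambda>x. partial_deriv i k (x - v))"
  proof
    fix x
    show "partial_deriv i (\<lambda>x. k (x - v)) x = partial_deriv i k (x - v)"
      unfolding e using smooth_differentiable[OF k] by (subst partial_deriv_diag_affine) (simp_all add: d)
  qed
qed

lemma test_on_shift:
  assumes "test_on a b k" "a' \<le> a + v$3" "b + v$3 \<le> b'" shows "test_on a' b' (\<lambda>x. k (x - v))"
proof -
  obtain e where e: "e > 0" "\<And>x. x$3 < a + e \<or> b - e < x$3 \<Longrightarrow> k x = 0"
    using assms(1) by (auto simp: test_on_def)
  have "k (x - v) = 0" if "x$3 < a' + e \<or> b' - e < x$3" for x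
    using that assms(2,3) by (intro e(2)) auto
  moreover have "periodic_on UNIV (\<lambda>x. k (x - v))"
    using assms(1) by (simp add: test_on_def periodic_on_def diff_add_eq[symmetric])
  ultimately show ?thesis using assms(1) e(1) by (auto simp: test_on_def smooth_shift)
qed

text \<open>The shift acts on the smooth factor only, so \<open>h\<close> may be merely square
  integrable: dominated convergence with the mean value bound on the difference quotients of
  \<open>k\<close>.\<close>

lemma integral_shift_derivative:
  assumes h: "sqint h" and k: "smooth k"
  shows "((\<lambda>t. \<integral>x. h x * k (x - t *\<^sub>R z) \<partial>nu) has_real_derivative
    - (\<integral>x. h x * (\<Sum>i\<in>UNIV. z$i * partial_deriv i k (x - t *\<^sub>R z)) \<partial>nu)) (at t)"
proof -
  define k' where "k' x = (\<Sum>i\<in>UNIV. z$i * partial_deriv i k x)" for x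
  have k's: "smooth k'"
    unfolding k'_def sum_3 by (intro smooth_add smooth_mult smooth_const smooth_partial_deriv k)
  note [measurable] = smooth_borel[OF k] smooth_borel[OF k's] sqint_borel[OF h]
  have int: "integrable nu (\<lambda>x. h x * k (x - t *\<^sub>R z))" for t
    by (intro sqint_mult_integrable h smooth_sq smooth_shift k)
  have der: "((\<lambda>t. k (x - t *\<^sub>R z)) has_real_derivative - k' (x - t *\<^sub>R z)) (at t)" for x t
  proof -
    have "((\<lambda>t. k (x + t *\<^sub>R (-z))) has_real_derivative (\<Sum>i\<in>UNIV. (-z)$i * partial_deriv i k (x + t *\<^sub>R (-z)))) (at t)"
      by (rule smooth_line_deriv_general[OF k])
    then show ?thesis by (simp add: k'_def sum_negf)
  qed
  have "((\<lambda>s. ((\<integral>x. h x * k (x - s *\<^sub>R z) \<partial>nu) - (\<integral>x. h x * k (x - t *\<^sub>R z) \<partial>nu)) / (s - t))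
    \<longlongrightarrow> - (\<integral>x. h x * k' (x - t *\<^sub>R z) \<partial>nu)) (at t)"
  proof (subst tendsto_at_iff_sequentially, intro allI impI)
    fix s :: "nat \<Rightarrow> real" assume s: "\<forall>i. s i \<in> UNIV - {t}" "s \<longlonglongrightarrow> t"
    define D where "D n x = (k (x - s n *\<^sub>R z) - k (x - t *\<^sub>R z)) / (s n - t)" for n x
    have [measurable]: "D n \<in> borel_measurable borel" for n unfolding D_def by measurable
    obtain R where R: "\<And>n. \<bar>s n\<bar> \<le> R" using convergent_imp_Bseq[of s] s(2)
      by (auto simp: Bseq_def convergent_def)
    \<comment> \<open>Bounds the coordinates of every shifted point that occurs: points of the cell
      have coordinates at most 1, and the shifts stay within the range of the sequence and
      \<open>t\<close>.\<close>
    define R' where "R' = 1 + max R \<bar>t\<bar> * norm z"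
    obtain B where B: "0 \<le> B" "\<And>x. (\<forall>i. \<bar>x$i\<bar> \<le> R') \<Longrightarrow> \<bar>k' x\<bar> \<le> B"
      using continuous_bounded_on_box[OF smooth_continuous[OF k's], of R'] by auto
    have bd: "\<bar>D n x\<bar> \<le> B" if x: "x \<in> cell" for n x
    proof -
      have "\<bar>k (x - s n *\<^sub>R z) - k (x - t *\<^sub>R z)\<bar> \<le> B * \<bar>s n - t\<bar>"
      proof -
        have "norm (k (x - s n *\<^sub>R z) - k (x - t *\<^sub>R z)) \<le> B * norm (s n - t)"
        proof (rule field_differentiable_bound[where S = "{- max R \<bar>t\<bar> .. max R \<bar>t\<bar>}" and f = "\<lambda>r. k (x - r *\<^sub>R z)" and f' = "\<lambda>r. - k' (x - r *\<^sub>R z)"])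
          fix r assume r: "r \<in> {- max R \<bar>t\<bar> .. max R \<bar>t\<bar>}"
          show "((\<lambda>r. k (x - r *\<^sub>R z)) has_field_derivative - k' (x - r *\<^sub>R z)) (at r within {- max R \<bar>t\<bar> .. max R \<bar>t\<bar>})"
            using der by (rule has_field_derivative_at_within)
          have "\<bar>(x - r *\<^sub>R z)$i\<bar> \<le> R'" for i
          proof -
            have "\<bar>(x - r *\<^sub>R z)$i\<bar> \<le> \<bar>x$i\<bar> + \<bar>r\<bar> * \<bar>z$i\<bar>"
              by (simp add: abs_mult[symmetric])
            also have "\<dots> \<le> 1 + max R \<bar>t\<bar> * norm z"
              using cell_bound[OF x, of i] r component_le_norm_cart[of z i]
              by (intro add_mono mult_mono) auto
            finally show ?thesis by (simp add: R'_def)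
          qed
          then show "norm (- k' (x - r *\<^sub>R z)) \<le> B" using B(2) by simp
        next
          show "s n \<in> {- max R \<bar>t\<bar> .. max R \<bar>t\<bar>}" using R[of n] by (auto simp: abs_le_iff)
        qed auto
        then show ?thesis by simp
      qed
      then show ?thesis using s(1) by (simp add: D_def field_simps)
    qed
    have lim: "(\<lambda>n. D n x) \<longlonglongrightarrow> - k' (x - t *\<^sub>R z)" for x
    proof -
      have "((\<lambda>s. (k (x - s *\<^sub>R z) - k (x - t *\<^sub>R z)) / (s - t)) \<longlongrightarrow> - k' (x - t *\<^sub>R z)) (at t)"
        using der[of x t] by (simp add: has_field_derivative_iff)
      then have "((\<lambda>s. (k (x - s *\<^sub>R z) - k (x - t *\<^sub>R z)) / (s - t)) \<circ> s) \<longlonglongrightarrow> - k' (x - t *\<^sub>R z)"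
        using s unfolding tendsto_at_iff_sequentially by blast
      then show ?thesis by (simp add: o_def D_def[abs_def])
    qed
    have "(\<lambda>n. \<integral>x. h x * D n x \<partial>nu) \<longlonglongrightarrow> (\<integral>x. h x * (- k' (x - t *\<^sub>R z)) \<partial>nu)"
    proof (rule integral_dominated_convergence[where w = "\<lambda>x. \<bar>h x\<bar> * B"])
      show "integrable nu (\<lambda>x. \<bar>h x\<bar> * B)" using sqint_integrable[OF sqint_abs[OF h]] by simp
      show "AE x in nu. (\<lambda>n. h x * D n x) \<longlonglongrightarrow> h x * (- k' (x - t *\<^sub>R z))"
        using lim by (intro AE_I2 tendsto_mult_left) auto
      show "AE x in nu. norm (h x * D n x) \<le> \<bar>h x\<bar> * B" for n
        using bd by (intro AE_nu_cell) (simp add: abs_mult mult_left_mono)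
    qed auto
    moreover have "(\<integral>x. h x * D n x \<partial>nu)
       = ((\<integral>x. h x * k (x - s n *\<^sub>R z) \<partial>nu) - (\<integral>x. h x * k (x - t *\<^sub>R z) \<partial>nu)) / (s n - t)" for n
    proof -
      have "(\<integral>x. h x * D n x \<partial>nu) = (\<integral>x. (h x * k (x - s n *\<^sub>R z) - h x * k (x - t *\<^sub>R z)) / (s n - t) \<partial>nu)"
        by (intro Bochner_Integration.integral_cong) (auto simp: D_def algebra_simps)
      also have "\<dots> = (\<integral>x. h x * k (x - s n *\<^sub>R z) - h x * k (x - t *\<^sub>R z) \<partial>nu) / (s n - t)"
        by (rule integral_divide_zero)
      finally show ?thesis using int by simp
    qed
    ultimately show "((\<lambda>s. ((\<integral>x. h x * k (x - s *\<^sub>R z) \<partial>nu) - (\<integral>x. h x * k (x - t *\<^sub>R z) \<partial>nu)) / (s - t)) \<circ> s)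
       \<longlonglongrightarrow> - (\<integral>x. h x * k' (x - t *\<^sub>R z) \<partial>nu)"
      by (simp add: o_def)
  qed
  then show ?thesis by (simp add: has_field_derivative_iff k'_def)
qed

lemma integral_shift_derivative_axis:
  assumes h: "sqint h" and k: "smooth k"
  shows "((\<lambda>t. \<integral>x. h x * k (x - t *\<^sub>R axis i 1) \<partial>nu) has_real_derivative
    - (\<integral>x. h x * partial_deriv i k (x - t *\<^sub>R axis i 1) \<partial>nu)) (at t)"
  using integral_shift_derivative[OF h k, of "axis i 1" t] by (simp only: sum_axis_mult)

lemma integral_slabL2_shift:
  assumes f: "slabL2 f" and k: "k \<in> borel_measurable borel" "periodic_on UNIV k" "\<And>x. x \<notin> slab \<Longrightarrow> k x = 0"
    and v: "0 \<le> v$1" "v$1 \<le> 1" "0 \<le> v$2" "v$2 \<le> 1"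
  shows "(\<integral>x. f x * k (x - v) \<partial>nu) = (\<integral>x. f (x + v) * k x \<partial>nu)"
proof -
  note [measurable] = slabL2_borel[OF f] k(1)
  have sw: "x + axis j 1 - v = (x - v) + axis j 1" for x j by simp
  have "(\<integral>x. f (x + v) * k (x + v - v) \<partial>nu) = (\<integral>x. f x * k (x - v) \<partial>nu)"
  proof (rule integral_nu_shift(1)[where F = "\<lambda>x. f x * k (x - v)"])
    show "per (\<lambda>x. f x * k (x - v))"
      unfolding per_def sw using slabL2_per[OF f] k(2) by (simp add: periodic_on_def)
  qed (use v k slabL2_outside[OF f] in auto)
  then show ?thesis by simp
qed

section \<open>Difference quotients on a strip\<close>

text \<open>
  Truncated to a strip, since the shifted function is only meaningful well inside the slab.
\<close>

definition dshift :: "real \<Rightarrow> 3 \<Rightarrow> real \<Rightarrow> (real^3 \<Rightarrow> real) \<Rightarrow> real^3 \<Rightarrow> real" where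
  "dshift \<epsilon> i t h x = indicator (strip \<epsilon> (1 - \<epsilon>)) x * (h (x + t *\<^sub>R axis i 1) - h x)"

lemma strip_subset_slab: "0 \<le> a \<Longrightarrow> b \<le> 1 \<Longrightarrow> strip a b \<subseteq> slab"
  by (auto simp: strip_def slab_def)

lemma axis_le_1: "t \<ge> 0 \<Longrightarrow> t \<le> 1 \<Longrightarrow> 0 \<le> (t *\<^sub>R axis (i::3) (1::real)) $ j \<and> (t *\<^sub>R axis i (1::real)) $ j \<le> 1"
  by (simp add: axis_def)

lemma sqint_shift_strip:
  assumes f: "slabL2 f" and t: "0 \<le> t" "t \<le> 1" and e: "0 \<le> \<epsilon>"
  shows "sqint (\<lambda>x. indicator (strip \<epsilon> (1 - \<epsilon>)) x * f (x + t *\<^sub>R axis i 1))"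
proof -
  note [measurable] = slabL2_borel[OF f]
  let ?v = "t *\<^sub>R axis i (1::real)"
  \<comment> \<open>The squared truncated shift is a shift of \<open>?F\<close>, where the
    truncation has moved along; shift invariance then reduces integrability to that of the square of
    \<open>f\<close>.\<close>
  let ?F = "\<lambda>x. (f x)\<^sup>2 * indicator (strip \<epsilon> (1 - \<epsilon>)) (x - ?v)"
  have st: "x + axis j 1 - ?v \<in> strip \<epsilon> (1 - \<epsilon>) \<longleftrightarrow> x - ?v \<in> strip \<epsilon> (1 - \<epsilon>)" if "j \<noteq> 3" for x :: "real^3" and j
    using that by (simp add: strip_def axis_def)
  have "integrable nu ?F"
  proof (rule Bochner_Integration.integrable_bound)
    show "integrable nu (\<lambda>x. (f x)\<^sup>2)" using slabL2_sq[OF f] by (simp add: sqint_def)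
  qed (auto simp: indicator_def)
  moreover have "integrable nu (\<lambda>x. ?F (x + ?v)) \<longleftrightarrow> integrable nu ?F"
  proof (rule integral_nu_shift(2))
    show "per ?F"
      unfolding per_def indicator_def using slabL2_per[OF f] st[of 1] st[of 2] by (simp add: periodic_on_def)
    show "?F (x + ?v) = 0" if "x \<notin> slab" for x
      using that e strip_subset_slab[of \<epsilon> "1 - \<epsilon>"] by (auto simp: indicator_def)
  qed (use t axis_le_1[OF t] slabL2_outside[OF f] in auto)
  ultimately have "integrable nu (\<lambda>x. (indicator (strip \<epsilon> (1 - \<epsilon>)) x * f (x + ?v))\<^sup>2)"
    by (simp add: power_mult_distrib mult.commute indicator_def of_bool_def if_distrib[of "\<lambda>x. x\<^sup>2"] cong: if_cong)
  then show ?thesis by (simp add: sqint_def)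
qed

lemma sqint_dshift:
  assumes f: "slabL2 f" and t: "0 \<le> t" "t \<le> 1" and e: "0 \<le> \<epsilon>"
  shows "sqint (dshift \<epsilon> i t f)"
proof -
  have "sqint (\<lambda>x. indicator (strip \<epsilon> (1 - \<epsilon>)) x * f (x + t *\<^sub>R axis i 1) - indicator (strip \<epsilon> (1 - \<epsilon>)) x * f x)"
    by (intro sqint_diff sqint_shift_strip assms sqint_mult_bounded[of f _ 1] slabL2_sq) (auto simp: indicator_def)
  then show ?thesis by (simp add: dshift_def[abs_def] right_diff_distrib)
qed

text \<open>Discrete integration by parts: the shift passes from \<open>h\<close> to
  \<open>k\<close>, and the truncation is invisible because \<open>k\<close> vanishes off the
  strip.\<close>

lemma integral_dshift_test:
  assumes h: "slabL2 h" and k: "test_on \<epsilon> (1 - \<epsilon>) k" and t: "0 \<le> t" "t \<le> 1" and e: "0 \<le> \<epsilon>"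
  shows "(\<integral>x. dshift \<epsilon> i t h x * k x \<partial>nu) = (\<integral>x. h x * k (x - t *\<^sub>R axis i 1) \<partial>nu) - (\<integral>x. h x * k x \<partial>nu)"
proof -
  let ?I = "indicator (strip \<epsilon> (1 - \<epsilon>)) :: real^3 \<Rightarrow> real"
  have Ik: "?I x * k x = k x" for x using test_on_outside[OF k, of x] by (auto simp: indicator_def)
  have k0: "k x = 0" if "x \<notin> slab" for x
    using that test_on_outside[OF k] strip_subset_slab[of \<epsilon> "1 - \<epsilon>"] e by auto
  have i1: "integrable nu (\<lambda>x. (?I x * h (x + t *\<^sub>R axis i 1)) * k x)"
    by (intro sqint_mult_integrable sqint_shift_strip h t e test_on_sq[OF k])
  have i2: "integrable nu (\<lambda>x. h x * k x)"
    by (intro sqint_mult_integrable slabL2_sq h test_on_sq[OF k])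
  have "(\<integral>x. dshift \<epsilon> i t h x * k x \<partial>nu) = (\<integral>x. (?I x * h (x + t *\<^sub>R axis i 1)) * k x - h x * k x \<partial>nu)"
  proof (rule Bochner_Integration.integral_cong[OF refl])
    fix x have "dshift \<epsilon> i t h x * k x = (?I x * k x) * h (x + t *\<^sub>R axis i 1) - h x * (?I x * k x)"
      by (simp add: dshift_def algebra_simps)
    also have "\<dots> = (?I x * k x) * h (x + t *\<^sub>R axis i 1) - h x * k x" unfolding Ik ..
    finally show "dshift \<epsilon> i t h x * k x = (?I x * h (x + t *\<^sub>R axis i 1)) * k x - h x * k x"
      by (simp add: algebra_simps)
  qed
  also have "\<dots> = (\<integral>x. (?I x * h (x + t *\<^sub>R axis i 1)) * k x \<partial>nu) - (\<integral>x. h x * k x \<partial>nu)"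
    using i1 i2 by simp
  also have "(\<integral>x. (?I x * h (x + t *\<^sub>R axis i 1)) * k x \<partial>nu) = (\<integral>x. h (x + t *\<^sub>R axis i 1) * k x \<partial>nu)"
  proof (rule Bochner_Integration.integral_cong[OF refl])
    fix x have "(?I x * h (x + t *\<^sub>R axis i 1)) * k x = h (x + t *\<^sub>R axis i 1) * (?I x * k x)"
      by (simp add: algebra_simps)
    then show "(?I x * h (x + t *\<^sub>R axis i 1)) * k x = h (x + t *\<^sub>R axis i 1) * k x" unfolding Ik .
  qed
  also have "\<dots> = (\<integral>x. h x * k (x - t *\<^sub>R axis i 1) \<partial>nu)"
    using k axis_le_1[OF t] by (intro integral_slabL2_shift[symmetric] h k0) (auto simp: test_on_def smooth_borel)
  finally show ?thesis .
qed

text \<open>As \<open>t\<close> does not exceed the distance \<epsilon> of the strip from the faces,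
  the shifted support stays in the slab and no mass is lost.\<close>

lemma nrm_shift_test:
  assumes k: "test_on \<epsilon> (1 - \<epsilon>) k" and t: "0 \<le> t" "t \<le> \<epsilon>" "\<epsilon> \<le> 1"
  shows "nrm (\<lambda>x. k (x - t *\<^sub>R axis i 1)) = nrm k"
proof -
  let ?v = "t *\<^sub>R axis i (1::real)"
  have t1: "t \<le> 1" using t by simp
  have tt: "test_on 0 1 (\<lambda>x. k (x - ?v))"
    by (rule test_on_shift[OF k]) (use t in \<open>auto simp: axis_def\<close>)
  then have g: "(\<lambda>x. k (x - ?v)) \<in> borel_measurable borel" "periodic_on UNIV (\<lambda>x. k (x - ?v))"
    by (auto simp: test_on_def smooth_borel)
  have out: "x \<notin> slab \<Longrightarrow> k (x - ?v) = 0" "x \<notin> slab \<Longrightarrow> k x = 0" for x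
    using test_on_outside[OF tt, of x] test_on_outside[OF k, of x] strip_subset_slab[of \<epsilon> "1 - \<epsilon>"] strip_subset_slab[of 0 1] t
    by (auto simp: slab_def strip_def)
  have "(\<integral>x. (k (x + ?v - ?v))\<^sup>2 \<partial>nu) = (\<integral>x. (k (x - ?v))\<^sup>2 \<partial>nu)"
    by (rule integral_nu_shift(1)[where F = "\<lambda>x. (k (x - ?v))\<^sup>2"])
      (use g out axis_le_1[OF t(1) t1] in \<open>auto simp: per_def periodic_on_def\<close>)
  then show ?thesis by (simp add: nrm_def)
qed

text \<open>Paired with a test function \<open>k\<close>, \<open>dshift\<close> is an increment of a
  differentiable function of the shift. By the mean value theorem it equals \<open>t\<close> times
  the pairing of \<open>h'\<close> with a shift of \<open>k\<close>, and shifts keep the norm of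
  \<open>k\<close>. By density \<open>dshift\<close> itself may be taken as
  \<open>k\<close>.\<close>

lemma nrm_dshift:
  assumes h: "slabL2 h" "slabL2 h'" "wd i h h'" and t: "0 < t" "t \<le> \<epsilon>" "\<epsilon> \<le> 1"
  shows "nrm (dshift \<epsilon> i t h) \<le> t * nrm h'"
proof -
  let ?D = "dshift \<epsilon> i t h"
  have t1: "0 \<le> t" "t \<le> 1" "0 \<le> \<epsilon>" using t by auto
  have D: "sqint ?D" by (rule sqint_dshift[OF h(1) t1])
  have bd: "\<bar>\<integral>x. ?D x * k x \<partial>nu\<bar> \<le> (t * nrm h') * nrm k" if k: "test_on \<epsilon> (1 - \<epsilon>) k" for k
  proof -
    let ?g = "\<lambda>t. \<integral>x. h x * k (x - t *\<^sub>R axis i 1) \<partial>nu"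
    let ?g' = "\<lambda>t. - (\<integral>x. h x * partial_deriv i k (x - t *\<^sub>R axis i 1) \<partial>nu)"
    have sm: "smooth k" using k by (simp add: test_on_def)
    have "\<exists>s. 0 < s \<and> s < t \<and> ?g t - ?g 0 = (t - 0) * ?g' s"
      using t(1) by (intro MVT2 integral_shift_derivative_axis slabL2_sq h sm) auto
    then obtain s where s: "0 < s" "s < t" "?g t - ?g 0 = t * ?g' s" by auto
    have "test_function (\<lambda>x. k (x - s *\<^sub>R axis i 1))"
      unfolding test_function_iff by (rule test_on_shift[OF k]) (use s t in \<open>auto simp: axis_def\<close>)
    then have "(\<integral>x. h x * partial_deriv i (\<lambda>x. k (x - s *\<^sub>R axis i 1)) x \<partial>nu)
        = - (\<integral>x. h' x * k (x - s *\<^sub>R axis i 1) \<partial>nu)"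
      using h(3) unfolding wd_def by blast
    then have "?g' s = (\<integral>x. h' x * k (x - s *\<^sub>R axis i 1) \<partial>nu)"
      unfolding partial_deriv_shift[OF sm] by simp
    then have "\<bar>?g' s\<bar> \<le> nrm h' * nrm (\<lambda>x. k (x - s *\<^sub>R axis i 1))"
      using nrm_Cauchy_Schwarz[OF slabL2_sq[OF h(2)] smooth_sq[OF smooth_shift[OF sm]]] by simp
    also have "nrm (\<lambda>x. k (x - s *\<^sub>R axis i 1)) = nrm k"
      using s t by (intro nrm_shift_test[OF k]) auto
    finally have "\<bar>?g' s\<bar> \<le> nrm h' * nrm k" .
    then have "\<bar>t * ?g' s\<bar> \<le> t * (nrm h' * nrm k)" using t(1) by (simp add: abs_mult del: abs_minus)
    moreover have "(\<integral>x. ?D x * k x \<partial>nu) = ?g t - ?g 0"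
      using integral_dshift_test[OF h(1) k t1] by simp
    ultimately show ?thesis using s(3) by (simp add: mult.assoc)
  qed
  have "appr \<epsilon> (1 - \<epsilon>) ?D"
    using t1 by (intro appr_all D) (auto simp: dshift_def)
  from dual_L2_bound[OF D this bd] have "\<bar>\<integral>x. ?D x * ?D x \<partial>nu\<bar> \<le> (t * nrm h') * nrm ?D" .
  moreover have "(\<integral>x. ?D x * ?D x \<partial>nu) = (nrm ?D)\<^sup>2" unfolding nrm_sq by (simp only: power2_eq_square)
  ultimately have *: "nrm ?D * nrm ?D \<le> (t * nrm h') * nrm ?D" by (simp add: power2_eq_square)
  show ?thesis
  proof (cases "nrm ?D = 0")
    case False
    then have "nrm ?D > 0" using nrm_nonneg[of ?D] by linarith
    with * show ?thesis by (rule mult_right_le_imp_le)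
  qed (use t in simp)
qed

text \<open>Needs no weak derivative of \<open>h\<close>: the difference quotient sits on the test
  function. This is how a weak derivative is later identified from limits of difference
  quotients.\<close>

lemma dshift_test_limit:
  assumes h: "slabL2 h" and k: "test_on \<epsilon> (1 - \<epsilon>) k" and e: "0 \<le> \<epsilon>"
    and t: "\<And>n. 0 < t n" "\<And>n. t n \<le> 1" "t \<longlonglongrightarrow> 0"
  shows "(\<lambda>n. \<integral>x. (1 / t n * dshift \<epsilon> i (t n) h x) * k x \<partial>nu) \<longlonglongrightarrow> - (\<integral>x. h x * partial_deriv i k x \<partial>nu)"
proof -
  let ?g = "\<lambda>t. \<integral>x. h x * k (x - t *\<^sub>R axis i 1) \<partial>nu"
  have sm: "smooth k" using k by (simp add: test_on_def)
  have "((\<lambda>s. (?g s - ?g 0) / (s - 0)) \<longlongrightarrow> - (\<integral>x. h x * partial_deriv i k (x - 0 *\<^sub>R axis i 1) \<partial>nu)) (at 0)"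
    using integral_shift_derivative_axis[OF slabL2_sq[OF h] sm, of i 0] by (simp add: has_field_derivative_iff)
  then have lim: "((\<lambda>s. (?g s - ?g 0) / (s - 0)) \<longlongrightarrow> - (\<integral>x. h x * partial_deriv i k (x - 0 *\<^sub>R axis i 1) \<partial>nu)) (at 0)" .
  have "((\<lambda>s. (?g s - ?g 0) / (s - 0)) \<circ> t) \<longlonglongrightarrow> - (\<integral>x. h x * partial_deriv i k (x - 0 *\<^sub>R axis i 1) \<partial>nu)"
  proof -
    have "\<forall>n. t n \<in> UNIV - {0}" using t(1) by (simp add: less_imp_neq[symmetric])
    with t(3) lim show ?thesis unfolding tendsto_at_iff_sequentially by blast
  qed
  note lim2 = this
  have eq: "(\<integral>x. (1 / t n * dshift \<epsilon> i (t n) h x) * k x \<partial>nu) = (?g (t n) - ?g 0) / (t n - 0)" for n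
  proof -
    have "(\<integral>x. (1 / t n * dshift \<epsilon> i (t n) h x) * k x \<partial>nu) = (\<integral>x. (dshift \<epsilon> i (t n) h x * k x) / t n \<partial>nu)"
      by (simp add: mult.assoc)
    also have "\<dots> = (\<integral>x. dshift \<epsilon> i (t n) h x * k x \<partial>nu) / t n" by (rule integral_divide_zero)
    finally show ?thesis using integral_dshift_test[OF h k less_imp_le[OF t(1)] t(2) e] by simp
  qed
  have "(\<lambda>n. \<integral>x. (1 / t n * dshift \<epsilon> i (t n) h x) * k x \<partial>nu) = ((\<lambda>s. (?g s - ?g 0) / (s - 0)) \<circ> t)"
    by (simp only: eq o_def)
  with lim2 show ?thesis by (simp only: scaleR_zero_left diff_zero)
qed

text \<open>Norm bounded functionals that converge on a dense set converge on its closure. The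
  summand 1 in \<open>M\<close> only makes it positive.\<close>

lemma weak_limit_extend:
  assumes D: "\<And>n. sqint (D n)" "\<And>n. nrm (D n) \<le> N" and h': "sqint h'"
    and lim: "\<And>\<phi>. test_on a b \<phi> \<Longrightarrow> (\<lambda>n. \<integral>x. D n x * \<phi> x \<partial>nu) \<longlonglongrightarrow> (\<integral>x. h' x * \<phi> x \<partial>nu)"
    and k: "appr a b k"
  shows "(\<lambda>n. \<integral>x. D n x * k x \<partial>nu) \<longlonglongrightarrow> (\<integral>x. h' x * k x \<partial>nu)"
proof (rule LIMSEQ_I)
  fix r :: real assume r: "r > 0"
  define M where "M = max N (nrm h') + 1"
  have M: "N \<le> M" "nrm h' \<le> M" "M > 0"
    using nrm_nonneg[of h'] max.cobounded1[of N "nrm h'"] max.cobounded2[of "nrm h'" N]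
    unfolding M_def by linarith+
  have ks: "sqint k" using k by (simp add: appr_def)
  obtain \<phi> where \<phi>: "test_on a b \<phi>" "nrm (\<lambda>x. k x - \<phi> x) < r / (3 * M)"
    using k r M(3) unfolding appr_def by (meson divide_pos_pos mult_pos_pos zero_less_numeral)
  obtain n0 where n0: "\<And>n. n \<ge> n0 \<Longrightarrow> \<bar>(\<integral>x. D n x * \<phi> x \<partial>nu) - (\<integral>x. h' x * \<phi> x \<partial>nu)\<bar> < r / 3"
    using LIMSEQ_D[OF lim[OF \<phi>(1)], of "r / 3"] r by auto
  have small: "\<bar>(\<integral>x. v x * k x \<partial>nu) - (\<integral>x. v x * \<phi> x \<partial>nu)\<bar> < r / 3" if v: "sqint v" "nrm v \<le> M" for v
  proof -
    have "(\<integral>x. v x * k x \<partial>nu) - (\<integral>x. v x * \<phi> x \<partial>nu) = (\<integral>x. v x * (k x - \<phi> x) \<partial>nu)"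
      using sqint_mult_integrable[OF v(1) ks] sqint_mult_integrable[OF v(1) test_on_sq[OF \<phi>(1)]]
      by (simp add: right_diff_distrib)
    also have "\<bar>\<dots>\<bar> \<le> nrm v * nrm (\<lambda>x. k x - \<phi> x)"
      by (intro nrm_Cauchy_Schwarz v sqint_diff ks test_on_sq[OF \<phi>(1)])
    also have "\<dots> \<le> M * nrm (\<lambda>x. k x - \<phi> x)" using v by (intro mult_right_mono) auto
    also have "\<dots> < M * (r / (3 * M))" using \<phi>(2) M(3) by (intro mult_strict_left_mono)
    also have "\<dots> = r / 3" using M(3) by simp
    finally show ?thesis .
  qed
  show "\<exists>n0. \<forall>n\<ge>n0. norm ((\<integral>x. D n x * k x \<partial>nu) - (\<integral>x. h' x * k x \<partial>nu)) < r"
  proof (intro exI allI impI)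
    fix n assume "n \<ge> n0"
    have "nrm (D n) \<le> M" using D(2)[of n] M(1) by simp
    then show "norm ((\<integral>x. D n x * k x \<partial>nu) - (\<integral>x. h' x * k x \<partial>nu)) < r"
      using small[OF D(1)[of n]] small[OF h' M(2)] n0[OF \<open>n \<ge> n0\<close>] unfolding real_norm_def by linarith
  qed
qed

text \<open>Strong times weak convergence. With \<open>a n\<close> written as \<open>b\<close> plus
  an error, the part with \<open>b\<close> converges because the difference quotients converge
  weakly, and the error is negligible because they are bounded in L2 by
  \<open>nrm_dshift\<close>.\<close>

lemma dshift_product_limit:
  assumes h: "slabL2 h" "slabL2 h'" "wd i h h'" and \<phi>: "test_on \<epsilon> (1 - \<epsilon>) \<phi>" and e: "0 \<le> \<epsilon>" "\<epsilon> \<le> 1"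
    and t: "\<And>n. 0 < t n" "\<And>n. t n \<le> \<epsilon>" "t \<longlonglongrightarrow> 0"
    and a: "\<And>n. sqint (a n)" "sqint b" "(\<lambda>n. nrm (\<lambda>x. a n x - b x)) \<longlonglongrightarrow> 0"
  shows "(\<lambda>n. \<integral>x. a n x * (1 / t n * dshift \<epsilon> i (t n) h x) * \<phi> x \<partial>nu) \<longlonglongrightarrow> (\<integral>x. b x * h' x * \<phi> x \<partial>nu)"
proof -
  let ?D = "\<lambda>n x. 1 / t n * dshift \<epsilon> i (t n) h x"
  have t1: "0 \<le> t n" "t n \<le> 1" for n using t(1)[of n] t(2)[of n] e by auto
  have D: "sqint (?D n)" for n by (intro sqint_cmult sqint_dshift h t1 e)
  have Dn: "nrm (?D n) \<le> nrm h'" for n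
  proof -
    have "nrm (?D n) = \<bar>1 / t n\<bar> * nrm (dshift \<epsilon> i (t n) h)" by (rule nrm_cmult)
    also have "\<dots> \<le> \<bar>1 / t n\<bar> * (t n * nrm h')"
      by (intro mult_left_mono nrm_dshift[OF h t(1) t(2) e(2)]) simp
    also have "\<dots> = nrm h'" using t(1)[of n] by simp
    finally show ?thesis .
  qed
  obtain B where B: "0 \<le> B" "\<And>x. (\<forall>i. \<bar>x$i\<bar> \<le> 1) \<Longrightarrow> \<bar>\<phi> x\<bar> \<le> B"
    using continuous_bounded_on_box[OF smooth_continuous, of \<phi> 1] \<phi> by (auto simp: test_on_def)
  have Bc: "AE x in nu. \<bar>\<phi> x\<bar> \<le> B" using B(2) cell_bound by (intro AE_nu_cell) blast
  note [measurable] = test_on_borel[OF \<phi>]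
  have b\<phi>: "sqint (\<lambda>x. \<phi> x * b x)" "sqint (\<lambda>x. \<phi> x * a n x)" for n
    by (rule sqint_mult_bounded[OF _ _ Bc]; use a in measurable)+
  have ap: "appr \<epsilon> (1 - \<epsilon>) (\<lambda>x. \<phi> x * b x)"
    using e test_on_outside[OF \<phi>] by (intro appr_all b\<phi>) auto
  have lim: "(\<lambda>n. \<integral>x. ?D n x * k x \<partial>nu) \<longlonglongrightarrow> (\<integral>x. h' x * k x \<partial>nu)" if k: "test_on \<epsilon> (1 - \<epsilon>) k" for k
  proof -
    have "test_function k" unfolding test_function_iff by (rule test_on_mono[OF k]) (use e in auto)
    then have "- (\<integral>x. h x * partial_deriv i k x \<partial>nu) = (\<integral>x. h' x * k x \<partial>nu)" using h(3) by (simp add: wd_def)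
    then show ?thesis using dshift_test_limit[OF h(1) k e(1) t(1) t1(2) t(3), of i] by simp
  qed
  have 1: "(\<lambda>n. \<integral>x. ?D n x * (\<phi> x * b x) \<partial>nu) \<longlonglongrightarrow> (\<integral>x. h' x * (\<phi> x * b x) \<partial>nu)"
    by (rule weak_limit_extend[where D = ?D, OF D Dn slabL2_sq[OF h(2)] lim ap])
  have 2: "(\<lambda>n. \<integral>x. ?D n x * (\<phi> x * (a n x - b x)) \<partial>nu) \<longlonglongrightarrow> 0"
  proof (rule Lim_null_comparison[OF always_eventually[OF allI]])
    show "norm (\<integral>x. ?D n x * (\<phi> x * (a n x - b x)) \<partial>nu) \<le> nrm h' * B * nrm (\<lambda>x. a n x - b x)" for n
    proof -
      have ab: "sqint (\<lambda>x. a n x - b x)" by (intro sqint_diff a)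
      have "\<bar>\<integral>x. ?D n x * (\<phi> x * (a n x - b x)) \<partial>nu\<bar> \<le> nrm (?D n) * nrm (\<lambda>x. \<phi> x * (a n x - b x))"
        by (intro nrm_Cauchy_Schwarz D sqint_mult_bounded[OF ab _ Bc]) measurable
      also have "\<dots> \<le> nrm h' * (B * nrm (\<lambda>x. a n x - b x))"
        by (intro mult_mono Dn nrm_mult_bounded[OF ab _ Bc B(1)]) (auto simp: B)
      finally show ?thesis by (simp add: mult.assoc)
    qed
    show "(\<lambda>n. nrm h' * B * nrm (\<lambda>x. a n x - b x)) \<longlonglongrightarrow> 0"
      using tendsto_mult_left[OF a(3), of "nrm h' * B"] by simp
  qed
  have "(\<integral>x. ?D n x * (\<phi> x * b x) \<partial>nu) + (\<integral>x. ?D n x * (\<phi> x * (a n x - b x)) \<partial>nu)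
     = (\<integral>x. a n x * ?D n x * \<phi> x \<partial>nu)" for n
  proof -
    have "(\<integral>x. ?D n x * (\<phi> x * b x) \<partial>nu) + (\<integral>x. ?D n x * (\<phi> x * (a n x - b x)) \<partial>nu)
      = (\<integral>x. ?D n x * (\<phi> x * b x) + ?D n x * (\<phi> x * (a n x - b x)) \<partial>nu)"
      by (intro Bochner_Integration.integral_add[symmetric] sqint_mult_integrable D b\<phi>
          sqint_mult_bounded[OF sqint_diff[OF a(1) a(2)] _ Bc]) measurable
    also have "\<dots> = (\<integral>x. a n x * ?D n x * \<phi> x \<partial>nu)"
      by (intro Bochner_Integration.integral_cong) (auto simp: algebra_simps)
    finally show ?thesis .
  qed
  with tendsto_add[OF 1 2] show ?thesis by (simp add: mult_ac)
qed

section \<open>Product rule and reciprocal rule for weak derivatives\<close>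

lemma test_function_shrink:
  assumes "test_function \<phi>"
  obtains \<epsilon> where "0 < \<epsilon>" "\<epsilon> < 1" "test_on \<epsilon> (1 - \<epsilon>) \<phi>"
proof -
  obtain e where e: "e > 0" "\<And>x. x$3 < e \<or> 1 - e < x$3 \<Longrightarrow> \<phi> x = 0"
    using assms by (auto simp: test_function_def)
  \<comment> \<open>Half of the margin of \<phi> defines the strip, the other half is left as the
    margin inside the strip.\<close>
  define \<epsilon> where "\<epsilon> = min (e / 2) (1 / 2)"
  have \<epsilon>: "0 < \<epsilon>" "\<epsilon> < 1" "\<epsilon> \<le> e / 2" using e by (auto simp: \<epsilon>_def)
  have "\<phi> x = 0" if "x$3 < \<epsilon> + e / 2 \<or> 1 - \<epsilon> - e / 2 < x$3" for x
    using that \<epsilon> by (intro e(2)) auto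
  then have "test_on \<epsilon> (1 - \<epsilon>) \<phi>" using assms e(1) unfolding test_on_def test_function_def
    by (metis half_gt_zero)
  with \<epsilon> that show ?thesis by blast
qed

lemma null_sequence_le:
  assumes "0 < \<epsilon>"
  obtains t :: "nat \<Rightarrow> real" where "\<And>n. 0 < t n" "\<And>n. t n \<le> \<epsilon>" "t \<longlonglongrightarrow> 0"
proof
  show "0 < \<epsilon> * inverse (real (Suc n))" "\<epsilon> * inverse (real (Suc n)) \<le> \<epsilon>" for n
    using assms by (auto simp: field_simps)
  show "(\<lambda>n. \<epsilon> * inverse (real (Suc n))) \<longlonglongrightarrow> 0"
    using tendsto_mult_left[OF LIMSEQ_inverse_real_of_nat, of \<epsilon>] by simp
qed

text \<open>Limit of the discrete product rule, in which \<open>f\<close> is taken at the shifted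
  point in one term and \<open>g\<close> at the original point in the other. The shifted
  \<open>f\<close> converges in L2 by \<open>nrm_dshift\<close>. A product of square integrable
  functions is only integrable, hence the assumption \<open>P\<close>.\<close>

lemma wd_mult:
  assumes f: "slabL2 f" "slabL2 f'" "wd i f f'" and g: "slabL2 g" "slabL2 g'" "wd i g g'"
    and P: "slabL2 (\<lambda>x. f x * g x)"
  shows "wd i (\<lambda>x. f x * g x) (\<lambda>x. f x * g' x + f' x * g x)"
  unfolding wd_def
proof (intro allI impI)
  fix \<phi> assume "test_function \<phi>"
  then obtain \<epsilon> where e: "0 < \<epsilon>" "\<epsilon> < 1" and \<phi>: "test_on \<epsilon> (1 - \<epsilon>) \<phi>" by (rule test_function_shrink)
  obtain t where t: "\<And>n. 0 < t n" "\<And>n. t n \<le> \<epsilon>" "t \<longlonglongrightarrow> 0" using null_sequence_le[OF e(1)] by blast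
  have t1: "0 \<le> t n" "t n \<le> 1" for n using t(1)[of n] t(2)[of n] e by auto
  have e': "0 \<le> \<epsilon>" "\<epsilon> \<le> 1" using e by auto
  let ?I = "indicator (strip \<epsilon> (1 - \<epsilon>)) :: real^3 \<Rightarrow> real"
  let ?P = "\<lambda>x. f x * g x"
  let ?sh = "\<lambda>n x. ?I x * f (x + t n *\<^sub>R axis i 1)"
  have I: "sqint (\<lambda>x. ?I x * f x)" by (rule sqint_mult_bounded[OF slabL2_sq[OF f(1)], of _ 1]) (auto simp: indicator_def)
  have 0: "(\<lambda>n. \<integral>x. (1 / t n * dshift \<epsilon> i (t n) ?P x) * \<phi> x \<partial>nu) \<longlonglongrightarrow> - (\<integral>x. ?P x * partial_deriv i \<phi> x \<partial>nu)"
    by (rule dshift_test_limit[OF P \<phi> e'(1) t(1) t1(2) t(3)])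
  have 1: "(\<lambda>n. \<integral>x. ?sh n x * (1 / t n * dshift \<epsilon> i (t n) g x) * \<phi> x \<partial>nu) \<longlonglongrightarrow> (\<integral>x. (?I x * f x) * g' x * \<phi> x \<partial>nu)"
  proof (rule dshift_product_limit[OF g \<phi> e' t])
    show "sqint (?sh n)" for n by (rule sqint_shift_strip[OF f(1) t1 e'(1)])
    have "(\<lambda>x. ?sh n x - ?I x * f x) = dshift \<epsilon> i (t n) f" for n
      by (auto simp: dshift_def algebra_simps)
    moreover have "(\<lambda>n. nrm (dshift \<epsilon> i (t n) f)) \<longlonglongrightarrow> 0"
    proof (rule Lim_null_comparison[OF always_eventually[OF allI]])
      show "norm (nrm (dshift \<epsilon> i (t n) f)) \<le> t n * nrm f'" for n
        using nrm_dshift[OF f t(1)[of n] t(2)[of n] e'(2)] by simp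
      show "(\<lambda>n. t n * nrm f') \<longlonglongrightarrow> 0" using tendsto_mult_right[OF t(3), of "nrm f'"] by simp
    qed
    ultimately show "(\<lambda>n. nrm (\<lambda>x. ?sh n x - ?I x * f x)) \<longlonglongrightarrow> 0" by simp
  qed (rule I)
  have 2: "(\<lambda>n. \<integral>x. g x * (1 / t n * dshift \<epsilon> i (t n) f x) * \<phi> x \<partial>nu) \<longlonglongrightarrow> (\<integral>x. g x * f' x * \<phi> x \<partial>nu)"
    by (rule dshift_product_limit[OF f \<phi> e' t]) (auto simp: slabL2_sq[OF g(1)] nrm_def)
  obtain B where B: "0 \<le> B" "\<And>x. (\<forall>i. \<bar>x$i\<bar> \<le> 1) \<Longrightarrow> \<bar>\<phi> x\<bar> \<le> B"
    using continuous_bounded_on_box[OF smooth_continuous, of \<phi> 1] \<phi> by (auto simp: test_on_def)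
  have Bc: "AE x in nu. \<bar>\<phi> x\<bar> \<le> B" using B(2) cell_bound by (intro AE_nu_cell) blast
  note m[measurable] = test_on_borel[OF \<phi>]
  have int3: "integrable nu (\<lambda>x. p x * q x * \<phi> x)" if "sqint p" "sqint q" for p q
    using sqint_mult_integrable[OF that(1) sqint_mult_bounded[OF that(2) m Bc]] by (simp add: mult_ac)
  have split: "(\<integral>x. (1 / t n * dshift \<epsilon> i (t n) ?P x) * \<phi> x \<partial>nu)
     = (\<integral>x. ?sh n x * (1 / t n * dshift \<epsilon> i (t n) g x) * \<phi> x \<partial>nu) + (\<integral>x. g x * (1 / t n * dshift \<epsilon> i (t n) f x) * \<phi> x \<partial>nu)" for n
  proof -
    have "(\<integral>x. ?sh n x * (1 / t n * dshift \<epsilon> i (t n) g x) * \<phi> x \<partial>nu) + (\<integral>x. g x * (1 / t n * dshift \<epsilon> i (t n) f x) * \<phi> x \<partial>nu)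
      = (\<integral>x. ?sh n x * (1 / t n * dshift \<epsilon> i (t n) g x) * \<phi> x + g x * (1 / t n * dshift \<epsilon> i (t n) f x) * \<phi> x \<partial>nu)"
      by (intro Bochner_Integration.integral_add[symmetric] int3 sqint_shift_strip sqint_cmult sqint_dshift slabL2_sq f g t1 e')
    also have "\<dots> = (\<integral>x. (1 / t n * dshift \<epsilon> i (t n) ?P x) * \<phi> x \<partial>nu)"
      by (intro Bochner_Integration.integral_cong) (auto simp: dshift_def indicator_def algebra_simps diff_divide_distrib)
    finally show ?thesis by simp
  qed
  have "- (\<integral>x. ?P x * partial_deriv i \<phi> x \<partial>nu) = (\<integral>x. (?I x * f x) * g' x * \<phi> x \<partial>nu) + (\<integral>x. g x * f' x * \<phi> x \<partial>nu)"
    using LIMSEQ_unique[OF 0 tendsto_add[OF 1 2, folded split]] .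
  also have "\<dots> = (\<integral>x. (?I x * f x) * g' x * \<phi> x + g x * f' x * \<phi> x \<partial>nu)"
    by (intro Bochner_Integration.integral_add[symmetric] int3 I slabL2_sq f g)
  also have "\<dots> = (\<integral>x. (f x * g' x + f' x * g x) * \<phi> x \<partial>nu)"
    using test_on_outside[OF \<phi>] by (intro Bochner_Integration.integral_cong) (auto simp: indicator_def algebra_simps)
  finally show "(\<integral>x. f x * g x * partial_deriv i \<phi> x \<partial>nu) = - (\<integral>x. (f x * g' x + f' x * g x) * \<phi> x \<partial>nu)"
    by simp
qed

definition recip :: "(real^3 \<Rightarrow> real) \<Rightarrow> real^3 \<Rightarrow> real" where
  "recip D x = indicator slab x / D x"

lemma recip_bound:
  assumes "0 < c" "\<And>x. x \<in> slab \<Longrightarrow> c \<le> D x" shows "\<bar>recip D x\<bar> \<le> 1 / c"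
proof (cases "x \<in> slab")
  case True
  then have "c \<le> D x" using assms by simp
  with True assms(1) show ?thesis by (simp add: recip_def frac_le)
qed (use assms(1) in \<open>simp add: recip_def\<close>)

lemma slabL2_recip:
  assumes "slabL2 D" "0 < c" "\<And>x. x \<in> slab \<Longrightarrow> c \<le> D x" shows "slabL2 (recip D)"
proof -
  note [measurable] = slabL2_borel[OF assms(1)]
  have "recip D \<in> borel_measurable borel" unfolding recip_def[abs_def] by measurable
  then have "sqint (recip D)" using recip_bound[OF assms(2,3)] by (intro sqint_bounded[of _ "1 / c"]) auto
  then show ?thesis using slabL2_per[OF assms(1)]
    by (simp add: slabL2_def periodic_on_def recip_def indicator_def)
qed

text \<open>The increment of a reciprocal is exactly minus the product of both reciprocals and the
  increment of \<open>D\<close>. The difference quotients of \<open>D\<close> are thus multiplied by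
  bounded factors that converge in L2, and no chain rule for weak derivatives is involved.\<close>

lemma wd_recip:
  assumes D: "slabL2 D" "slabL2 D'" "wd i D D'" and c: "0 < c" "\<And>x. x \<in> slab \<Longrightarrow> c \<le> D x"
  shows "wd i (recip D) (\<lambda>x. - (recip D x * (recip D x * D' x)))"
  unfolding wd_def
proof (intro allI impI)
  fix \<phi> assume "test_function \<phi>"
  then obtain \<epsilon> where e: "0 < \<epsilon>" "\<epsilon> < 1" and \<phi>: "test_on \<epsilon> (1 - \<epsilon>) \<phi>" by (rule test_function_shrink)
  obtain t where t: "\<And>n. 0 < t n" "\<And>n. t n \<le> \<epsilon>" "t \<longlonglongrightarrow> 0" using null_sequence_le[OF e(1)] by blast
  have t1: "0 \<le> t n" "t n \<le> 1" for n using t(1)[of n] t(2)[of n] e by auto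
  have e': "0 \<le> \<epsilon>" "\<epsilon> \<le> 1" using e by auto
  let ?I = "indicator (strip \<epsilon> (1 - \<epsilon>)) :: real^3 \<Rightarrow> real"
  let ?g = "recip D"
  note gg = slabL2_recip[OF D(1) c] and gb = recip_bound[of c D, OF c]
  note [measurable] = slabL2_borel[OF gg] slabL2_borel[OF D(1)]
  let ?a = "\<lambda>n x. - (?g x * (?I x * ?g (x + t n *\<^sub>R axis i 1)))"
  let ?b = "\<lambda>x. - (?g x * (?I x * ?g x))"
  have key: "dshift \<epsilon> i (t n) ?g x = - (?g x * (?I x * ?g (x + t n *\<^sub>R axis i 1))) * dshift \<epsilon> i (t n) D x" for n x
  proof (cases "x \<in> strip \<epsilon> (1 - \<epsilon>)")
    case True
    have s: "x \<in> slab" using True strip_subset_slab[of \<epsilon> "1 - \<epsilon>"] e' by auto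
    have s2: "x + t n *\<^sub>R axis i 1 \<in> slab"
      using True t1(1)[of n] t(2)[of n] e' by (auto simp: slab_def strip_def axis_def)
    have "0 < D x" "0 < D (x + t n *\<^sub>R axis i 1)" using c s s2 less_le_trans by blast+
    then show ?thesis using True s s2 by (simp add: dshift_def recip_def field_simps)
  qed (simp add: dshift_def)
  have 0: "(\<lambda>n. \<integral>x. (1 / t n * dshift \<epsilon> i (t n) ?g x) * \<phi> x \<partial>nu) \<longlonglongrightarrow> - (\<integral>x. ?g x * partial_deriv i \<phi> x \<partial>nu)"
    by (rule dshift_test_limit[OF gg \<phi> e'(1) t(1) t1(2) t(3)])
  have sqa: "sqint (?a n)" for n
  proof (rule sqint_bounded[of _ "(1 / c) * (1 / c)"])
    show "AE x in nu. \<bar>?a n x\<bar> \<le> (1 / c) * (1 / c)"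
    proof (rule AE_I2)
      fix x
      have "\<bar>?g x\<bar> * \<bar>?I x * ?g (x + t n *\<^sub>R axis i 1)\<bar> \<le> (1 / c) * (1 / c)"
        using gb[of x] gb[of "x + t n *\<^sub>R axis i 1"] c(1) by (intro mult_mono) (auto simp: indicator_def)
      then show "\<bar>?a n x\<bar> \<le> (1 / c) * (1 / c)" by (simp add: abs_mult)
    qed
  qed measurable
  have sqb: "sqint ?b"
  proof (rule sqint_bounded[of _ "(1 / c) * (1 / c)"])
    show "AE x in nu. \<bar>?b x\<bar> \<le> (1 / c) * (1 / c)"
    proof (rule AE_I2)
      fix x
      have "\<bar>?g x\<bar> * \<bar>?I x * ?g x\<bar> \<le> (1 / c) * (1 / c)"
        using gb[of x] c(1) by (intro mult_mono) (auto simp: indicator_def)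
      then show "\<bar>?b x\<bar> \<le> (1 / c) * (1 / c)" by (simp add: abs_mult)
    qed
  qed measurable
  have 1: "(\<lambda>n. \<integral>x. ?a n x * (1 / t n * dshift \<epsilon> i (t n) D x) * \<phi> x \<partial>nu) \<longlonglongrightarrow> (\<integral>x. ?b x * D' x * \<phi> x \<partial>nu)"
  proof (rule dshift_product_limit[OF D \<phi> e' t sqa sqb])
    show "(\<lambda>n. nrm (\<lambda>x. ?a n x - ?b x)) \<longlonglongrightarrow> 0"
    proof (rule Lim_null_comparison[OF always_eventually[OF allI]])
      show "norm (nrm (\<lambda>x. ?a n x - ?b x)) \<le> (1 / c * (1 / c) * (1 / c)) * (t n * nrm D')" for n
      proof -
        have "nrm (\<lambda>x. ?a n x - ?b x) \<le> (1 / c * (1 / c) * (1 / c)) * nrm (dshift \<epsilon> i (t n) D)"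
        proof (rule nrm_mono[OF sqint_dshift[OF D(1) t1 e'(1)]])
          show "AE x in nu. \<bar>?a n x - ?b x\<bar> \<le> (1 / c * (1 / c) * (1 / c)) * \<bar>dshift \<epsilon> i (t n) D x\<bar>"
          proof (rule AE_I2)
            fix x
            \<comment> \<open>Replacing the shifted reciprocal by the unshifted one costs again an
              increment of \<open>recip D\<close>, which \<open>key\<close> bounds by the increment
              of \<open>D\<close> times the cube of \<open>1 / c\<close>.\<close>
            have "?a n x - ?b x = - ?g x * dshift \<epsilon> i (t n) ?g x"
              by (simp add: dshift_def algebra_simps)
            also have "\<bar>\<dots>\<bar> = \<bar>?g x\<bar> * (\<bar>?g x\<bar> * \<bar>?I x * ?g (x + t n *\<^sub>R axis i 1)\<bar>) * \<bar>dshift \<epsilon> i (t n) D x\<bar>"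
              unfolding key by (simp add: abs_mult mult.assoc)
            also have "\<dots> \<le> (1 / c * (1 / c * (1 / c))) * \<bar>dshift \<epsilon> i (t n) D x\<bar>"
              using gb[of x] gb[of "x + t n *\<^sub>R axis i 1"] c(1)
              by (intro mult_mono mult_right_mono) (auto simp: indicator_def)
            finally show "\<bar>?a n x - ?b x\<bar> \<le> (1 / c * (1 / c) * (1 / c)) * \<bar>dshift \<epsilon> i (t n) D x\<bar>" by simp
          qed
        qed (use c(1) sqa sqb in \<open>auto intro!: borel_measurable_diff simp: sqint_def\<close>)
        also have "\<dots> \<le> (1 / c * (1 / c) * (1 / c)) * (t n * nrm D')"
          using c(1) by (intro mult_left_mono nrm_dshift[OF D t(1) t(2) e'(2)]) auto
        finally show ?thesis by simp
      qed
      show "(\<lambda>n. (1 / c * (1 / c) * (1 / c)) * (t n * nrm D')) \<longlonglongrightarrow> 0"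
        using tendsto_mult_left[OF tendsto_mult_right[OF t(3), of "nrm D'"], of "1 / c * (1 / c) * (1 / c)"] by simp
    qed
  qed
  have "(\<lambda>n. \<integral>x. ?a n x * (1 / t n * dshift \<epsilon> i (t n) D x) * \<phi> x \<partial>nu) = (\<lambda>n. \<integral>x. (1 / t n * dshift \<epsilon> i (t n) ?g x) * \<phi> x \<partial>nu)"
    unfolding key by (simp add: mult_ac)
  with LIMSEQ_unique[OF 0] 1
  have "- (\<integral>x. ?g x * partial_deriv i \<phi> x \<partial>nu) = (\<integral>x. ?b x * D' x * \<phi> x \<partial>nu)" by simp
  also have "\<dots> = (\<integral>x. - (?g x * (?g x * D' x)) * \<phi> x \<partial>nu)"
    using test_on_outside[OF \<phi>] by (intro Bochner_Integration.integral_cong) (auto simp: indicator_def)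
  finally show "(\<integral>x. ?g x * partial_deriv i \<phi> x \<partial>nu) = - (\<integral>x. - (?g x * (?g x * D' x)) * \<phi> x \<partial>nu)"
    by linarith
qed

section \<open>Dilation averages and the trace\<close>

text \<open>Integrals of derivatives of test functions vanish. The difference quotients of the
  constant 1 are 0 on the strip for small shifts, so no explicit integration over the cell and its
  periodic faces is needed.\<close>

lemma wd_indicator_slab: "wd i (\<lambda>x. indicator slab x) (\<lambda>x. 0)"
  unfolding wd_def
proof (intro allI impI)
  let ?h = "\<lambda>x. indicator slab x :: real"
  fix \<phi> assume "test_function \<phi>"
  then obtain \<epsilon> where e: "0 < \<epsilon>" "\<epsilon> < 1" and \<phi>: "test_on \<epsilon> (1 - \<epsilon>) \<phi>" by (rule test_function_shrink)
  obtain t where t: "\<And>n. 0 < t n" "\<And>n. t n \<le> \<epsilon>" "t \<longlonglongrightarrow> 0" using null_sequence_le[OF e(1)] by blast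
  have t1: "t n \<le> 1" for n using t(2)[of n] e by auto
  have g: "slabL2 ?h"
    using slabL2_smooth_slab[OF smooth_const[of 1]] by (simp add: periodic_on_def)
  have "(\<lambda>n. \<integral>x. (1 / t n * dshift \<epsilon> i (t n) ?h x) * \<phi> x \<partial>nu) \<longlonglongrightarrow> - (\<integral>x. ?h x * partial_deriv i \<phi> x \<partial>nu)"
    using e by (intro dshift_test_limit g \<phi> t t1) auto
  moreover have "dshift \<epsilon> i (t n) ?h x = 0" for n x
  proof (cases "x \<in> strip \<epsilon> (1 - \<epsilon>)")
    case True
    then have "x \<in> slab" "x + t n *\<^sub>R axis i 1 \<in> slab"
      using t(1)[of n] t(2)[of n] e by (auto simp: slab_def strip_def axis_def)
    then show ?thesis by (simp add: dshift_def)
  qed (simp add: dshift_def)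
  ultimately have "(\<lambda>n::nat. 0) \<longlonglongrightarrow> - (\<integral>x. ?h x * partial_deriv i \<phi> x \<partial>nu)" by simp
  from LIMSEQ_unique[OF this tendsto_const]
  show "(\<integral>x. ?h x * partial_deriv i \<phi> x \<partial>nu) = - (\<integral>x. 0 * \<phi> x \<partial>nu)" by simp
qed

text \<open>The product of \<open>w\<close> with a test function is again a test function, and the
  integral of its derivative vanishes by \<open>wd_indicator_slab\<close>.\<close>

lemma wd_smooth:
  assumes w: "smooth w" "periodic_on UNIV w"
  shows "wd i (\<lambda>x. indicator slab x * w x) (\<lambda>x. indicator slab x * partial_deriv i w x)"
  unfolding wd_def
proof (intro allI impI)
  fix \<phi> assume \<phi>: "test_function \<phi>"
  have s: "smooth \<phi>" using \<phi> by (rule test_smooth)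
  have "test_function (\<lambda>x. w x * \<phi> x)"
    using \<phi> w unfolding test_function_iff by (intro test_on_mult)
  then have "(\<integral>x. indicator slab x * partial_deriv i (\<lambda>x. w x * \<phi> x) x \<partial>nu) = - (\<integral>x. 0 * (w x * \<phi> x) \<partial>nu)"
    using wd_indicator_slab[of i] unfolding wd_def by blast
  moreover have "partial_deriv i (\<lambda>x. w x * \<phi> x) x = w x * partial_deriv i \<phi> x + partial_deriv i w x * \<phi> x" for x
    by (intro partial_deriv_mult smooth_differentiable w s)
  ultimately have "(\<integral>x. (indicator slab x * w x) * partial_deriv i \<phi> x + (indicator slab x * partial_deriv i w x) * \<phi> x \<partial>nu) = 0"
    by (simp add: algebra_simps)
  moreover have "integrable nu (\<lambda>x. (indicator slab x * w x) * partial_deriv i \<phi> x)"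
    "integrable nu (\<lambda>x. (indicator slab x * partial_deriv i w x) * \<phi> x)"
    by (intro sqint_mult_integrable slabL2_sq slabL2_smooth_slab smooth_sq w s smooth_partial_deriv partial_deriv_periodic)+
  ultimately show "(\<integral>x. indicator slab x * w x * partial_deriv i \<phi> x \<partial>nu) = - (\<integral>x. indicator slab x * partial_deriv i w x * \<phi> x \<partial>nu)"
    by simp
qed

lemma sob_smooth:
  assumes "smooth w" "periodic_on UNIV w" shows "\<exists>K. sob k m K (\<lambda>x. indicator slab x * w x)"
  using assms
proof (induction k arbitrary: m w)
  case 0
  obtain B where B: "0 \<le> B" "\<And>x. (\<forall>i. \<bar>x$i\<bar> \<le> 1) \<Longrightarrow> \<bar>w x\<bar> \<le> B"
    using continuous_bounded_on_box[OF smooth_continuous[OF 0(1)], of 1] by auto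
  let ?K = "max B (nrm (\<lambda>x. indicator slab x * w x))"
  have "AE x in nu. \<bar>indicator slab x * w x\<bar> \<le> ?K"
    using B cell_bound by (intro AE_nu_cell) (auto simp: indicator_def abs_mult le_max_iff_disj)
  then have "sob 0 m ?K (\<lambda>x. indicator slab x * w x)"
    using slabL2_smooth_slab[OF 0] by simp
  then show ?case by blast
next
  case (Suc k)
  let ?w = "\<lambda>x. indicator slab x * w x"
  obtain B where B: "0 \<le> B" "\<And>x. (\<forall>i. \<bar>x$i\<bar> \<le> 1) \<Longrightarrow> \<bar>w x\<bar> \<le> B"
    using continuous_bounded_on_box[OF smooth_continuous[OF Suc.prems(1)], of 1] by auto
  have "\<exists>L. sob k (m - 1) L (\<lambda>x. indicator slab x * partial_deriv i w x)" for i
    using Suc by (intro Suc.IH smooth_partial_deriv partial_deriv_periodic)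
  then obtain L where L: "\<And>i. sob k (m - 1) (L i) (\<lambda>x. indicator slab x * partial_deriv i w x)" by metis
  define K where "K = B + nrm ?w + (\<Sum>i\<in>UNIV. L i)"
  have L0: "0 \<le> L i" for i by (rule sob_nonneg[OF L])
  have LK: "L i \<le> K" for i
  proof -
    have "L i \<le> sum L UNIV" by (rule member_le_sum) (simp_all add: L0)
    then show ?thesis using B(1) nrm_nonneg[of ?w] unfolding K_def by linarith
  qed
  have BK: "B \<le> K" "nrm ?w \<le> K"
    using sum_nonneg[of UNIV L] L0 B(1) nrm_nonneg[of ?w] by (simp_all add: K_def)
  have "AE x in nu. \<bar>?w x\<bar> \<le> K"
  proof (rule AE_nu_cell)
    fix x :: "real^3" assume "x \<in> cell"
    then have "\<bar>w x\<bar> \<le> B" using B(2) cell_bound by blast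
    with BK(1) B(1) show "\<bar>?w x\<bar> \<le> K" by (auto simp: indicator_def)
  qed
  moreover have "\<exists>v. wd i ?w v \<and> sob k (m - 1) K v" for i
    using wd_smooth[OF Suc.prems, of i] sob_mono[OF L[of i] order_refl order_refl LK] by blast
  ultimately have "sob (Suc k) m K ?w" using slabL2_smooth_slab[OF Suc.prems] BK by simp
  then show ?case by blast
qed

section \<open>Contraction along vertical lines towards a face, with the projection onto the face at
  \<theta> = 0\<close>

definition contract :: "real \<Rightarrow> real \<Rightarrow> real^3 \<Rightarrow> real^3" where
  "contract c \<theta> x = x + ((\<theta> - 1) * (x$3 - c)) *\<^sub>R axis 3 1"

lemma contract_nth [simp]: "contract c \<theta> x $ 1 = x$1" "contract c \<theta> x $ 2 = x$2" "contract c \<theta> x $ 3 = c + \<theta> * (x$3 - c)"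
  by (simp_all add: contract_def algebra_simps)

definition contract_scale :: "real \<Rightarrow> real^3" where
  "contract_scale \<theta> = (\<chi> i. if i = 3 then \<theta> else 1)"

lemma contract_scale_nth [simp]: "contract_scale \<theta> $ i = (if i = 3 then \<theta> else 1)"
  by (simp add: contract_scale_def)

lemma contract_eq: "contract c \<theta> = diag_affine ((c * (1 - \<theta>)) *\<^sub>R axis 3 1) (contract_scale \<theta>)"
  by (auto simp: fun_eq_iff vec_eq_iff forall_3 algebra_simps)

lemma contract_inverse: "\<theta> \<noteq> 0 \<Longrightarrow> contract c (1 / \<theta>) (contract c \<theta> x) = x"
  by (simp add: vec_eq_iff forall_3)

lemma contract_slab:
  assumes "x \<in> slab" "c \<in> {0, 1}" "0 < \<theta>" "\<theta> \<le> 1" shows "contract c \<theta> x \<in> slab"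
proof -
  have x: "0 < x$3" "x$3 < 1" using assms by (auto simp: slab_def)
  have "\<theta> * x$3 < 1" "0 < \<theta> * x$3" "\<theta> * (1 - x$3) < 1" "0 < \<theta> * (1 - x$3)"
  proof -
    have "\<theta> * x$3 \<le> x$3" "\<theta> * (1 - x$3) \<le> 1 - x$3"
      using x assms(3,4) by (intro mult_left_le_one_le; simp)+
    then show "\<theta> * x$3 < 1" "\<theta> * (1 - x$3) < 1" using x by linarith+
  qed (use x assms(3) in simp_all)
  then show ?thesis using assms(2) by (auto simp: slab_def algebra_simps)
qed

lemma contract_cell: "x \<in> cell \<Longrightarrow> c \<in> {0, 1} \<Longrightarrow> 0 < \<theta> \<Longrightarrow> \<theta> \<le> 1 \<Longrightarrow> contract c \<theta> x \<in> cell"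
  using contract_slab[of x c \<theta>] by (auto simp: cell_eq tube_def)

lemma contract_plus_axis: "contract c \<theta> (x + axis 1 1) = contract c \<theta> x + axis 1 1" "contract c \<theta> (x + axis 2 1) = contract c \<theta> x + axis 2 1"
  by (simp_all add: contract_def)

lemma borel_contract [measurable]: "contract c \<theta> \<in> borel_measurable borel"
  unfolding contract_eq by measurable

lemma nn_integral_contract:
  assumes [measurable]: "F \<in> borel_measurable borel" and t: "0 < \<theta>"
  shows "(\<integral>\<^sup>+x. F (contract c \<theta> x) \<partial>lborel) = ennreal (1 / \<theta>) * (\<integral>\<^sup>+x. F x \<partial>lborel)"
proof -
  have "(\<integral>\<^sup>+x. F x \<partial>lborel) = ennreal \<theta> * (\<integral>\<^sup>+x. F (contract c \<theta> x) \<partial>lborel)"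
    unfolding contract_eq using t by (subst nn_integral_diag_affine[of F "contract_scale \<theta>"]) auto
  then have "ennreal (1 / \<theta>) * (\<integral>\<^sup>+x. F x \<partial>lborel) = (ennreal (1 / \<theta>) * ennreal \<theta>) * (\<integral>\<^sup>+x. F (contract c \<theta> x) \<partial>lborel)"
    by (simp add: mult.assoc)
  also have "ennreal (1 / \<theta>) * ennreal \<theta> = 1" using t by (simp add: ennreal_mult[symmetric])
  finally show ?thesis by simp
qed

lemma integral_contract:
  fixes F :: "real^3 \<Rightarrow> real"
  assumes [measurable]: "F \<in> borel_measurable borel" and t: "0 < \<theta>"
  shows "(\<integral>x. F (contract c \<theta> x) \<partial>lborel) = 1 / \<theta> * (\<integral>x. F x \<partial>lborel)"
proof -
  have "(\<integral>\<^sup>+x. ennreal (G (contract c \<theta> x)) \<partial>lborel) = (\<integral>\<^sup>+x. ennreal (1 / \<theta> * G x) \<partial>lborel)"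
    if [measurable]: "G \<in> borel_measurable borel" for G
    using t nn_integral_contract[of "\<lambda>x. ennreal (G x)" \<theta> c]
    by (subst ennreal_mult') (auto simp: nn_integral_cmult)
  from this[of F] this[of "\<lambda>x. - F x"]
  have "(\<integral>x. F (contract c \<theta> x) \<partial>lborel) = (\<integral>x. 1 / \<theta> * F x \<partial>lborel)"
    by (intro integral_eq_of_nn_integral_eq(1)) auto
  then show ?thesis by simp
qed

text \<open>The factor \<open>1 / \<theta>\<close> is the inverse Jacobian. There is only an
  inequality because the contraction maps the cell onto a part of it.\<close>

lemma nn_integral_nu_contract_le:
  assumes [measurable]: "F \<in> borel_measurable borel" and c: "c \<in> {0, 1}" and t: "0 < \<theta>" "\<theta> \<le> 1"
  shows "(\<integral>\<^sup>+x. F (contract c \<theta> x) \<partial>nu) \<le> ennreal (1 / \<theta>) * (\<integral>\<^sup>+x. F x \<partial>nu)"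
proof -
  have "(\<integral>\<^sup>+x. F (contract c \<theta> x) \<partial>nu) = (\<integral>\<^sup>+x. indicator cell x * F (contract c \<theta> x) \<partial>lborel)"
    by (simp add: nn_integral_nu)
  also have "\<dots> \<le> (\<integral>\<^sup>+x. indicator cell (contract c \<theta> x) * F (contract c \<theta> x) \<partial>lborel)"
    using contract_cell[OF _ c t] by (intro nn_integral_mono) (auto simp: indicator_def)
  also have "\<dots> = ennreal (1 / \<theta>) * (\<integral>\<^sup>+x. indicator cell x * F x \<partial>lborel)"
    by (rule nn_integral_contract[where F = "\<lambda>x. indicator cell x * F x"]) (use t in auto)
  finally show ?thesis by (simp add: nn_integral_nu)
qed

text \<open>Equality holds here because \<psi> vanishes off the slab: the points of the cell that
  the contraction misses are sent out of the slab by the inverse dilation.\<close>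

lemma integral_nu_contract:
  assumes w: "slabL2 w" and \<psi>: "\<psi> \<in> borel_measurable borel" "\<And>x. x \<notin> slab \<Longrightarrow> \<psi> x = 0"
    and c: "c \<in> {0, 1}" and t: "0 < \<theta>" "\<theta> \<le> 1"
  shows "(\<integral>x. w (contract c \<theta> x) * \<psi> x \<partial>nu) = 1 / \<theta> * (\<integral>x. w x * \<psi> (contract c (1 / \<theta>) x) \<partial>nu)"
proof -
  note [measurable] = slabL2_borel[OF w] \<psi>(1)
  have nu: "nu = density lborel (\<lambda>x. ennreal (indicator cell x))"
    by (simp add: nu_def ennreal_indicator)
  have i: "integral\<^sup>L nu g = (\<integral>x. indicator cell x * g x \<partial>lborel)" if "g \<in> borel_measurable borel" for g :: "real^3 \<Rightarrow> real"
    unfolding nu using that by (subst integral_density) auto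
  let ?F = "\<lambda>y. indicator cell y * (w y * \<psi> (contract c (1 / \<theta>) y))"
  have "(\<integral>x. w (contract c \<theta> x) * \<psi> x \<partial>nu) = (\<integral>x. indicator cell x * (w (contract c \<theta> x) * \<psi> x) \<partial>lborel)"
    by (rule i) measurable
  also have "\<dots> = (\<integral>x. ?F (contract c \<theta> x) \<partial>lborel)"
  proof (rule Bochner_Integration.integral_cong[OF refl])
    fix x
    have p: "contract c (1 / \<theta>) (contract c \<theta> x) = x" using t by (intro contract_inverse) auto
    show "indicator cell x * (w (contract c \<theta> x) * \<psi> x) = ?F (contract c \<theta> x)"
      unfolding p using contract_slab[OF _ c t, of x] \<psi>(2)[of x]
      by (cases "x \<in> slab") (auto simp: indicator_def cell_eq tube_def)
  qed
  also have "\<dots> = 1 / \<theta> * (\<integral>x. ?F x \<partial>lborel)"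
    by (rule integral_contract) (use t in auto)
  also have "(\<integral>x. ?F x \<partial>lborel) = (\<integral>x. w x * \<psi> (contract c (1 / \<theta>) x) \<partial>nu)"
    by (rule i[symmetric]) measurable
  finally show ?thesis .
qed

lemma test_contract:
  assumes \<phi>: "test_function \<phi>" and c: "c \<in> {0, 1}" and t: "0 < \<theta>" "\<theta> \<le> 1"
  shows "test_function (\<lambda>x. \<phi> (contract c (1 / \<theta>) x))"
proof -
  obtain e where e: "e > 0" "\<And>x. x$3 < e \<or> 1 - e < x$3 \<Longrightarrow> \<phi> x = 0"
    using \<phi> by (auto simp: test_function_def)
  \<comment> \<open>Towards the face \<open>c\<close> the margin shrinks by the factor \<theta>, at
    the other face it can only grow. The minimum with 1 keeps the distances compared in cases 2 and
    3 nonnegative, as \<open>le\<close> demands.\<close>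
  have q: "\<phi> (contract c (1 / \<theta>) x) = 0" if x: "x$3 < min 1 e * \<theta> \<or> 1 - min 1 e * \<theta> < x$3" for x
  proof (rule e(2))
    let ?m = "min 1 e"
    have m: "0 < ?m" "?m \<le> e" "?m \<le> 1" using e(1) by simp_all
    have m': "?m * \<theta> \<le> ?m" using m(1) t by (intro mult_left_le) simp_all
    have le: "y \<le> y / \<theta>" if "0 \<le> y" for y
      using that t by (simp add: pos_le_divide_eq mult_left_le)
    have lt: "y / \<theta> < e" if "y < ?m * \<theta>" for y
    proof -
      have "?m * \<theta> \<le> e * \<theta>" using t by (intro mult_right_mono m(2)) simp
      then have "y < e * \<theta>" using that by linarith
      then show ?thesis using t(1) by (simp add: pos_divide_less_eq)
    qed
    consider "c = 0" "x$3 < ?m * \<theta>" | "c = 0" "1 - ?m * \<theta> < x$3" | "c = 1" "x$3 < ?m * \<theta>" | "c = 1" "1 - ?m * \<theta> < x$3"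
      using c x by auto
    then show "contract c (1 / \<theta>) x $ 3 < e \<or> 1 - e < contract c (1 / \<theta>) x $ 3"
    proof cases
      case 1 then show ?thesis using lt by simp
    next
      case 2
      then have "1 - e < x$3" "0 \<le> x$3" using m m' by linarith+
      then show ?thesis using 2 le[of "x$3"] by simp
    next
      case 3
      then have "1 - e < 1 - x$3" "0 \<le> 1 - x$3" using m m' by linarith+
      then have "1 - e < (1 - x$3) / \<theta>" using le[of "1 - x$3"] by simp
      then show ?thesis using 3 by (simp add: diff_divide_distrib)
    next
      case 4
      then have "(1 - x$3) / \<theta> < e" by (intro lt) simp
      then show ?thesis using 4 by (simp add: diff_divide_distrib)
    qed
  qed
  have "0 < min 1 e * \<theta>" using e(1) t by simp
  moreover have "smooth (\<lambda>x. \<phi> (contract c (1 / \<theta>) x))"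
    unfolding contract_eq by (intro smooth_diag_affine test_smooth \<phi>)
  moreover have "periodic_on UNIV (\<lambda>x. \<phi> (contract c (1 / \<theta>) x))"
    using \<phi> by (simp add: test_function_def periodic_on_def contract_plus_axis)
  ultimately show ?thesis using q unfolding test_function_def by blast
qed

text \<open>The weak chain rule for a vertical contraction: the dilation is moved to the test
  function, differentiated there and moved back. Only the third direction is scaled, which explains
  the exponent.\<close>

lemma integral_contract_partial_deriv:
  assumes w: "slabL2 w" "slabL2 w'" "wd i w w'" and \<phi>: "test_function \<phi>" and c: "c \<in> {0, 1}" and t: "0 < \<theta>" "\<theta> \<le> 1"
  shows "(\<integral>x. w (contract c \<theta> x) * partial_deriv i \<phi> x \<partial>nu)
    = - (\<theta> ^ (if i = 3 then 1 else 0) * (\<integral>x. w' (contract c \<theta> x) * \<phi> x \<partial>nu))"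
proof -
  note sm = test_smooth[OF \<phi>]
  have out: "x \<notin> slab \<Longrightarrow> \<phi> x = 0" "x \<notin> slab \<Longrightarrow> partial_deriv i \<phi> x = 0" for x
    using test_on_outside[of 0 1 \<phi> x] test_on_outside[of 0 1 "partial_deriv i \<phi>" x] \<phi> test_partial_deriv[OF \<phi>]
    by (auto simp: test_function_iff slab_def strip_def)
  have pd: "partial_deriv i (\<lambda>x. \<phi> (contract c (1 / \<theta>) x)) x = contract_scale (1 / \<theta>) $ i * partial_deriv i \<phi> (contract c (1 / \<theta>) x)" for x
    unfolding contract_eq by (rule partial_deriv_diag_affine) (rule smooth_differentiable[OF sm])
  then have pd': "partial_deriv i \<phi> (contract c (1 / \<theta>) x) = \<theta> ^ (if i = 3 then 1 else 0) * partial_deriv i (\<lambda>x. \<phi> (contract c (1 / \<theta>) x)) x" for x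
    using t by simp
  have "(\<integral>x. w (contract c \<theta> x) * partial_deriv i \<phi> x \<partial>nu) = 1 / \<theta> * (\<integral>x. w x * partial_deriv i \<phi> (contract c (1 / \<theta>) x) \<partial>nu)"
    by (intro integral_nu_contract w out c t smooth_borel smooth_partial_deriv sm)
  also have "(\<integral>x. w x * partial_deriv i \<phi> (contract c (1 / \<theta>) x) \<partial>nu)
      = (\<integral>x. \<theta> ^ (if i = 3 then 1 else 0) * (w x * partial_deriv i (\<lambda>x. \<phi> (contract c (1 / \<theta>) x)) x) \<partial>nu)"
    unfolding pd' by (intro Bochner_Integration.integral_cong) (auto simp: mult_ac)
  also have "\<dots> = \<theta> ^ (if i = 3 then 1 else 0) * (\<integral>x. w x * partial_deriv i (\<lambda>x. \<phi> (contract c (1 / \<theta>) x)) x \<partial>nu)"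
    by (rule integral_mult_right_zero)
  also have "(\<integral>x. w x * partial_deriv i (\<lambda>x. \<phi> (contract c (1 / \<theta>) x)) x \<partial>nu) = - (\<integral>x. w' x * \<phi> (contract c (1 / \<theta>) x) \<partial>nu)"
    using w(3) test_contract[OF \<phi> c t] unfolding wd_def by blast
  finally have "(\<integral>x. w (contract c \<theta> x) * partial_deriv i \<phi> x \<partial>nu)
     = - (\<theta> ^ (if i = 3 then 1 else 0) * (1 / \<theta> * (\<integral>x. w' x * \<phi> (contract c (1 / \<theta>) x) \<partial>nu)))"
    by (simp add: mult_ac)
  also have "1 / \<theta> * (\<integral>x. w' x * \<phi> (contract c (1 / \<theta>) x) \<partial>nu) = (\<integral>x. w' (contract c \<theta> x) * \<phi> x \<partial>nu)"
    by (intro integral_nu_contract[symmetric] w out c t smooth_borel sm)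
  finally show ?thesis .
qed

section \<open>Weighted averages over vertical segments and Hardy's inequality\<close>

text \<open>
  \<open>avg 0 c w\<close> is the mean of \<open>w\<close> over the vertical segment from the face \<open>x\<^sub>3 = c\<close> to \<open>x\<close>; the weight
  \<open>\<theta>\<^sup>a\<close> makes the family closed under \<open>\<partial>\<^sub>3\<close>.
\<close>

definition avg :: "nat \<Rightarrow> real \<Rightarrow> (real^3 \<Rightarrow> real) \<Rightarrow> real^3 \<Rightarrow> real" where
  "avg a c w x = indicator slab x * (\<integral>\<theta>. indicator {0<..<1} \<theta> * \<theta> ^ a * w (contract c \<theta> x) \<partial>lborel)"

text \<open>A common majorant of all \<open>avg a c w\<close> that is defined without any
  integrability; where it is finite, the integral in \<open>avg\<close> is a genuine one.\<close>

definition avg_abs :: "real \<Rightarrow> (real^3 \<Rightarrow> real) \<Rightarrow> real^3 \<Rightarrow> ennreal" where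
  "avg_abs c w x = (\<integral>\<^sup>+\<theta>. ennreal (indicator {0<..<1} \<theta> * \<bar>w (contract c \<theta> x)\<bar>) \<partial>lborel)"

interpretation nu_lborel: pair_sigma_finite nu "lborel :: real measure"
  by (intro pair_sigma_finite.intro nu.sigma_finite_measure_axioms lborel.sigma_finite_measure_axioms)

lemma measurable_contract_pair [measurable]:
  "(\<lambda>p. contract c (snd p) (fst p)) \<in> borel_measurable (nu \<Otimes>\<^sub>M lborel)"
  "(\<lambda>\<theta>. contract c \<theta> x) \<in> borel_measurable borel"
  "(\<lambda>p. contract c (snd p) (fst p)) \<in> borel_measurable (borel \<Otimes>\<^sub>M lborel)"
  unfolding contract_def by measurable

text \<open>This 2 is the constant in Hardy's inequality, and it enters the sup bound again as the
  integral over all scales.\<close>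

lemma nn_integral_inverse_sqrt: "(\<integral>\<^sup>+\<theta>. ennreal (indicator {0<..<1} \<theta> * \<theta> powr (- 1 / 2)) \<partial>lborel) = 2"
proof -
  have "((\<lambda>x. x powr (- 1 / 2)) has_integral (1 powr (- 1 / 2 + 1) / (- 1 / 2 + 1))) {0..1::real}"
    by (rule has_integral_powr_from_0) auto
  then have "((\<lambda>x::real. if x \<in> {0..1} then x powr (- 1 / 2) else 0) has_integral 2) UNIV"
    unfolding has_integral_restrict_UNIV by simp
  moreover have "(\<lambda>x::real. if x \<in> {0..1} then x powr (- 1 / 2) else 0) = (\<lambda>x. indicator {0..1} x * x powr (- 1 / 2))"
    by (auto simp: indicator_def)
  ultimately have "((\<lambda>x. indicator {0..1} x * x powr (- 1 / 2)) has_integral 2) (UNIV :: real set)"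
    by simp
  then have "(\<integral>\<^sup>+\<theta>. ennreal (indicator {0..1} \<theta> * \<theta> powr (- 1 / 2)) \<partial>lborel) = ennreal 2"
    by (intro nn_integral_has_integral_lborel) auto
  moreover have "(\<integral>\<^sup>+\<theta>. ennreal (indicator {0<..<1} \<theta> * \<theta> powr (- 1 / 2)) \<partial>lborel)
      = (\<integral>\<^sup>+\<theta>. ennreal (indicator {0..1} \<theta> * \<theta> powr (- 1 / 2)) \<partial>lborel)"
    using AE_lborel_singleton[of "0::real"] AE_lborel_singleton[of "1::real"]
    by (intro nn_integral_cong_AE) (auto elim!: eventually_elim2 simp: indicator_def)
  ultimately show ?thesis by simp
qed

text \<open>
  Hardy's inequality: Cauchy--Schwarz with the weights \<open>\<theta>\<^sup>-\<^sup>1\<^sup>/\<^sup>4\<close> and \<open>\<theta>\<^sup>1\<^sup>/\<^sup>4\<close>.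
\<close>

lemma avg_abs_bound:
  assumes w: "slabL2 w" and c: "c \<in> {0, 1}"
  shows "(\<integral>\<^sup>+x. (avg_abs c w x)\<^sup>2 \<partial>nu) \<le> ennreal ((2 * nrm w)\<^sup>2)"
proof -
  note [measurable] = slabL2_borel[OF w]
  let ?r = "\<lambda>\<theta>::real. ennreal (indicator {0<..<1} \<theta> * \<theta> powr (- 1 / 4))"
  let ?s = "\<lambda>\<theta> x. ennreal (indicator {0<..<1} \<theta> * \<theta> powr (1 / 4) * \<bar>w (contract c \<theta> x)\<bar>)"
  let ?q = "\<lambda>\<theta>. ennreal (indicator {0<..<1} \<theta> * \<theta> powr (1 / 2))"
  have r2: "(\<integral>\<^sup>+\<theta>. (?r \<theta>)\<^sup>2 \<partial>lborel) = 2"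
  proof -
    have "(?r \<theta>)\<^sup>2 = ennreal (indicator {0<..<1} \<theta> * \<theta> powr (- 1 / 2))" for \<theta>
      by (auto simp: ennreal_power indicator_def powr_power)
    then show ?thesis using nn_integral_inverse_sqrt by simp
  qed
  have s2: "(?s \<theta> x)\<^sup>2 = ?q \<theta> * ennreal ((w (contract c \<theta> x))\<^sup>2)" for \<theta> x
    by (auto simp: ennreal_power indicator_def powr_power power_mult_distrib ennreal_mult[symmetric])
  have contract: "(avg_abs c w x)\<^sup>2 \<le> 2 * (\<integral>\<^sup>+\<theta>. (?s \<theta> x)\<^sup>2 \<partial>lborel)" for x
  proof -
    have "avg_abs c w x = (\<integral>\<^sup>+\<theta>. ?r \<theta> * ?s \<theta> x \<partial>lborel)"
      unfolding avg_abs_def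
    proof (rule nn_integral_cong)
      fix \<theta> :: real
      have "\<theta> powr (- 1 / 4) * \<theta> powr (1 / 4) = 1" if "\<theta> > 0"
        using that by (simp add: powr_add[symmetric])
      then have "\<theta> powr (- 1 / 4) * (\<theta> powr (1 / 4) * \<bar>w (contract c \<theta> x)\<bar>) = \<bar>w (contract c \<theta> x)\<bar>" if "\<theta> > 0"
        using that by (simp add: mult.assoc[symmetric])
      then show "ennreal (indicator {0<..<1} \<theta> * \<bar>w (contract c \<theta> x)\<bar>) = ?r \<theta> * ?s \<theta> x"
        by (auto simp: indicator_def ennreal_mult[symmetric])
    qed
    note eq = this
    have "(avg_abs c w x)\<^sup>2 \<le> (\<integral>\<^sup>+\<theta>. (?r \<theta>)\<^sup>2 \<partial>lborel) * (\<integral>\<^sup>+\<theta>. (?s \<theta> x)\<^sup>2 \<partial>lborel)"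
      unfolding eq by (rule Cauchy_Schwarz_nn_integral; measurable)
    then show ?thesis unfolding r2 .
  qed
  have "(\<integral>\<^sup>+x. (avg_abs c w x)\<^sup>2 \<partial>nu) \<le> (\<integral>\<^sup>+x. 2 * (\<integral>\<^sup>+\<theta>. (?s \<theta> x)\<^sup>2 \<partial>lborel) \<partial>nu)"
    by (intro nn_integral_mono contract)
  also have "\<dots> = 2 * (\<integral>\<^sup>+x. (\<integral>\<^sup>+\<theta>. ?q \<theta> * ennreal ((w (contract c \<theta> x))\<^sup>2) \<partial>lborel) \<partial>nu)"
    unfolding s2 by (rule nn_integral_cmult) measurable
  also have "(\<integral>\<^sup>+x. (\<integral>\<^sup>+\<theta>. ?q \<theta> * ennreal ((w (contract c \<theta> x))\<^sup>2) \<partial>lborel) \<partial>nu)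
      = (\<integral>\<^sup>+\<theta>. (\<integral>\<^sup>+x. ?q \<theta> * ennreal ((w (contract c \<theta> x))\<^sup>2) \<partial>nu) \<partial>lborel)"
    using nu_lborel.Fubini[of "\<lambda>p. ?q (snd p) * ennreal ((w (contract c (snd p) (fst p)))\<^sup>2)"] by simp
  \<comment> \<open>The contraction costs \<open>1 / \<theta>\<close>, which lowers the weight with
    exponent 1/2 to exponent -1/2. Its integral is a second factor 2, so that the square of the
    bound carries a 4.\<close>
  also have "\<dots> \<le> (\<integral>\<^sup>+\<theta>. ennreal (indicator {0<..<1} \<theta> * \<theta> powr (- 1 / 2)) * ennreal ((nrm w)\<^sup>2) \<partial>lborel)"
  proof (rule nn_integral_mono)
    fix \<theta> :: real
    show "(\<integral>\<^sup>+x. ?q \<theta> * ennreal ((w (contract c \<theta> x))\<^sup>2) \<partial>nu) \<le> ennreal (indicator {0<..<1} \<theta> * \<theta> powr (- 1 / 2)) * ennreal ((nrm w)\<^sup>2)"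
    proof (cases "0 < \<theta> \<and> \<theta> < 1")
      case True
      have "(\<integral>\<^sup>+x. ?q \<theta> * ennreal ((w (contract c \<theta> x))\<^sup>2) \<partial>nu) = ?q \<theta> * (\<integral>\<^sup>+x. ennreal ((w (contract c \<theta> x))\<^sup>2) \<partial>nu)"
        by (rule nn_integral_cmult) measurable
      also have "\<dots> \<le> ?q \<theta> * (ennreal (1 / \<theta>) * (\<integral>\<^sup>+x. ennreal ((w x)\<^sup>2) \<partial>nu))"
        using True c by (intro mult_left_mono nn_integral_nu_contract_le[where F = "\<lambda>x. ennreal ((w x)\<^sup>2)"]) auto
      also have "\<dots> = (?q \<theta> * ennreal (1 / \<theta>)) * ennreal ((nrm w)\<^sup>2)"
        by (simp add: ennreal_nrm_sq[OF slabL2_sq[OF w]] mult.assoc)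
      also have "?q \<theta> * ennreal (1 / \<theta>) = ennreal (indicator {0<..<1} \<theta> * \<theta> powr (- 1 / 2))"
      proof -
        have "\<theta> powr (1 / 2) * (1 / \<theta>) = \<theta> powr (1 / 2) * \<theta> powr (-1)" using True by (simp only: powr_neg_one)
        also have "\<dots> = \<theta> powr (1 / 2 + (-1))" by (rule powr_add[symmetric])
        also have "\<dots> = \<theta> powr (- 1 / 2)" by simp
        finally show ?thesis using True by (simp add: ennreal_mult[symmetric])
      qed
      finally show ?thesis .
    qed (auto simp: indicator_def)
  qed
  also have "\<dots> = 2 * ennreal ((nrm w)\<^sup>2)"
    by (subst nn_integral_multc) (use nn_integral_inverse_sqrt in simp_all)
  also have "2 * (2 * ennreal ((nrm w)\<^sup>2)) = ennreal ((2 * nrm w)\<^sup>2)"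
    by (simp add: power_mult_distrib ennreal_mult mult.assoc[symmetric])
  finally show ?thesis by (simp add: mult_left_mono)
qed

lemma borel_avg: assumes "slabL2 w" shows "avg a c w \<in> borel_measurable borel"
proof -
  note [measurable] = slabL2_borel[OF assms]
  have "(\<lambda>x. \<integral>\<theta>. indicator {0<..<1} \<theta> * \<theta> ^ a * w (contract c \<theta> x) \<partial>lborel) \<in> borel_measurable borel"
    using lborel.borel_measurable_lebesgue_integral[of "\<lambda>x \<theta>. indicator {0<..<1} \<theta> * \<theta> ^ a * w (contract c \<theta> x)" "borel :: (real^3) measure"]
    by (simp add: case_prod_beta')
  then show ?thesis unfolding avg_def[abs_def] by measurable
qed

lemma borel_avg_abs: assumes "slabL2 w" shows "avg_abs c w \<in> borel_measurable borel"
proof -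
  note [measurable] = slabL2_borel[OF assms]
  have "(\<lambda>x. \<integral>\<^sup>+\<theta>. ennreal (indicator {0<..<1} \<theta> * \<bar>w (contract c \<theta> x)\<bar>) \<partial>lborel) \<in> borel_measurable borel"
    by measurable
  then show ?thesis unfolding avg_abs_def[abs_def] .
qed

lemma integrable_avg:
  assumes "slabL2 w" "avg_abs c w x < \<infinity>"
  shows "integrable lborel (\<lambda>\<theta>. indicator {0<..<1} \<theta> * \<theta> ^ a * w (contract c \<theta> x))"
proof -
  note [measurable] = slabL2_borel[OF assms(1)]
  have "(\<integral>\<^sup>+\<theta>. ennreal (norm (indicator {0<..<1} \<theta> * \<theta> ^ a * w (contract c \<theta> x))) \<partial>lborel) \<le> avg_abs c w x"
    unfolding avg_abs_def
  proof (rule nn_integral_mono, rule ennreal_leI)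
    fix \<theta> :: real
    show "norm (indicator {0<..<1} \<theta> * \<theta> ^ a * w (contract c \<theta> x)) \<le> indicator {0<..<1} \<theta> * \<bar>w (contract c \<theta> x)\<bar>"
      by (auto simp: indicator_def abs_mult power_abs intro!: mult_left_le_one_le power_le_one)
  qed
  also have "\<dots> < \<infinity>" by (rule assms(2))
  finally show ?thesis by (intro integrableI_bounded) measurable
qed

lemma abs_avg_le:
  assumes "slabL2 w" shows "ennreal \<bar>avg a c w x\<bar> \<le> avg_abs c w x"
proof (cases "avg_abs c w x < \<infinity>")
  case True
  have "\<bar>avg a c w x\<bar> \<le> norm (\<integral>\<theta>. indicator {0<..<1} \<theta> * \<theta> ^ a * w (contract c \<theta> x) \<partial>lborel)"
    by (auto simp: avg_def indicator_def)
  then have "ennreal \<bar>avg a c w x\<bar> \<le> ennreal (norm (\<integral>\<theta>. indicator {0<..<1} \<theta> * \<theta> ^ a * w (contract c \<theta> x) \<partial>lborel))"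
    by (rule ennreal_leI)
  also have "\<dots> \<le> (\<integral>\<^sup>+\<theta>. ennreal (norm (indicator {0<..<1} \<theta> * \<theta> ^ a * w (contract c \<theta> x))) \<partial>lborel)"
    by (rule integral_norm_bound_ennreal[OF integrable_avg[OF assms True]])
  also have "\<dots> \<le> avg_abs c w x"
    unfolding avg_abs_def
  proof (rule nn_integral_mono, rule ennreal_leI)
    fix \<theta> :: real
    show "norm (indicator {0<..<1} \<theta> * \<theta> ^ a * w (contract c \<theta> x)) \<le> indicator {0<..<1} \<theta> * \<bar>w (contract c \<theta> x)\<bar>"
      by (auto simp: indicator_def abs_mult power_abs intro!: mult_left_le_one_le power_le_one)
  qed
  finally show ?thesis .
next
  case False
  then show ?thesis by (simp add: not_less top_unique)
qed

lemma avg_slabL2: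
  assumes w: "slabL2 w" and c: "c \<in> {0, 1}"
  shows "slabL2 (avg a c w)" "nrm (avg a c w) \<le> 2 * nrm w"
proof -
  note [measurable] = borel_avg[OF w]
  have "(\<integral>\<^sup>+x. ennreal ((avg a c w x)\<^sup>2) \<partial>nu) \<le> (\<integral>\<^sup>+x. (avg_abs c w x)\<^sup>2 \<partial>nu)"
  proof (rule nn_integral_mono)
    fix x
    have "ennreal ((avg a c w x)\<^sup>2) = (ennreal \<bar>avg a c w x\<bar>)\<^sup>2" by (simp add: ennreal_power)
    also have "\<dots> \<le> (avg_abs c w x)\<^sup>2" by (intro power_mono abs_avg_le w) simp
    finally show "ennreal ((avg a c w x)\<^sup>2) \<le> (avg_abs c w x)\<^sup>2" .
  qed
  also have "\<dots> \<le> ennreal ((2 * nrm w)\<^sup>2)" by (rule avg_abs_bound[OF w c])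
  finally have le: "(\<integral>\<^sup>+x. ennreal ((avg a c w x)\<^sup>2) \<partial>nu) \<le> ennreal ((2 * nrm w)\<^sup>2)" .
  have "sqint (avg a c w)" using sqint_nrm_leI(1)[OF borel_avg[OF w] le] by simp
  moreover have "periodic_on UNIV (avg a c w)"
    using slabL2_per[OF w] by (simp add: periodic_on_def avg_def contract_plus_axis indicator_def)
  ultimately show "slabL2 (avg a c w)" by (simp add: slabL2_def avg_def)
  show "nrm (avg a c w) \<le> 2 * nrm w" using sqint_nrm_leI(2)[OF borel_avg[OF w] le] by simp
qed

lemma avg_abs_finite:
  assumes w: "slabL2 w" and c: "c \<in> {0, 1}" shows "AE x in nu. avg_abs c w x < \<infinity>"
proof -
  have "(\<integral>\<^sup>+x. (avg_abs c w x)\<^sup>2 \<partial>nu) \<noteq> \<infinity>"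
    using avg_abs_bound[OF w c] by (auto simp: top_unique)
  then have "AE x in nu. (avg_abs c w x)\<^sup>2 \<noteq> \<infinity>"
    using borel_avg_abs[OF w, of c] by (intro nn_integral_PInf_AE) auto
  then show ?thesis by eventually_elim (auto simp: less_top power2_eq_square ennreal_mult_eq_top_iff)
qed

text \<open>Linearity can be asserted only where both segments carry integrable functions, since the
  integral of a non-integrable function is 0 by convention.\<close>

lemma avg_diff:
  assumes "slabL2 w" "slabL2 v" "c \<in> {0, 1}"
  shows "AE x in nu. avg a c (\<lambda>x. w x - v x) x = avg a c w x - avg a c v x"
  using avg_abs_finite[OF assms(1,3)] avg_abs_finite[OF assms(2,3)]
proof eventually_elim
  case (elim x)
  have "(\<integral>\<theta>. indicator {0<..<1} \<theta> * \<theta> ^ a * (w (contract c \<theta> x) - v (contract c \<theta> x)) \<partial>lborel)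
    = (\<integral>\<theta>. indicator {0<..<1} \<theta> * \<theta> ^ a * w (contract c \<theta> x) - indicator {0<..<1} \<theta> * \<theta> ^ a * v (contract c \<theta> x) \<partial>lborel)"
    by (simp add: right_diff_distrib)
  also have "\<dots> = (\<integral>\<theta>. indicator {0<..<1} \<theta> * \<theta> ^ a * w (contract c \<theta> x) \<partial>lborel) - (\<integral>\<theta>. indicator {0<..<1} \<theta> * \<theta> ^ a * v (contract c \<theta> x) \<partial>lborel)"
    by (intro Bochner_Integration.integral_diff integrable_avg assms elim)
  finally show ?case by (simp add: avg_def right_diff_distrib)
qed

text \<open>Fubini's theorem; joint integrability comes from Cauchy--Schwarz for
  \<open>avg_abs\<close> and the test function.\<close>

lemma integral_avg_test:
  assumes w: "slabL2 w" and c: "c \<in> {0, 1}" and \<psi>: "test_function \<psi>"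
  shows "(\<integral>x. avg a c w x * \<psi> x \<partial>nu) = (\<integral>\<theta>. indicator {0<..<1} \<theta> * \<theta> ^ a * (\<integral>x. w (contract c \<theta> x) * \<psi> x \<partial>nu) \<partial>lborel)"
proof -
  note [measurable] = slabL2_borel[OF w] smooth_borel[OF test_smooth[OF \<psi>]] borel_avg_abs[OF w]
  have out: "\<psi> x = 0" if "x \<notin> slab" for x
    using test_on_outside[of 0 1 \<psi> x] \<psi> that by (auto simp: test_function_iff slab_def strip_def)
  have sqint\<psi>: "sqint \<psi>" using \<psi> by (simp add: test_function_iff test_on_sq)
  let ?f = "\<lambda>x \<theta>. indicator {0<..<1} \<theta> * \<theta> ^ a * w (contract c \<theta> x) * \<psi> x"
  have m: "(\<lambda>p. ?f (fst p) (snd p)) \<in> borel_measurable (nu \<Otimes>\<^sub>M lborel)" by measurable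
  have "(\<integral>\<^sup>+p. ennreal (norm (?f (fst p) (snd p))) \<partial>(nu \<Otimes>\<^sub>M lborel)) = (\<integral>\<^sup>+x. \<integral>\<^sup>+\<theta>. ennreal (norm (?f x \<theta>)) \<partial>lborel \<partial>nu)"
    using lborel.nn_integral_fst[of "\<lambda>p. ennreal (norm (?f (fst p) (snd p)))" nu] by simp
  also have "\<dots> \<le> (\<integral>\<^sup>+x. avg_abs c w x * ennreal \<bar>\<psi> x\<bar> \<partial>nu)"
  proof (rule nn_integral_mono)
    fix x
    have "(\<integral>\<^sup>+\<theta>. ennreal (norm (?f x \<theta>)) \<partial>lborel) \<le> (\<integral>\<^sup>+\<theta>. ennreal (indicator {0<..<1} \<theta> * \<bar>w (contract c \<theta> x)\<bar>) * ennreal \<bar>\<psi> x\<bar> \<partial>lborel)"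
    proof (rule nn_integral_mono)
      fix \<theta> :: real
      have "norm (?f x \<theta>) \<le> indicator {0<..<1} \<theta> * \<bar>w (contract c \<theta> x)\<bar> * \<bar>\<psi> x\<bar>"
        by (auto simp: indicator_def abs_mult power_abs intro!: mult_right_mono mult_left_le_one_le power_le_one)
      then show "ennreal (norm (?f x \<theta>)) \<le> ennreal (indicator {0<..<1} \<theta> * \<bar>w (contract c \<theta> x)\<bar>) * ennreal \<bar>\<psi> x\<bar>"
        by (simp add: ennreal_mult[symmetric] ennreal_leI)
    qed
    also have "\<dots> = avg_abs c w x * ennreal \<bar>\<psi> x\<bar>"
      unfolding avg_abs_def by (rule nn_integral_multc) measurable
    finally show "(\<integral>\<^sup>+\<theta>. ennreal (norm (?f x \<theta>)) \<partial>lborel) \<le> avg_abs c w x * ennreal \<bar>\<psi> x\<bar>" .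
  qed
  also have "\<dots> < \<infinity>"
  proof -
    have "(\<integral>\<^sup>+x. avg_abs c w x * ennreal \<bar>\<psi> x\<bar> \<partial>nu)\<^sup>2
      \<le> (\<integral>\<^sup>+x. (avg_abs c w x)\<^sup>2 \<partial>nu) * (\<integral>\<^sup>+x. (ennreal \<bar>\<psi> x\<bar>)\<^sup>2 \<partial>nu)"
      by (rule Cauchy_Schwarz_nn_integral) measurable
    also have "\<dots> \<le> ennreal ((2 * nrm w)\<^sup>2) * ennreal ((nrm \<psi>)\<^sup>2)"
      using avg_abs_bound[OF w c] by (intro mult_mono) (simp_all add: ennreal_power ennreal_nrm_sq[OF sqint\<psi>])
    also have "\<dots> < \<infinity>" by (simp add: ennreal_mult[symmetric])
    finally show ?thesis by (auto simp: power2_eq_square less_top[symmetric] ennreal_mult_eq_top_iff)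
  qed
  finally have int: "integrable (nu \<Otimes>\<^sub>M lborel) (\<lambda>p. ?f (fst p) (snd p))"
    using m by (intro integrableI_bounded) auto
  have "(\<integral>x. avg a c w x * \<psi> x \<partial>nu) = (\<integral>x. (\<integral>\<theta>. ?f x \<theta> \<partial>lborel) \<partial>nu)"
  proof (rule Bochner_Integration.integral_cong[OF refl])
    fix x show "avg a c w x * \<psi> x = (\<integral>\<theta>. ?f x \<theta> \<partial>lborel)"
      using out[of x] by (cases "x \<in> slab") (simp_all add: avg_def)
  qed
  also have "\<dots> = (\<integral>\<theta>. (\<integral>x. ?f x \<theta> \<partial>nu) \<partial>lborel)"
    using nu_lborel.Fubini_integral[of ?f] int by (simp add: case_prod_beta')
  also have "\<dots> = (\<integral>\<theta>. indicator {0<..<1} \<theta> * \<theta> ^ a * (\<integral>x. w (contract c \<theta> x) * \<psi> x \<partial>nu) \<partial>lborel)"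
    by (simp add: mult.assoc)
  finally show ?thesis .
qed

text \<open>Under the integral over \<theta> a vertical derivative picks up the factor \<theta> of
  the chain rule, which raises the exponent of the weight by one; horizontal derivatives leave it
  alone.\<close>

lemma wd_avg:
  assumes w: "slabL2 w" "slabL2 w'" "wd i w w'" and c: "c \<in> {0, 1}"
  shows "wd i (avg a c w) (avg (a + (if i = 3 then 1 else 0)) c w')"
  unfolding wd_def
proof (intro allI impI)
  fix \<phi> assume \<phi>: "test_function \<phi>"
  have "(\<integral>x. avg a c w x * partial_deriv i \<phi> x \<partial>nu)
    = (\<integral>\<theta>. indicator {0<..<1} \<theta> * \<theta> ^ a * (\<integral>x. w (contract c \<theta> x) * partial_deriv i \<phi> x \<partial>nu) \<partial>lborel)"
    by (rule integral_avg_test[OF w(1) c test_partial_deriv[OF \<phi>]])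
  also have "\<dots> = (\<integral>\<theta>. - (indicator {0<..<1} \<theta> * \<theta> ^ (a + (if i = 3 then 1 else 0)) * (\<integral>x. w' (contract c \<theta> x) * \<phi> x \<partial>nu)) \<partial>lborel)"
  proof (rule Bochner_Integration.integral_cong[OF refl])
    fix \<theta> :: real
    show "indicator {0<..<1} \<theta> * \<theta> ^ a * (\<integral>x. w (contract c \<theta> x) * partial_deriv i \<phi> x \<partial>nu)
      = - (indicator {0<..<1} \<theta> * \<theta> ^ (a + (if i = 3 then 1 else 0)) * (\<integral>x. w' (contract c \<theta> x) * \<phi> x \<partial>nu))"
      using integral_contract_partial_deriv[OF w \<phi> c, of \<theta>]
      by (cases "\<theta> \<in> {0<..<1}") (simp_all add: power_add mult.assoc)
  qed
  also have "\<dots> = - (\<integral>x. avg (a + (if i = 3 then 1 else 0)) c w' x * \<phi> x \<partial>nu)"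
    by (simp add: integral_avg_test[OF w(2) c \<phi>])
  finally show "(\<integral>x. avg a c w x * partial_deriv i \<phi> x \<partial>nu) = - (\<integral>x. avg (a + (if i = 3 then 1 else 0)) c w' x * \<phi> x \<partial>nu)" .
qed

text \<open>The bound does not deteriorate with the order because every weight is at most 1. The
  exponent \<open>a\<close> is arbitrary in the induction, as vertical derivatives raise it.\<close>

lemma sob_avg:
  assumes c: "c \<in> {0, 1}" shows "sob k 0 K w \<Longrightarrow> sob k 0 (2 * K) (avg a c w)"
proof (induction k arbitrary: w a)
  case 0
  then show ?case using avg_slabL2[of w c a] c by auto
next
  case (Suc k)
  have "\<exists>v. wd i (avg a c w) v \<and> sob k 0 (2 * K) v" for i
  proof -
    obtain w' where w': "wd i w w'" "sob k 0 K w'" using Suc.prems by auto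
    have "wd i (avg a c w) (avg (a + (if i = 3 then 1 else 0)) c w')"
      by (intro wd_avg sob_good[OF Suc.prems] sob_good[OF w'(2)] w'(1) c)
    with Suc.IH[OF w'(2)] show ?thesis by blast
  qed
  then show ?case using Suc.prems avg_slabL2[of w c a] c by auto
qed

section \<open>Boundary values and functions of trace zero\<close>

lemma borel_measurable_horizontal [measurable]:
  "(\<lambda>x::real^3. vector [x$1, x$2] :: real^2) \<in> borel_measurable borel"
proof (rule borel_measurable_continuous_onI)
  have eq: "(\<lambda>x::real^3. vector [x$1, x$2] :: real^2) = (\<lambda>x. x$1 *\<^sub>R axis 1 1 + x$2 *\<^sub>R axis 2 1)"
    by (auto simp: fun_eq_iff vec_eq_iff forall_2 axis_def)
  show "continuous_on UNIV (\<lambda>x::real^3. vector [x$1, x$2] :: real^2)"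
    unfolding eq by (intro continuous_intros)
qed

text \<open>The slab has height 1, so its volume projects to area. Boundary integrals thereby become
  volume integrals of functions that do not depend on \<open>x$3\<close>, and can be compared with
  \<open>nrm\<close>.\<close>

lemma distr_slab_square:
  "distr (density lborel (indicator slab)) borel (\<lambda>x::real^3. vector [x$1, x$2]) = (lborel :: (real^2) measure)"
proof (rule lborel_eqI[symmetric])
  fix l u :: "real^2" assume lu: "\<And>b. b \<in> Basis \<Longrightarrow> l \<bullet> b \<le> u \<bullet> b"
  have le: "l$i \<le> u$i" for i
    using lu[of "axis i 1"] by (simp add: axis_in_Basis_iff cart_eq_inner_axis)
  have B2: "(Basis :: (real^2) set) = {axis 1 1, axis 2 1}" "axis 1 (1::real) \<noteq> (axis 2 1 :: real^2)"
    by (auto simp: Basis_vec_def UNIV_2 axis_eq_axis)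
  have "emeasure (distr (density lborel (indicator slab)) borel (\<lambda>x::real^3. vector [x$1, x$2])) (box l u)
    = emeasure (density lborel (indicator slab)) ((\<lambda>x::real^3. vector [x$1, x$2]) -` box l u)"
    by (subst emeasure_distr) auto
  also have "\<dots> = (\<integral>\<^sup>+x. indicator slab x * indicator ((\<lambda>x::real^3. vector [x$1, x$2]) -` box l u) x \<partial>lborel)"
    by (subst emeasure_density) (auto intro!: measurable_sets_borel[of _ borel])
  also have "\<dots> = (\<integral>\<^sup>+x. indicator (box (vector [l$1, l$2, 0]) (vector [u$1, u$2, 1])) x \<partial>(lborel :: (real^3) measure))"
    by (intro nn_integral_cong) (auto simp: indicator_def slab_def mem_box_cart forall_2 forall_3)
  also have "\<dots> = emeasure lborel (box (vector [l$1, l$2, 0]) (vector [u$1, u$2, 1]) :: (real^3) set)"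
    by simp
  also have "\<dots> = ennreal (\<Prod>b\<in>Basis. (vector [u$1, u$2, 1] - vector [l$1, l$2, 0] :: real^3) \<bullet> b)"
  proof (rule emeasure_lborel_box)
    fix b :: "real^3" assume "b \<in> Basis"
    then obtain i where "b = axis i 1" by (auto simp: Basis_vec_def)
    then show "vector [l$1, l$2, 0] \<bullet> b \<le> vector [u$1, u$2, 1] \<bullet> b"
      using exhaust_3[of i] le by (auto simp: inner_axis_nth)
  qed
  also have "(\<Prod>b\<in>Basis. (vector [u$1, u$2, 1] - vector [l$1, l$2, 0] :: real^3) \<bullet> b) = (\<Prod>b\<in>Basis. (u - l) \<bullet> b)"
  proof -
    have "(\<Prod>b\<in>Basis. (u - l) \<bullet> b) = ((u - l) \<bullet> axis 1 1) * ((u - l) \<bullet> axis 2 1)"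
      unfolding B2(1) using B2(2) by simp
    then show ?thesis by (simp add: prod_Basis_3 inner_axis_nth cart_eq_inner_axis[symmetric] inner_diff_left)
  qed
  finally show "emeasure (distr (density lborel (indicator slab)) borel (\<lambda>x::real^3. vector [x$1, x$2])) (box l u)
    = ennreal (\<Prod>b\<in>Basis. (u - l) \<bullet> b)" .
qed simp

lemma integral_bdry:
  assumes w: "smooth w" and c: "c \<in> {0, 1}"
  shows "(\<integral>y. (w (vector [y$1, y$2, c]))\<^sup>2 \<partial>lebesgue_on square) = (\<integral>x. (w (contract c 0 x))\<^sup>2 \<partial>nu)"
proof -
  have [measurable]: "(\<lambda>y::real^2. y$i) \<in> borel_measurable borel" for i
    by (intro borel_measurable_continuous_onI continuous_intros)
  have sqint[measurable]: "square \<in> sets borel" unfolding square_def by measurable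
  have cont: "continuous_on UNIV (\<lambda>y::real^2. vector [y$1, y$2, c] :: real^3)"
  proof -
    have "(\<lambda>y::real^2. vector [y$1, y$2, c] :: real^3) = (\<lambda>y. y$1 *\<^sub>R axis 1 1 + y$2 *\<^sub>R axis 2 1 + c *\<^sub>R axis 3 1)"
      by (auto simp: fun_eq_iff vec_eq_iff forall_3)
    note eq = this
    show ?thesis unfolding eq by (intro continuous_intros)
  qed
  have [measurable]: "(\<lambda>y::real^2. w (vector [y$1, y$2, c])) \<in> borel_measurable borel"
    by (intro borel_measurable_continuous_onI continuous_on_compose2[OF smooth_continuous[OF w] cont]) auto
  let ?F = "\<lambda>y::real^2. indicator square y * (w (vector [y$1, y$2, c]))\<^sup>2"
  have "(\<integral>y. (w (vector [y$1, y$2, c]))\<^sup>2 \<partial>lebesgue_on square) = (\<integral>y. ?F y \<partial>lebesgue)"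
    by (subst integral_restrict_space) auto
  also have "\<dots> = (\<integral>y. ?F y \<partial>lborel)"
    by (rule integral_completion) measurable
  also have "\<dots> = (\<integral>y. ?F y \<partial>distr (density lborel (indicator slab)) borel (\<lambda>x::real^3. vector [x$1, x$2]))"
    unfolding distr_slab_square ..
  also have "\<dots> = (\<integral>x. ?F (vector [x$1, x$2]) \<partial>density lborel (indicator slab))"
    by (rule integral_distr) measurable
  also have "\<dots> = (\<integral>x. ?F (vector [x$1, x$2]) \<partial>density lborel (\<lambda>x. ennreal (indicator slab x)))"
    by (simp add: ennreal_indicator)
  also have "\<dots> = (\<integral>x. indicator slab x *\<^sub>R ?F (vector [x$1, x$2]) \<partial>lborel)"
  proof (rule integral_density)
    have "?F \<in> borel_measurable borel" by measurable
    from measurable_compose[OF borel_measurable_horizontal this]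
    show "(\<lambda>x::real^3. ?F (vector [x$1, x$2])) \<in> borel_measurable lborel" by simp
  qed auto
  also have "\<dots> = (\<integral>x. indicator cell x *\<^sub>R (w (contract c 0 x))\<^sup>2 \<partial>lborel)"
  proof (rule Bochner_Integration.integral_cong[OF refl])
    fix x :: "real^3"
    have "contract c 0 x = vector [x$1, x$2, c]" by (simp add: vec_eq_iff forall_3)
    then show "indicator slab x *\<^sub>R ?F (vector [x$1, x$2]) = indicator cell x *\<^sub>R (w (contract c 0 x))\<^sup>2"
      by (auto simp: indicator_def cell_def square_def)
  qed
  also have "\<dots> = (\<integral>x. (w (contract c 0 x))\<^sup>2 \<partial>nu)"
  proof -
    have nu: "nu = density lborel (\<lambda>x. ennreal (indicator cell x))"
      by (simp add: nu_def ennreal_indicator)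
    show ?thesis unfolding nu using smooth_borel[OF w] by (subst integral_density) auto
  qed
  finally show ?thesis .
qed

lemma nrm_contract_0_le_bdry:
  assumes "smooth w" "c \<in> {0, 1}" shows "nrm (\<lambda>x. w (contract c 0 x)) \<le> bdry_norm w"
proof -
  have "(\<integral>x. (w (contract c 0 x))\<^sup>2 \<partial>nu) \<le> (\<Sum>c\<in>{0, 1}. \<integral>y. (w (vector [y$1, y$2, c]))\<^sup>2 \<partial>lebesgue_on square)"
    unfolding integral_bdry[OF assms, symmetric] using assms(2) by (intro member_le_sum) auto
  then show ?thesis by (simp add: nrm_def bdry_norm_def)
qed

text \<open>The fundamental theorem of calculus along the vertical segment from the foot point
  \<open>contract c 0 x\<close> to \<open>x\<close>.\<close>

lemma avg_smooth:
  assumes w: "smooth w" and x: "x \<in> slab" and c: "c \<in> {0, 1}"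
  shows "(x$3 - c) * avg 0 c (\<lambda>x. indicator slab x * partial_deriv 3 w x) x = w x - w (contract c 0 x)"
proof -
  have ptl: "contract c \<theta> x = contract c 0 x + \<theta> *\<^sub>R ((x$3 - c) *\<^sub>R axis 3 1)" for \<theta>
    by (simp add: vec_eq_iff forall_3)
  have sumd: "(\<Sum>i\<in>UNIV. ((x$3 - c) *\<^sub>R axis 3 1) $ i * partial_deriv i w y) = (x$3 - c) * partial_deriv 3 w y" for y
    by (simp add: sum_3)
  have "(\<integral>\<theta>. ((x$3 - c) * partial_deriv 3 w (contract c \<theta> x)) * indicator {0..1} \<theta> \<partial>lborel) = w (contract c 1 x) - w (contract c 0 x)"
  proof (rule integral_FTC_Icc_real)
    fix \<theta> :: real
    show "((\<lambda>\<theta>. w (contract c \<theta> x)) has_real_derivative (x$3 - c) * partial_deriv 3 w (contract c \<theta> x)) (at \<theta>)"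
      using smooth_line_deriv_general[OF w, of "contract c 0 x" "(x$3 - c) *\<^sub>R axis 3 1" \<theta>]
      unfolding sumd ptl[symmetric] .
    have "isCont (\<lambda>\<theta>. contract c \<theta> x) \<theta>" unfolding contract_def by (intro continuous_intros)
    moreover have "isCont (partial_deriv 3 w) (contract c \<theta> x)"
      using smooth_continuous[OF smooth_partial_deriv[OF w, of 3]] by (simp add: continuous_on_eq_continuous_at)
    ultimately have "isCont (\<lambda>\<theta>. partial_deriv 3 w (contract c \<theta> x)) \<theta>" by (rule isCont_o2)
    from isCont_mult[OF continuous_const this]
    show "isCont (\<lambda>\<theta>. (x$3 - c) * partial_deriv 3 w (contract c \<theta> x)) \<theta>" .
  qed auto
  also have "(\<integral>\<theta>. ((x$3 - c) * partial_deriv 3 w (contract c \<theta> x)) * indicator {0..1} \<theta> \<partial>lborel)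
    = (\<integral>\<theta>. (x$3 - c) * (indicator {0<..<1} \<theta> * \<theta> ^ 0 * (indicator slab (contract c \<theta> x) * partial_deriv 3 w (contract c \<theta> x))) \<partial>lborel)"
  proof (rule integral_cong_AE)
    have [measurable]: "partial_deriv 3 w \<in> borel_measurable borel" by (intro smooth_borel smooth_partial_deriv w)
    show "(\<lambda>\<theta>. ((x$3 - c) * partial_deriv 3 w (contract c \<theta> x)) * indicator {0..1} \<theta>) \<in> borel_measurable lborel"
      by measurable
    show "(\<lambda>\<theta>. (x$3 - c) * (indicator {0<..<1} \<theta> * \<theta> ^ 0 * (indicator slab (contract c \<theta> x) * partial_deriv 3 w (contract c \<theta> x)))) \<in> borel_measurable lborel"
      by measurable
    show "AE \<theta> in lborel. (x$3 - c) * partial_deriv 3 w (contract c \<theta> x) * indicator {0..1} \<theta>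
       = (x$3 - c) * (indicator {0<..<1} \<theta> * \<theta> ^ 0 * (indicator slab (contract c \<theta> x) * partial_deriv 3 w (contract c \<theta> x)))"
      using AE_lborel_singleton[of "0::real"] AE_lborel_singleton[of "1::real"]
    proof eventually_elim
      case (elim \<theta>)
      then show ?case using contract_slab[OF x c, of \<theta>] by (auto simp: indicator_def)
    qed
  qed
  also have "\<dots> = (x$3 - c) * avg 0 c (\<lambda>x. indicator slab x * partial_deriv 3 w x) x"
    using x by (simp add: avg_def)
  also have "contract c 1 x = x" by (simp add: contract_def)
  finally show ?thesis by simp
qed

text \<open>For the smooth approximations of \<open>u\<close> the identity holds up to their
  boundary values, by \<open>avg_smooth\<close>. Hardy's inequality makes the average continuous in
  L2, so both sides pass to the limit and the boundary term disappears.\<close>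

lemma trace_avg:
  assumes tr: "has_trace u (\<lambda>_. 0)" and u': "slabL2 u'" "AE x in nu. u x = u' x"
    and u3: "wd 3 u' u3" "slabL2 u3" and c: "c \<in> {0, 1}"
  shows "AE x in nu. u' x = (x$3 - c) * avg 0 c u3 x"
proof -
  obtain w where w: "\<And>n. smooth (w n)" "\<And>n. periodic_on UNIV (w n)"
    "(\<lambda>n. sobolev_norm 1 (\<lambda>x. w n x - u x)) \<longlonglongrightarrow> 0" "(\<lambda>n. bdry_norm (w n)) \<longlonglongrightarrow> 0"
    using tr by (auto simp: has_trace_def)
  have uS: "u \<in> sobolev 1" using tr by (simp add: has_trace_def)
  then have uL: "u \<in> L2" by (simp add: sobolev_def)
  note Zu = sobolev_imp_sob[OF uS u']
  let ?W = "\<lambda>n x. indicator slab x * w n x"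
  let ?g = "\<lambda>n x. indicator slab x * partial_deriv 3 (w n) x"
  let ?N = "\<lambda>n. sobolev_norm 1 (\<lambda>x. w n x - u x)"
  have gW: "slabL2 (?W n)" and gg: "slabL2 (?g n)" and wg: "wd 3 (?W n) (?g n)" for n
    by (intro slabL2_smooth_slab wd_smooth w smooth_partial_deriv partial_deriv_periodic)+
  \<comment> \<open>The Sobolev norm of the difference speaks of derivatives selected by choice;
    uniqueness of weak derivatives identifies the vertical one with \<open>?g n\<close> minus
    \<open>u3\<close>.\<close>
  have est: "nrm (\<lambda>x. ?W n x - u' x) \<le> ?N n \<and> nrm (\<lambda>x. ?g n x - u3 x) \<le> ?N n" for n
  proof -
    let ?f = "\<lambda>x. w n x - u x"
    let ?f' = "\<lambda>x. ?W n x + (-1) * u' x"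
    obtain K where K: "sob 1 0 K (?W n)" using sob_smooth[OF w(1,2)] by blast
    have ZZ: "sob 1 0 (K + \<bar>-1\<bar> * sobolev_norm 1 u) ?f'"
      by (intro sob_add K sob_cmult Zu)
    have ae: "AE x in nu. ?f x = ?f' x"
    proof -
      have "AE x in nu. x \<in> slab" by (rule AE_nu_cell) (simp add: cell_def)
      with u'(2) show ?thesis by eventually_elim simp
    qed
    have "?f \<in> L2"
    proof -
      have m: "w n \<in> borel_measurable (lebesgue_on cell)" "u \<in> borel_measurable (lebesgue_on cell)"
        using borel_lebesgue_on_cell[OF smooth_borel[OF w(1)]] uL by (auto simp: L2_def)
      have "periodic_on slab ?f" using w(2)[of n] uL by (simp add: periodic_on_def L2_def)
      moreover have "integrable (lebesgue_on cell) (\<lambda>x. (?f x)\<^sup>2)"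
      proof (subst integral_cell_AE(2))
        show "(\<lambda>x. (?f x)\<^sup>2) \<in> borel_measurable (lebesgue_on cell)" using m by simp
        show "(\<lambda>x. (?f' x)\<^sup>2) \<in> borel_measurable borel" using slabL2_borel[OF sob_good[OF ZZ]] by simp
        show "AE x in nu. (?f x)\<^sup>2 = (?f' x)\<^sup>2" using ae by eventually_elim simp
        show "integrable nu (\<lambda>x. (?f' x)\<^sup>2)" using slabL2_sq[OF sob_good[OF ZZ]] by (simp add: sqint_def)
      qed
      ultimately show ?thesis using m by (simp add: L2_def)
    qed
    from sob_imp_sobolev(1)[OF this ae ZZ] have "?f \<in> sobolev 1" .
    from sobolev_imp_sob[OF this sob_good[OF ZZ] ae] have Zf: "sob 1 0 (?N n) ?f'" .
    obtain v where v: "wd 3 ?f' v" "sob 0 0 (?N n) v" using Zf by auto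
    have "wd 3 ?f' (\<lambda>x. ?g n x + (-1) * u3 x)"
      by (intro wd_add wd_cmult wg u3 gW gg slabL2_cmult u')
    moreover have gd: "slabL2 (\<lambda>x. ?g n x + (-1) * u3 x)" by (intro slabL2_add slabL2_cmult gg u3)
    ultimately have "AE x in nu. ?g n x + (-1) * u3 x = v x"
      using v(1) sob_good[OF v(2)] by (intro wd_unique[of 3 ?f'])
    then have "nrm (\<lambda>x. ?g n x + (-1) * u3 x) = nrm v"
      by (rule nrm_cong_AE[OF slabL2_borel[OF gd] slabL2_borel[OF sob_good[OF v(2)]]])
    then show ?thesis using sob_nrm[OF Zf] sob_nrm[OF v(2)] by simp
  qed
  \<comment> \<open>The defect of the claim. It does not depend on \<open>n\<close>, so bounds
    tending to 0 force it to vanish.\<close>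
  define R where "R x = u' x + (-1) * ((x$3 - c) * avg 0 c u3 x)" for x
  note ga = avg_slabL2[OF _ c]
  have x3b: "AE x in nu. \<bar>x$3 - c\<bar> \<le> 1" using c by (intro AE_nu_cell) (auto simp: cell_def slab_def)
  have sqR: "sqint R"
    unfolding R_def using x3b
    by (intro sqint_add sqint_cmult slabL2_sq[OF u'(1)] sqint_mult_bounded[OF slabL2_sq[OF ga(1)[OF u3(2)]], of _ 1]) auto
  have bd: "nrm R \<le> ?N n + bdry_norm (w n) + 2 * ?N n" for n
  proof -
    \<comment> \<open>By \<open>avg_smooth\<close> the defect is the sum of three errors:
      \<open>?A\<close> is controlled by the Sobolev distance, \<open>?B\<close> by the boundary
      norm, and \<open>?C\<close> by Hardy's inequality, whence the factor 2.\<close>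
    let ?A = "\<lambda>x. u' x - ?W n x" and ?B = "\<lambda>x. w n (contract c 0 x)" and ?C = "\<lambda>x. (x$3 - c) * avg 0 c (\<lambda>x. ?g n x - u3 x) x"
    have gd: "slabL2 (\<lambda>x. ?g n x - u3 x)" using slabL2_add[OF gg[of n] slabL2_cmult[OF u3(2), of "-1"]] by simp
    have sA: "sqint ?A" by (intro sqint_diff slabL2_sq u' gW)
    have sB: "sqint ?B" unfolding contract_eq by (intro smooth_sq smooth_diag_affine w)
    have sC: "sqint ?C" using x3b by (intro sqint_mult_bounded[OF slabL2_sq[OF ga(1)[OF gd]], of _ 1]) auto
    have "nrm R = nrm (\<lambda>x. (?A x + ?B x) + ?C x)"
    proof (rule nrm_cong_AE)
      have "AE x in nu. x \<in> slab" by (rule AE_nu_cell) (simp add: cell_def)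
      with avg_diff[OF gg[of n] u3(2) c, of 0]
      show "AE x in nu. R x = (?A x + ?B x) + ?C x"
      proof eventually_elim
        case (elim x)
        have "?C x = (w n x - w n (contract c 0 x)) - (x$3 - c) * avg 0 c u3 x"
          by (simp only: elim(1) right_diff_distrib avg_smooth[OF w(1) elim(2) c])
        then show ?case using elim(2) by (simp add: R_def)
      qed
      show "R \<in> borel_measurable borel" by (rule sqint_borel[OF sqR])
      show "(\<lambda>x. (?A x + ?B x) + ?C x) \<in> borel_measurable borel" by (intro sqint_borel sqint_add sA sB sC)
    qed
    also have "\<dots> \<le> nrm (\<lambda>x. ?A x + ?B x) + nrm ?C" by (intro nrm_triangle sqint_add sA sB sC)
    also have "\<dots> \<le> (nrm ?A + nrm ?B) + nrm ?C" using nrm_triangle[OF sA sB] by simp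
    also have "nrm ?A \<le> ?N n" using est[of n] nrm_minus_commute[of u' "?W n"] by simp
    also have "nrm ?B \<le> bdry_norm (w n)" by (intro nrm_contract_0_le_bdry w c)
    also have "nrm ?C \<le> 1 * nrm (avg 0 c (\<lambda>x. ?g n x - u3 x))"
      using x3b by (intro nrm_mult_bounded slabL2_sq[OF ga(1)[OF gd]]) auto
    also have "\<dots> \<le> 2 * ?N n" using ga(2)[OF gd, of 0] est[of n] by simp
    finally show ?thesis by simp
  qed
  have "(\<lambda>n. ?N n + bdry_norm (w n) + 2 * ?N n) \<longlonglongrightarrow> 0 + 0 + 2 * 0"
    by (intro tendsto_intros w)
  then have "nrm R \<le> 0 + 0 + 2 * 0" using bd by (intro LIMSEQ_le_const) auto
  then have "nrm R = 0" using nrm_nonneg[of R] by linarith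
  from nrm_eq_0[OF sqR this] show ?thesis by eventually_elim (simp add: R_def)
qed

section \<open>The embedding of second order Sobolev functions into bounded functions\<close>

text \<open>A cube of shift directions with side 1/4, pointing upwards for \<sigma> = 1 and
  downwards for \<sigma> = -1. Functions supported away from the face ahead can be shifted along all
  of them within the slab.\<close>

definition corner :: "real \<Rightarrow> (real^3) set" where
  "corner \<sigma> = {z. 0 < z$1 \<and> z$1 < 1 / 4 \<and> 0 < z$2 \<and> z$2 < 1 / 4 \<and> 0 < \<sigma> * z$3 \<and> \<sigma> * z$3 < 1 / 4}"

lemma sets_corner [measurable]: "corner \<sigma> \<in> sets borel"
  unfolding corner_def by measurable

lemma emeasure_corner:
  assumes "\<sigma> = 1 \<or> \<sigma> = -1" shows "emeasure lborel (corner \<sigma>) = ennreal (1 / 64)"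
proof -
  have box: "emeasure lborel (box (vector [0, 0, a]) (vector [1/4, 1/4, a + 1/4]) :: (real^3) set) = ennreal (1 / 64)" for a :: real
  proof (subst emeasure_lborel_box)
    fix b :: "real^3" assume "b \<in> Basis"
    then obtain i where "b = axis i 1" by (auto simp: Basis_vec_def)
    then show "vector [0, 0, a] \<bullet> b \<le> vector [1/4, 1/4, a + 1/4] \<bullet> b"
      using exhaust_3[of i] by (auto simp: inner_axis_nth)
  qed (simp add: prod_Basis_3 inner_axis_nth)
  show ?thesis
  proof (cases "\<sigma> = 1")
    case True
    then have "corner \<sigma> = box (vector [0, 0, 0]) (vector [1/4, 1/4, 0 + 1/4])"
      by (auto simp: corner_def mem_box_cart forall_3)
    then show ?thesis using box[of 0] by simp
  next
    case False
    then have "corner \<sigma> = box (vector [0, 0, -1/4]) (vector [1/4, 1/4, -1/4 + 1/4])"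
      using assms by (auto simp: corner_def mem_box_cart forall_3)
    then show ?thesis using box[of "-1/4"] by simp
  qed
qed

lemma ennreal_power2_le_imp_le:
  assumes "x\<^sup>2 \<le> ennreal (r\<^sup>2)" "0 \<le> r" shows "x \<le> ennreal r"
proof (cases x)
  case (real s)
  then have "s\<^sup>2 \<le> r\<^sup>2" using assms by (simp add: ennreal_power ennreal_le_iff)
  then have "s \<le> r" using assms(2) by (rule power2_le_imp_le)
  then show ?thesis using real by (simp add: ennreal_leI)
next
  case top
  then show ?thesis using assms(1) by (simp add: top_unique power2_eq_square ennreal_mult_eq_top_iff)
qed

text \<open>Cauchy--Schwarz on a cube of volume 1/64 gives the 1/8. Dilation by \<open>t\<close> has
  Jacobian \<open>t ^ 3\<close>, hence the power -3/2 after the root, and the dilated cube stays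
  within one period. Multiplied by the weight \<open>t\<close> of Taylor's formula this power is
  integrable at 0, which is why two derivatives suffice in three variables.\<close>

lemma corner_average:
  assumes h: "slabL2 h" and s: "\<sigma> = 1 \<or> \<sigma> = -1" and x: "x \<in> cell" and t: "0 < t" "t \<le> 1"
  shows "(\<integral>\<^sup>+z. indicator (corner \<sigma>) z * ennreal \<bar>h (x + t *\<^sub>R z)\<bar> \<partial>lborel) \<le> ennreal (nrm h / 8 * t powr (- 3 / 2))"
proof (rule ennreal_power2_le_imp_le)
  note [measurable] = slabL2_borel[OF h]
  let ?Q = "indicator (corner \<sigma>) :: real^3 \<Rightarrow> ennreal"
  let ?F = "\<lambda>y. ennreal ((h y)\<^sup>2)"
  have "(\<integral>\<^sup>+z. ?Q z * ennreal \<bar>h (x + t *\<^sub>R z)\<bar> \<partial>lborel)\<^sup>2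
      = (\<integral>\<^sup>+z. ?Q z * (?Q z * ennreal \<bar>h (x + t *\<^sub>R z)\<bar>) \<partial>lborel)\<^sup>2"
    by (intro arg_cong[where f = "\<lambda>x. x\<^sup>2"] nn_integral_cong) (auto simp: indicator_def)
  also have "\<dots> \<le> (\<integral>\<^sup>+z. (?Q z)\<^sup>2 \<partial>lborel) * (\<integral>\<^sup>+z. (?Q z * ennreal \<bar>h (x + t *\<^sub>R z)\<bar>)\<^sup>2 \<partial>lborel)"
    by (rule Cauchy_Schwarz_nn_integral) measurable
  also have "(\<integral>\<^sup>+z. (?Q z)\<^sup>2 \<partial>lborel) = ennreal (1 / 64)"
  proof -
    have "(?Q z)\<^sup>2 = ?Q z" for z by (simp add: indicator_def)
    then show ?thesis by (simp add: emeasure_corner[OF s])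
  qed
  also have "(\<integral>\<^sup>+z. (?Q z * ennreal \<bar>h (x + t *\<^sub>R z)\<bar>)\<^sup>2 \<partial>lborel)
      \<le> (\<integral>\<^sup>+z. indicator tube (diag_affine 0 (\<chi> i. t) z) * ?F (diag_affine 0 (\<chi> i. t) z + x) \<partial>lborel)"
  proof (rule nn_integral_mono)
    fix z
    have da: "diag_affine 0 (\<chi> i. t) z = t *\<^sub>R z" by (simp add: vec_eq_iff)
    have "t *\<^sub>R z \<in> tube" if "z \<in> corner \<sigma>"
    proof -
      have z: "0 < z$1" "z$1 < 1" "0 < z$2" "z$2 < 1" using that by (auto simp: corner_def)
      have "t * z$1 \<le> z$1" "t * z$2 \<le> z$2" using z t by (intro mult_left_le_one_le; simp)+
      then have "t * z$1 < 1" "t * z$2 < 1" using z by linarith+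
      then show ?thesis using z t by (simp add: tube_def)
    qed
    then show "(?Q z * ennreal \<bar>h (x + t *\<^sub>R z)\<bar>)\<^sup>2 \<le> indicator tube (diag_affine 0 (\<chi> i. t) z) * ?F (diag_affine 0 (\<chi> i. t) z + x)"
      unfolding da by (auto simp: indicator_def ennreal_power add.commute)
  qed
  \<comment> \<open>The Jacobian is inserted together with its inverse, to match the factor in the
    change of variables.\<close>
  also have "\<dots> = ennreal (1 / t ^ 3) * (ennreal (t ^ 3) * (\<integral>\<^sup>+z. indicator tube (diag_affine 0 (\<chi> i. t) z) * ?F (diag_affine 0 (\<chi> i. t) z + x) \<partial>lborel))"
    using t by (simp add: mult.assoc[symmetric] ennreal_mult[symmetric])
  also have "ennreal (t ^ 3) * (\<integral>\<^sup>+z. indicator tube (diag_affine 0 (\<chi> i. t) z) * ?F (diag_affine 0 (\<chi> i. t) z + x) \<partial>lborel)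
      = (\<integral>\<^sup>+y. indicator tube y * ?F (y + x) \<partial>lborel)"
    using t by (subst nn_integral_diag_affine[of "\<lambda>y. indicator tube y * ?F (y + x)" "\<chi> i. t" 0])
      (auto simp: power3_eq_cube abs_mult)
  also have "(\<integral>\<^sup>+y. indicator tube y * ?F (y + x) \<partial>lborel) = (\<integral>\<^sup>+y. indicator tube y * ?F y \<partial>lborel)"
    using x slabL2_per[OF h] by (intro nn_integral_tube_shift) (auto simp: per_def periodic_on_def cell_def)
  also have "\<dots> = ennreal ((nrm h)\<^sup>2)"
    unfolding ennreal_nrm_sq[OF slabL2_sq[OF h]] by (rule nn_integral_nu_tube[symmetric]) (auto simp: slabL2_outside[OF h])
  also have "ennreal (1 / 64) * (ennreal (1 / t ^ 3) * ennreal ((nrm h)\<^sup>2)) = ennreal ((nrm h / 8 * t powr (- 3 / 2))\<^sup>2)"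
  proof -
    have "(t powr (- 3 / 2))\<^sup>2 = t powr (- 3)" using t by (simp add: powr_power)
    also have "\<dots> = 1 / t ^ 3" using t by (simp add: powr_minus_divide powr_numeral)
    finally show ?thesis using t
      by (simp add: ennreal_mult[symmetric] power_mult_distrib power_divide)
  qed
  finally show "(\<integral>\<^sup>+z. ?Q z * ennreal \<bar>h (x + t *\<^sub>R z)\<bar> \<partial>lborel)\<^sup>2 \<le> ennreal ((nrm h / 8 * t powr (- 3 / 2))\<^sup>2)"
    by (simp add: mult_left_mono)
qed (use t in simp)

text \<open>Differentiating in the shift puts the derivative on \<open>k\<close>; as the shifted
  \<open>k\<close> is a test function, the derivative moves on to \<open>f\<close> and becomes
  \<open>v i\<close>. The two signs cancel.\<close>

lemma shift_wd_derivative: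
  assumes f: "slabL2 f" "\<And>i. slabL2 (v i)" "\<And>i. wd i f (v i)" and k: "smooth k" and tk: "test_function (\<lambda>x. k (x - t *\<^sub>R z))"
  shows "((\<lambda>t. \<integral>x. f x * k (x - t *\<^sub>R z) \<partial>nu) has_real_derivative
    (\<Sum>i\<in>UNIV. z$i * (\<integral>x. v i x * k (x - t *\<^sub>R z) \<partial>nu))) (at t)"
proof -
  have int: "integrable nu (\<lambda>x. f x * partial_deriv i k (x - t *\<^sub>R z))" for i
    by (intro sqint_mult_integrable slabL2_sq f smooth_sq smooth_shift smooth_partial_deriv k)
  have "(\<integral>x. f x * (\<Sum>i\<in>UNIV. z$i * partial_deriv i k (x - t *\<^sub>R z)) \<partial>nu)
      = (\<integral>x. (\<Sum>i\<in>UNIV. z$i * (f x * partial_deriv i k (x - t *\<^sub>R z))) \<partial>nu)"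
    by (intro Bochner_Integration.integral_cong) (auto simp: sum_distrib_left mult_ac)
  also have "\<dots> = (\<Sum>i\<in>UNIV. z$i * (\<integral>x. f x * partial_deriv i k (x - t *\<^sub>R z) \<partial>nu))"
    using int by (subst Bochner_Integration.integral_sum) auto
  also have "\<dots> = (\<Sum>i\<in>UNIV. z$i * - (\<integral>x. v i x * k (x - t *\<^sub>R z) \<partial>nu))"
  proof (intro sum.cong refl arg_cong2[where f = "(*)"])
    fix i
    have "(\<integral>x. f x * partial_deriv i (\<lambda>x. k (x - t *\<^sub>R z)) x \<partial>nu) = - (\<integral>x. v i x * k (x - t *\<^sub>R z) \<partial>nu)"
      using f(3)[of i] tk unfolding wd_def by blast
    then show "(\<integral>x. f x * partial_deriv i k (x - t *\<^sub>R z) \<partial>nu) = - (\<integral>x. v i x * k (x - t *\<^sub>R z) \<partial>nu)"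
      unfolding partial_deriv_shift[OF k] .
  qed
  finally have "- (\<integral>x. f x * (\<Sum>i\<in>UNIV. z$i * partial_deriv i k (x - t *\<^sub>R z)) \<partial>nu)
      = (\<Sum>i\<in>UNIV. z$i * (\<integral>x. v i x * k (x - t *\<^sub>R z) \<partial>nu))"
    by (simp add: sum_negf)
  with integral_shift_derivative[OF slabL2_sq[OF f(1)] k, of z t] show ?thesis by simp
qed

locale two_derivs =
  fixes f :: "real^3 \<Rightarrow> real" and f1 :: "3 \<Rightarrow> real^3 \<Rightarrow> real" and f2 :: "3 \<Rightarrow> 3 \<Rightarrow> real^3 \<Rightarrow> real"
  assumes f: "slabL2 f" and f1: "\<And>i. slabL2 (f1 i)" "\<And>i. wd i f (f1 i)"
    and f2: "\<And>i j. slabL2 (f2 i j)" "\<And>i j. wd j (f1 i) (f2 i j)"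
begin

text \<open>One pointwise majorant for \<open>f\<close> and its derivatives up to order two, so that
  all terms of Taylor's formula are estimated in the same way.\<close>

definition h :: "real^3 \<Rightarrow> real" where
  "h x = \<bar>f x\<bar> + (\<Sum>i\<in>UNIV. \<bar>f1 i x\<bar>) + (\<Sum>i\<in>UNIV. \<Sum>j\<in>UNIV. \<bar>f2 i j x\<bar>)"

lemma slabL2_h: "slabL2 h"
  unfolding h_def sum_3 by (intro slabL2_add slabL2_abs f f1 f2)

lemma h_nonneg: "0 \<le> h x"
  unfolding h_def by (intro add_nonneg_nonneg sum_nonneg) auto

text \<open>The 13 counts the summands of \<open>h\<close>: 1 + 3 + 9.\<close>

lemma nrm_h:
  assumes "nrm f \<le> M" "\<And>i. nrm (f1 i) \<le> M" "\<And>i j. nrm (f2 i j) \<le> M" shows "nrm h \<le> 13 * M"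
proof -
  have ab: "nrm (\<lambda>x. \<bar>g x\<bar>) = nrm g" for g by (simp add: nrm_def)
  have tri: "sqint (\<lambda>x. p x + q x) \<and> nrm (\<lambda>x. p x + q x) \<le> a + b" if "sqint p \<and> nrm p \<le> a" "sqint q \<and> nrm q \<le> b" for p q a b
    using that nrm_triangle[of p q] sqint_add[of p q] by auto
  have b0: "sqint (\<lambda>x. \<bar>f x\<bar>) \<and> nrm (\<lambda>x. \<bar>f x\<bar>) \<le> M"
    and b1: "sqint (\<lambda>x. \<bar>f1 i x\<bar>) \<and> nrm (\<lambda>x. \<bar>f1 i x\<bar>) \<le> M"
    and b2: "sqint (\<lambda>x. \<bar>f2 i j x\<bar>) \<and> nrm (\<lambda>x. \<bar>f2 i j x\<bar>) \<le> M" for i j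
    using assms by (auto simp: ab intro: sqint_abs slabL2_sq f f1 f2)
  have "sqint h \<and> nrm h \<le> M + (M + M + M) + ((M + M + M) + (M + M + M) + (M + M + M))"
    unfolding h_def[abs_def] sum_3 by (intro tri b0 b1 b2)
  then show ?thesis by simp
qed

text \<open>
  From \<open>G 0 = G 1 - G' 1 + \<integral> t G'' t dt\<close> for \<open>G t = \<integral> f(x) \<phi>(x - t z) dx\<close>: all derivatives fall on \<open>\<phi>\<close>, so
  \<open>f\<close> needs no smoothing.
\<close>

lemma taylor_bound:
  assumes s: "(\<sigma> = (1::real) \<and> a = 0 \<and> b = 3/4) \<or> (\<sigma> = -1 \<and> a = 1/4 \<and> b = 1)"
    and \<phi>: "test_on a b \<phi>" and z: "z \<in> corner \<sigma>"
  shows "ennreal \<bar>\<integral>x. f x * \<phi> x \<partial>nu\<bar> \<le> (\<integral>\<^sup>+x. ennreal (h (x + 1 *\<^sub>R z) * \<bar>\<phi> x\<bar>) \<partial>nu)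
    + (\<integral>\<^sup>+t. ennreal (indicator {0<..<1} t * t) * (\<integral>\<^sup>+x. ennreal (h (x + t *\<^sub>R z) * \<bar>\<phi> x\<bar>) \<partial>nu) \<partial>lborel)"
proof -
  note [measurable] = slabL2_borel[OF slabL2_h] test_on_borel[OF \<phi>]
  have sm: "smooth \<phi>" using \<phi> by (simp add: test_on_def)
  have zb: "\<bar>z$i\<bar> \<le> 1" for i using z s exhaust_3[of i] by (auto simp: corner_def)
  have out: "\<phi> x = 0" if "x \<notin> slab" for x
  proof (rule test_on_outside[OF \<phi>])
    show "x \<notin> strip a b" using that strip_subset_slab[of a b] s by auto
  qed
  \<comment> \<open>The support of \<phi> leaves a quarter of the slab free on the side to which
    \<open>z\<close> points, and the vertical component of \<open>z\<close> is below 1/4, so none of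
    the shifts pushes the support beyond a face.\<close>
  have tt: "test_function (\<lambda>x. \<phi> (x - t *\<^sub>R z))" if "0 \<le> t" "t \<le> 1" for t
    unfolding test_function_iff
  proof (rule test_on_shift[OF \<phi>])
    have "t * \<bar>z$3\<bar> \<le> \<bar>z$3\<bar>" using that by (intro mult_left_le_one_le) auto
    then have le: "\<bar>t * z$3\<bar> \<le> \<bar>z$3\<bar>" using that by (simp add: abs_mult)
    have "0 \<le> \<sigma> * z$3" using z by (simp add: corner_def less_imp_le)
    from mult_nonneg_nonneg[OF that(1) this] have sg: "0 \<le> t * (\<sigma> * z$3)" .
    show "0 \<le> a + (t *\<^sub>R z) $ 3" "b + (t *\<^sub>R z) $ 3 \<le> 1"
    proof -
      have z3: "\<bar>z$3\<bar> < 1 / 4" using z s by (auto simp: corner_def)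
      have tz: "t * z$3 \<le> 1 / 4" "- (1 / 4) \<le> t * z$3" using le z3 by linarith+
      from s show "0 \<le> a + (t *\<^sub>R z) $ 3" using tz sg by auto
      from s show "b + (t *\<^sub>R z) $ 3 \<le> 1" using tz sg by auto
    qed
  qed
  let ?I = "\<lambda>g t. \<integral>x. g x * \<phi> (x - t *\<^sub>R z) \<partial>nu"
  define B where "B t = (\<integral>\<^sup>+x. ennreal (h (x + t *\<^sub>R z) * \<bar>\<phi> x\<bar>) \<partial>nu)" for t
  have tz: "0 \<le> (t *\<^sub>R z)$1" "(t *\<^sub>R z)$1 \<le> 1" "0 \<le> (t *\<^sub>R z)$2" "(t *\<^sub>R z)$2 \<le> 1" if "0 \<le> t" "t \<le> 1" for t
  proof -
    have "t * z$1 \<le> z$1" "t * z$2 \<le> z$2" using that z by (intro mult_left_le_one_le; simp add: corner_def)+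
    moreover have zz: "0 < z$1" "z$1 < 1" "0 < z$2" "z$2 < 1" using z by (auto simp: corner_def)
    ultimately have "t * z$1 \<le> 1" "t * z$2 \<le> 1" by linarith+
    then show "0 \<le> (t *\<^sub>R z)$1" "(t *\<^sub>R z)$1 \<le> 1" "0 \<le> (t *\<^sub>R z)$2" "(t *\<^sub>R z)$2 \<le> 1"
      using that zz by simp_all
  qed
  have B_eq: "B t = (\<integral>\<^sup>+x. ennreal (h x * \<bar>\<phi> (x - t *\<^sub>R z)\<bar>) \<partial>nu)" if "0 \<le> t" "t \<le> 1" for t
  proof -
    have "(\<integral>\<^sup>+x. ennreal (h (x + t *\<^sub>R z) * \<bar>\<phi> (x + t *\<^sub>R z - t *\<^sub>R z)\<bar>) \<partial>nu) = (\<integral>\<^sup>+x. ennreal (h x * \<bar>\<phi> (x - t *\<^sub>R z)\<bar>) \<partial>nu)"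
    proof (rule nn_integral_nu_shift[where F = "\<lambda>x. ennreal (h x * \<bar>\<phi> (x - t *\<^sub>R z)\<bar>)"])
      have sw: "x + axis j 1 - t *\<^sub>R z = (x - t *\<^sub>R z) + axis j 1" for x j by simp
      show "per (\<lambda>x. ennreal (h x * \<bar>\<phi> (x - t *\<^sub>R z)\<bar>))"
        unfolding per_def sw using slabL2_per[OF slabL2_h] \<phi> by (simp add: periodic_on_def test_on_def)
    qed (use tz[OF that] out slabL2_outside[OF slabL2_h] in auto)
    then show ?thesis by (simp add: B_def)
  qed
  have IB: "ennreal \<bar>c\<bar> \<le> B t"
    if t: "0 \<le> t" "t \<le> 1" and g: "sqint g" "\<And>x. \<bar>g x\<bar> \<le> h x" and c: "c = ?I g t" for g t c
  proof -
    have sqint: "sqint (\<lambda>x. \<phi> (x - t *\<^sub>R z))" by (intro smooth_sq smooth_shift sm)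
    have "ennreal \<bar>c\<bar> \<le> (\<integral>\<^sup>+x. ennreal (norm (g x * \<phi> (x - t *\<^sub>R z))) \<partial>nu)"
      using integral_norm_bound_ennreal[OF sqint_mult_integrable[OF g(1) sqint]] by (simp add: c)
    also have "\<dots> \<le> B t"
      unfolding B_eq[OF t] using g(2)
      by (intro nn_integral_mono ennreal_leI) (simp add: abs_mult mult_right_mono)
    finally show ?thesis .
  qed
  let ?G = "?I f" and ?G1 = "\<lambda>t. \<Sum>i\<in>UNIV. z$i * ?I (f1 i) t"
    and ?G2 = "\<lambda>t. \<Sum>i\<in>UNIV. z$i * (\<Sum>j\<in>UNIV. z$j * ?I (f2 i j) t)"
  have dG: "(?G has_real_derivative ?G1 t) (at t)" if "0 \<le> t" "t \<le> 1" for t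
    by (rule shift_wd_derivative[OF f f1 sm tt[OF that]])
  have dI1: "(?I (f1 i) has_real_derivative (\<Sum>j\<in>UNIV. z$j * ?I (f2 i j) t)) (at t)" if "0 \<le> t" "t \<le> 1" for i t
    by (rule shift_wd_derivative[OF f1(1) f2 sm tt[OF that]])
  have dG1: "(?G1 has_real_derivative ?G2 t) (at t)" if "0 \<le> t" "t \<le> 1" for t
    by (intro DERIV_sum DERIV_cmult dI1 that)
  have cI: "isCont (?I g) t" if "sqint g" for g t
    using DERIV_isCont[OF integral_shift_derivative[OF that sm, of z t]] .
  have pull: "(\<Sum>i\<in>UNIV. z$i * ?I (g i) t) = ?I (\<lambda>x. \<Sum>i\<in>UNIV. z$i * g i x) t"
    if "\<And>i. sqint (g i)" for g :: "3 \<Rightarrow> real^3 \<Rightarrow> real" and t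
  proof -
    have "integrable nu (\<lambda>x. g i x * \<phi> (x - t *\<^sub>R z))" for i
      by (intro sqint_mult_integrable that smooth_sq smooth_shift sm)
    then have "(\<Sum>i\<in>UNIV. z$i * ?I (g i) t) = (\<integral>x. (\<Sum>i\<in>UNIV. z$i * (g i x * \<phi> (x - t *\<^sub>R z))) \<partial>nu)"
      by (subst Bochner_Integration.integral_sum) auto
    also have "\<dots> = ?I (\<lambda>x. \<Sum>i\<in>UNIV. z$i * g i x) t"
      by (intro Bochner_Integration.integral_cong) (simp_all add: sum_distrib_right mult.assoc)
    finally show ?thesis .
  qed
  let ?g1 = "\<lambda>x. \<Sum>i\<in>UNIV. z$i * f1 i x" and ?g2 = "\<lambda>x. \<Sum>i\<in>UNIV. z$i * (\<Sum>j\<in>UNIV. z$j * f2 i j x)"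
  have sq1: "sqint ?g1" and sq2i: "sqint (\<lambda>x. \<Sum>j\<in>UNIV. z$j * f2 i j x)" and sq2: "sqint ?g2" for i
    unfolding sum_3 by (intro sqint_add sqint_cmult slabL2_sq f1 f2)+
  have G1e: "?G1 t = ?I ?g1 t" for t by (intro pull slabL2_sq f1)
  have G2e: "?G2 t = ?I ?g2 t" for t
  proof -
    have "?G2 t = (\<Sum>i\<in>UNIV. z$i * ?I (\<lambda>x. \<Sum>j\<in>UNIV. z$j * f2 i j x) t)"
      by (intro sum.cong refl arg_cong2[where f = "(*)"] pull slabL2_sq f2)
    also have "\<dots> = ?I ?g2 t" by (intro pull sq2i)
    finally show ?thesis .
  qed
  \<comment> \<open>The coordinates of \<open>z\<close> are at most 1 in modulus, so derivatives in
    direction \<open>z\<close> are dominated by the plain sums of partial derivatives in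
    \<open>h\<close>.\<close>
  have zle: "\<bar>\<Sum>i\<in>UNIV. z$i * y i\<bar> \<le> (\<Sum>i\<in>UNIV. \<bar>y i\<bar>)" for y :: "3 \<Rightarrow> real"
    by (rule order_trans[OF sum_abs sum_mono]) (simp add: abs_mult mult_left_le_one_le zb)
  have g1h: "\<bar>f x + (-1) * ?g1 x\<bar> \<le> h x" for x
  proof -
    have "0 \<le> (\<Sum>i\<in>UNIV. \<Sum>j\<in>UNIV. \<bar>f2 i j x\<bar>)" by (intro sum_nonneg) simp
    then show ?thesis
      using zle[of "\<lambda>i. f1 i x"] abs_triangle_ineq4[of "f x" "?g1 x"] unfolding h_def by simp
  qed
  have g2h: "\<bar>?g2 x\<bar> \<le> h x" for x
  proof -
    have "\<bar>?g2 x\<bar> \<le> (\<Sum>i\<in>UNIV. \<bar>\<Sum>j\<in>UNIV. z$j * f2 i j x\<bar>)" by (rule zle)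
    also have "\<dots> \<le> (\<Sum>i\<in>UNIV. \<Sum>j\<in>UNIV. \<bar>f2 i j x\<bar>)" by (intro sum_mono zle)
    also have "\<dots> \<le> h x" unfolding h_def by (simp add: sum_nonneg)
    finally show ?thesis .
  qed
  \<comment> \<open>The derivative of \<open>G t - t * G' t\<close> is \<open>- t * G'' t\<close>:
    this expansion around \<open>t = 1\<close> is chosen because the remainder then has the weight
    \<open>t\<close> at the singular end 0.\<close>
  have ftc: "(\<integral>t. (- (t * ?G2 t)) * indicator {0..1} t \<partial>lborel) = (?G 1 - 1 * ?G1 1) - (?G 0 - 0 * ?G1 0)"
  proof (rule integral_FTC_Icc_real[where F = "\<lambda>t. ?G t - t * ?G1 t"])
    fix t :: real assume t: "0 \<le> t" "t \<le> 1"
    have "((\<lambda>t. ?G t - t * ?G1 t) has_real_derivative ?G1 t - (1 * ?G1 t + ?G2 t * t)) (at t)"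
      by (intro DERIV_diff DERIV_mult DERIV_ident dG dG1 t)
    then show "((\<lambda>t. ?G t - t * ?G1 t) has_real_derivative - (t * ?G2 t)) (at t)"
      by (simp only: mult_1 diff_add_eq_diff_diff_swap diff_self) (simp add: mult.commute)
    have "isCont ?G2 t" unfolding G2e by (rule cI[OF sq2])
    from isCont_minus[OF isCont_mult[OF continuous_ident this]]
    show "isCont (\<lambda>t. - (t * ?G2 t)) t" .
  qed simp
  let ?J = "\<integral>t. (- (t * ?G2 t)) * indicator {0..1} t \<partial>lborel"
  have eq: "?G 0 = (?G 1 - ?G1 1) - ?J" using ftc by simp
  have c2: "continuous_on UNIV ?G2"
    unfolding G2e using cI[OF sq2] by (simp add: continuous_on_eq_continuous_at)
  have [measurable]: "?G2 \<in> borel_measurable borel" by (intro borel_measurable_continuous_onI c2)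
  have J: "ennreal \<bar>?J\<bar> \<le> (\<integral>\<^sup>+t. ennreal (indicator {0<..<1} t * t) * B t \<partial>lborel)"
  proof -
    have int: "integrable lborel (\<lambda>t. (- (t * ?G2 t)) * indicator {0..1} t)"
    proof -
      have "set_integrable lborel {0..1} (\<lambda>t. - (t * ?G2 t))"
        by (intro borel_integrable_atLeastAtMost' continuous_on_minus continuous_on_mult continuous_on_id
            continuous_on_subset[OF c2] subset_UNIV)
      then show ?thesis by (simp add: set_integrable_def mult.commute)
    qed
    have "ennreal \<bar>?J\<bar> \<le> (\<integral>\<^sup>+t. ennreal (norm ((- (t * ?G2 t)) * indicator {0..1} t)) \<partial>lborel)"
      using integral_norm_bound_ennreal[OF int] by simp
    also have "\<dots> \<le> (\<integral>\<^sup>+t. ennreal (indicator {0<..<1} t * t) * B t \<partial>lborel)"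
    proof (rule nn_integral_mono_AE)
      show "AE t in lborel. ennreal (norm ((- (t * ?G2 t)) * indicator {0..1} t)) \<le> ennreal (indicator {0<..<1} t * t) * B t"
        using AE_lborel_singleton[of "0::real"] AE_lborel_singleton[of "1::real"]
      proof eventually_elim
        case (elim t)
        show ?case
        proof (cases "t \<in> {0<..<1}")
          case True
          then have "ennreal (norm ((- (t * ?G2 t)) * indicator {0..1} t)) = ennreal t * ennreal \<bar>?G2 t\<bar>"
            by (simp add: abs_mult ennreal_mult)
          also have "\<dots> \<le> ennreal t * B t"
            using True by (intro mult_left_mono IB[OF _ _ sq2 g2h G2e]) auto
          finally show ?thesis using True by simp
        next
          case False
          then show ?thesis using elim by (auto simp: indicator_def)
        qed
      qed
    qed
    finally show ?thesis .
  qed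
  have G01: "ennreal \<bar>?G 1 - ?G1 1\<bar> \<le> B 1"
  proof (rule IB[OF _ _ _ g1h])
    show "sqint (\<lambda>x. f x + (-1) * ?g1 x)" by (intro sqint_add sqint_cmult sq1 slabL2_sq f)
    have i: "integrable nu (\<lambda>x. f x * \<phi> (x - 1 *\<^sub>R z))" "integrable nu (\<lambda>x. ?g1 x * \<phi> (x - 1 *\<^sub>R z))"
      by (intro sqint_mult_integrable sq1 slabL2_sq f smooth_sq smooth_shift sm)+
    show "?G 1 - ?G1 1 = ?I (\<lambda>x. f x + (-1) * ?g1 x) 1"
      unfolding G1e Bochner_Integration.integral_diff[OF i, symmetric]
      by (intro Bochner_Integration.integral_cong) (auto simp: algebra_simps)
  qed auto
  have "ennreal \<bar>?G 0\<bar> \<le> ennreal (\<bar>?G 1 - ?G1 1\<bar> + \<bar>?J\<bar>)"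
    unfolding eq by (intro ennreal_leI abs_triangle_ineq4)
  also have "\<dots> = ennreal \<bar>?G 1 - ?G1 1\<bar> + ennreal \<bar>?J\<bar>" by (rule ennreal_plus) auto
  also have "\<dots> \<le> B 1 + (\<integral>\<^sup>+t. ennreal (indicator {0<..<1} t * t) * B t \<partial>lborel)"
    by (intro add_mono G01 J)
  finally show ?thesis by (simp add: B_def)
qed

text \<open>The Taylor bound is averaged over the corner, of volume 1/64. The scale \<open>t\<close>
  contributes \<open>t\<close> times the power -3/2, with integral 2, and the endpoint
  \<open>t = 1\<close> contributes 1, each times \<open>nrm h / 8\<close>; this gives 24 = 64 * 3 /
  8.\<close>

lemma dual_bound:
  assumes s: "(\<sigma> = (1::real) \<and> a = 0 \<and> b = 3/4) \<or> (\<sigma> = -1 \<and> a = 1/4 \<and> b = 1)"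
    and \<phi>: "test_on a b \<phi>"
  shows "\<bar>\<integral>x. f x * \<phi> x \<partial>nu\<bar> \<le> 24 * nrm h * (\<integral>x. \<bar>\<phi> x\<bar> \<partial>nu)"
proof -
  note [measurable] = slabL2_borel[OF slabL2_h] test_on_borel[OF \<phi>]
  have s': "\<sigma> = 1 \<or> \<sigma> = -1" using s by auto
  let ?Q = "indicator (corner \<sigma>) :: real^3 \<Rightarrow> ennreal"
  let ?X = "ennreal \<bar>\<integral>x. f x * \<phi> x \<partial>nu\<bar>"
  define B where "B t z = (\<integral>\<^sup>+x. ennreal (h (x + t *\<^sub>R z) * \<bar>\<phi> x\<bar>) \<partial>nu)" for t z
  define L where "L = (\<integral>x. \<bar>\<phi> x\<bar> \<partial>nu)"
  have L0: "0 \<le> L" unfolding L_def by (rule Bochner_Integration.integral_nonneg) simp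
  have L: "(\<integral>\<^sup>+x. ennreal \<bar>\<phi> x\<bar> \<partial>nu) = ennreal L"
    unfolding L_def using sqint_integrable[OF sqint_abs[OF test_on_sq[OF \<phi>]]] by (intro nn_integral_eq_integral) auto
  have [measurable]: "(\<lambda>(t, z). B t z) \<in> borel_measurable (borel \<Otimes>\<^sub>M borel)"
    unfolding B_def case_prod_beta' by measurable
  have avgB: "(\<integral>\<^sup>+z. ?Q z * B t z \<partial>lborel) \<le> ennreal (nrm h / 8 * t powr (- 3 / 2) * L)" if t: "0 < t" "t \<le> 1" for t
  proof -
    interpret P: pair_sigma_finite "lborel :: (real^3) measure" nu
      by (intro pair_sigma_finite.intro nu.sigma_finite_measure_axioms lborel.sigma_finite_measure_axioms)
    have "(\<integral>\<^sup>+z. ?Q z * B t z \<partial>lborel) = (\<integral>\<^sup>+z. (\<integral>\<^sup>+x. ?Q z * ennreal (h (x + t *\<^sub>R z) * \<bar>\<phi> x\<bar>) \<partial>nu) \<partial>lborel)"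
      unfolding B_def by (intro nn_integral_cong nn_integral_cmult[symmetric]) measurable
    also have "\<dots> = (\<integral>\<^sup>+x. (\<integral>\<^sup>+z. ?Q z * ennreal (h (x + t *\<^sub>R z) * \<bar>\<phi> x\<bar>) \<partial>lborel) \<partial>nu)"
      using P.Fubini[of "\<lambda>p. ?Q (fst p) * ennreal (h (snd p + t *\<^sub>R fst p) * \<bar>\<phi> (snd p)\<bar>)"] by simp
    also have "\<dots> \<le> (\<integral>\<^sup>+x. ennreal (nrm h / 8 * t powr (- 3 / 2)) * ennreal \<bar>\<phi> x\<bar> \<partial>nu)"
    proof (intro nn_integral_mono_AE AE_nu_cell)
      fix x :: "real^3" assume x: "x \<in> cell"
      have "(\<integral>\<^sup>+z. ?Q z * ennreal (h (x + t *\<^sub>R z) * \<bar>\<phi> x\<bar>) \<partial>lborel)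
          = (\<integral>\<^sup>+z. (?Q z * ennreal \<bar>h (x + t *\<^sub>R z)\<bar>) * ennreal \<bar>\<phi> x\<bar> \<partial>lborel)"
        using h_nonneg by (intro nn_integral_cong) (simp add: ennreal_mult mult.assoc)
      also have "\<dots> = (\<integral>\<^sup>+z. ?Q z * ennreal \<bar>h (x + t *\<^sub>R z)\<bar> \<partial>lborel) * ennreal \<bar>\<phi> x\<bar>"
        by (rule nn_integral_multc) measurable
      also have "\<dots> \<le> ennreal (nrm h / 8 * t powr (- 3 / 2)) * ennreal \<bar>\<phi> x\<bar>"
        by (intro mult_right_mono corner_average slabL2_h s' x t) simp
      finally show "(\<integral>\<^sup>+z. ?Q z * ennreal (h (x + t *\<^sub>R z) * \<bar>\<phi> x\<bar>) \<partial>lborel) \<le> ennreal (nrm h / 8 * t powr (- 3 / 2)) * ennreal \<bar>\<phi> x\<bar>" .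
    qed
    also have "\<dots> = ennreal (nrm h / 8 * t powr (- 3 / 2)) * (\<integral>\<^sup>+x. ennreal \<bar>\<phi> x\<bar> \<partial>nu)"
      by (rule nn_integral_cmult) measurable
    also have "\<dots> = ennreal (nrm h / 8 * t powr (- 3 / 2) * L)"
      unfolding L using L0 by (intro ennreal_mult[symmetric]) auto
    finally show ?thesis .
  qed
  let ?k = "\<lambda>t::real. ennreal (indicator {0<..<1} t * t)"
  have "ennreal (1 / 64) * ?X = (\<integral>\<^sup>+z. ?Q z * ?X \<partial>lborel)"
    by (subst nn_integral_multc) (auto simp: emeasure_corner[OF s'])
  also have "\<dots> \<le> (\<integral>\<^sup>+z. ?Q z * B 1 z + (\<integral>\<^sup>+t. ?k t * (?Q z * B t z) \<partial>lborel) \<partial>lborel)"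
  proof (rule nn_integral_mono)
    fix z
    show "?Q z * ?X \<le> ?Q z * B 1 z + (\<integral>\<^sup>+t. ?k t * (?Q z * B t z) \<partial>lborel)"
    proof (cases "z \<in> corner \<sigma>")
      case True
      then show ?thesis using taylor_bound[OF s \<phi> True] by (simp add: B_def)
    qed simp
  qed
  also have "\<dots> = (\<integral>\<^sup>+z. ?Q z * B 1 z \<partial>lborel) + (\<integral>\<^sup>+z. (\<integral>\<^sup>+t. ?k t * (?Q z * B t z) \<partial>lborel) \<partial>lborel)"
    by (rule nn_integral_add) measurable
  also have "(\<integral>\<^sup>+z. (\<integral>\<^sup>+t. ?k t * (?Q z * B t z) \<partial>lborel) \<partial>lborel) = (\<integral>\<^sup>+t. (\<integral>\<^sup>+z. ?k t * (?Q z * B t z) \<partial>lborel) \<partial>lborel)"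
    using lborel_pair.Fubini'[of "\<lambda>z t. ?k t * (?Q z * B t z)"] by simp
  also have "(\<integral>\<^sup>+z. ?Q z * B 1 z \<partial>lborel) + (\<integral>\<^sup>+t. (\<integral>\<^sup>+z. ?k t * (?Q z * B t z) \<partial>lborel) \<partial>lborel)
      \<le> ennreal (nrm h / 8 * L) + ennreal (nrm h / 8 * L) * 2"
  proof (rule add_mono)
    show "(\<integral>\<^sup>+z. ?Q z * B 1 z \<partial>lborel) \<le> ennreal (nrm h / 8 * L)" using avgB[of 1] by simp
    have "(\<integral>\<^sup>+t. (\<integral>\<^sup>+z. ?k t * (?Q z * B t z) \<partial>lborel) \<partial>lborel)
        \<le> (\<integral>\<^sup>+t. ennreal (nrm h / 8 * L) * ennreal (indicator {0<..<1} t * t powr (- 1 / 2)) \<partial>lborel)"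
    proof (rule nn_integral_mono)
      fix t :: real
      show "(\<integral>\<^sup>+z. ?k t * (?Q z * B t z) \<partial>lborel) \<le> ennreal (nrm h / 8 * L) * ennreal (indicator {0<..<1} t * t powr (- 1 / 2))"
      proof (cases "t \<in> {0<..<1}")
        case True
        have "(\<integral>\<^sup>+z. ?k t * (?Q z * B t z) \<partial>lborel) = ?k t * (\<integral>\<^sup>+z. ?Q z * B t z \<partial>lborel)"
          by (rule nn_integral_cmult) measurable
        also have "\<dots> \<le> ?k t * ennreal (nrm h / 8 * t powr (- 3 / 2) * L)"
          using True by (intro mult_left_mono avgB) auto
        also have "\<dots> = ennreal (t * (nrm h / 8 * t powr (- 3 / 2) * L))"
          using True L0 by (subst ennreal_mult[symmetric]) auto
        also have "t * (nrm h / 8 * t powr (- 3 / 2) * L) = (nrm h / 8 * L) * (t powr 1 * t powr (- 3 / 2))"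
          using True by simp
        also have "t powr 1 * t powr (- 3 / 2) = t powr (1 + (- 3 / 2))" by (rule powr_add[symmetric])
        also have "1 + (- 3 / 2) = (- 1 / 2 :: real)" by simp
        also have "ennreal (nrm h / 8 * L * t powr (- 1 / 2)) = ennreal (nrm h / 8 * L) * ennreal (indicator {0<..<1} t * t powr (- 1 / 2))"
          using True L0 by (subst ennreal_mult[symmetric]) auto
        finally show ?thesis .
      qed simp
    qed
    also have "\<dots> = ennreal (nrm h / 8 * L) * (\<integral>\<^sup>+t. ennreal (indicator {0<..<1} t * t powr (- 1 / 2)) \<partial>lborel)"
      by (rule nn_integral_cmult) measurable
    also have "\<dots> = ennreal (nrm h / 8 * L) * 2" unfolding nn_integral_inverse_sqrt ..
    finally show "(\<integral>\<^sup>+t. (\<integral>\<^sup>+z. ?k t * (?Q z * B t z) \<partial>lborel) \<partial>lborel) \<le> ennreal (nrm h / 8 * L) * 2" .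
  qed
  also have "ennreal (nrm h / 8 * L) + ennreal (nrm h / 8 * L) * 2 = ennreal (3 * (nrm h / 8 * L))"
  proof -
    have n: "0 \<le> nrm h / 8 * L" using L0 by simp
    have "ennreal (nrm h / 8 * L) * 2 = ennreal (nrm h / 8 * L * 2)" using n by (simp only: ennreal_mult ennreal_numeral[symmetric] zero_le_numeral)
    then show ?thesis using n by (simp only: ennreal_plus[symmetric] mult_nonneg_nonneg zero_le_numeral) (simp add: algebra_simps)
  qed
  finally have "ennreal (1 / 64 * \<bar>\<integral>x. f x * \<phi> x \<partial>nu\<bar>) \<le> ennreal (3 * (nrm h / 8 * L))"
    by (subst ennreal_mult) auto
  then have "1 / 64 * \<bar>\<integral>x. f x * \<phi> x \<partial>nu\<bar> \<le> 3 * (nrm h / 8 * L)"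
    using L0 by (subst (asm) ennreal_le_iff) auto
  then show ?thesis by (simp add: L_def)
qed

text \<open>Upward shifts handle the lower three quarters of the slab and downward shifts the upper
  three quarters; together they cover it.\<close>

lemma sup_bound: "AE x in nu. \<bar>f x\<bar> \<le> 24 * nrm h"
proof -
  have "AE x in nu. x \<in> strip 0 (3/4) \<longrightarrow> \<bar>f x\<bar> \<le> 24 * nrm h"
    by (rule dual_Linf_bound[OF slabL2_sq[OF f]]) (use dual_bound[of 1 0 "3/4"] in auto)
  moreover have "AE x in nu. x \<in> strip (1/4) 1 \<longrightarrow> \<bar>f x\<bar> \<le> 24 * nrm h"
    by (rule dual_Linf_bound[OF slabL2_sq[OF f]]) (use dual_bound[of "-1" "1/4" 1] in auto)
  moreover have "AE x in nu. x \<in> strip 0 (3/4) \<or> x \<in> strip (1/4) 1"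
    by (rule AE_nu_cell) (auto simp: cell_def slab_def strip_def)
  ultimately show ?thesis by eventually_elim auto
qed

end

text \<open>The constant is 24 from \<open>sup_bound\<close> times 13 from
  \<open>nrm_h\<close>.\<close>

lemma sob_2_bounded:
  assumes "sob (Suc (Suc k)) m M f" shows "AE x in nu. \<bar>f x\<bar> \<le> 312 * M"
proof -
  have "\<exists>v. wd i f v \<and> sob (Suc k) (m - 1) M v" for i using assms by simp
  then obtain f1 where F1: "\<And>i. wd i f (f1 i)" "\<And>i. sob (Suc k) (m - 1) M (f1 i)" by metis
  have "\<forall>i j. \<exists>v. wd j (f1 i) v \<and> sob k (m - 1 - 1) M v" using F1(2) by simp
  then obtain f2 where F2: "\<And>i j. wd j (f1 i) (f2 i j)" "\<And>i j. sob k (m - 1 - 1) M (f2 i j)" by metis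
  interpret two_derivs f f1 f2
    by unfold_locales (use assms F1 F2 sob_good in blast)+
  have "nrm h \<le> 13 * M" by (intro nrm_h sob_nrm[OF assms] sob_nrm[OF F1(2)] sob_nrm[OF F2(2)])
  with sup_bound show ?thesis by (auto elim: eventually_mono)
qed

text \<open>A derivative of order below \<open>k - 1\<close> has two further derivatives in L2 and
  is bounded by \<open>sob_2_bounded\<close>; the induction applies this to each of them.\<close>

lemma sob_embedding:
  "sob k 0 M f \<Longrightarrow> sob k (k - 1) (312 * M) f"
proof (induction k arbitrary: f)
  case 0
  then show ?case using sob_nonneg[OF 0] by auto
next
  case (Suc k)
  have M: "0 \<le> M" by (rule sob_nonneg[OF Suc.prems])
  have "\<exists>v. wd i f v \<and> sob k (k - 1) (312 * M) v" for i
  proof -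
    obtain v where "wd i f v" "sob k 0 M v" using Suc.prems by auto
    with Suc.IH show ?thesis by blast
  qed
  moreover have "AE x in nu. \<bar>f x\<bar> \<le> 312 * M" if "0 < k"
    using that Suc.prems by (cases k) (auto dest: sob_2_bounded simp del: sob.simps)
  ultimately show ?case using Suc.prems M by auto
qed

section \<open>Products, reciprocals and the quotient\<close>

lemma slabL2_mult_bounded:
  assumes f: "slabL2 f" "AE x in nu. \<bar>f x\<bar> \<le> K" "0 \<le> K" and g: "slabL2 g"
  shows "slabL2 (\<lambda>x. f x * g x)" "nrm (\<lambda>x. f x * g x) \<le> K * nrm g"
proof -
  have "sqint (\<lambda>x. f x * g x)" by (rule sqint_mult_bounded[OF slabL2_sq[OF g] slabL2_borel[OF f(1)] f(2)])
  then show "slabL2 (\<lambda>x. f x * g x)"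
    using slabL2_per[OF f(1)] slabL2_per[OF g] slabL2_outside[OF f(1)] by (simp add: slabL2_def periodic_on_def)
  show "nrm (\<lambda>x. f x * g x) \<le> K * nrm g"
    by (rule nrm_mult_bounded[OF slabL2_sq[OF g] slabL2_borel[OF f(1)] f(2,3)])
qed

lemma sob_mult_0:
  assumes f: "sob k m K f" and g: "sob l n L g" and mn: "0 < m + n"
  shows "slabL2 (\<lambda>x. f x * g x)" "nrm (\<lambda>x. f x * g x) \<le> K * L"
    "0 < min m n \<Longrightarrow> AE x in nu. \<bar>f x * g x\<bar> \<le> K * L"
proof -
  note K = sob_nonneg[OF f] and L = sob_nonneg[OF g]
  have "slabL2 (\<lambda>x. f x * g x) \<and> nrm (\<lambda>x. f x * g x) \<le> K * L"
  proof (cases "0 < m")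
    case True
    have "nrm (\<lambda>x. f x * g x) \<le> K * nrm g" "slabL2 (\<lambda>x. f x * g x)"
      using slabL2_mult_bounded[OF sob_good[OF f] sob_bounded[OF f True] K sob_good[OF g]] by auto
    moreover have "K * nrm g \<le> K * L" by (intro mult_left_mono sob_nrm[OF g] K)
    ultimately show ?thesis by simp
  next
    case False
    then have n: "0 < n" using mn by simp
    have "nrm (\<lambda>x. g x * f x) \<le> L * nrm f" "slabL2 (\<lambda>x. g x * f x)"
      using slabL2_mult_bounded[OF sob_good[OF g] sob_bounded[OF g n] L sob_good[OF f]] by auto
    moreover have "L * nrm f \<le> L * K" by (intro mult_left_mono sob_nrm[OF f] L)
    ultimately show ?thesis by (simp add: mult.commute)
  qed
  then show "slabL2 (\<lambda>x. f x * g x)" "nrm (\<lambda>x. f x * g x) \<le> K * L" by auto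
  assume "0 < min m n"
  then have "AE x in nu. \<bar>f x\<bar> \<le> K" "AE x in nu. \<bar>g x\<bar> \<le> L"
    using sob_bounded[OF f] sob_bounded[OF g] by auto
  then show "AE x in nu. \<bar>f x * g x\<bar> \<le> K * L"
    by eventually_elim (simp add: abs_mult mult_mono K)
qed

text \<open>In a Leibniz term the orders on \<open>f\<close> and \<open>g\<close> add up to at most
  \<open>j\<close>, so by \<open>j < m + n\<close> the first is below \<open>m\<close> or the second
  below \<open>n\<close>: one factor is bounded, the other in L2. Each derivative doubles the number
  of terms.\<close>

lemma sob_mult:
  "sob k m K f \<Longrightarrow> sob l n L g \<Longrightarrow> j \<le> k \<Longrightarrow> j \<le> l \<Longrightarrow> j < m + n \<Longrightarrow> sob j (min m n) (2 ^ j * K * L) (\<lambda>x. f x * g x)"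
proof (induction j arbitrary: k m f l n g)
  case 0
  then show ?case using sob_mult_0[OF 0(1,2)] by simp
next
  case (Suc j)
  obtain k' l' where kl: "k = Suc k'" "l = Suc l'" "j \<le> k'" "j \<le> l'"
    using Suc.prems(3,4) by (metis Suc_le_D Suc_le_mono)
  note KL = mult_nonneg_nonneg[OF sob_nonneg[OF Suc.prems(1)] sob_nonneg[OF Suc.prems(2)]]
  note base = sob_mult_0[OF Suc.prems(1,2)]
  have mn: "0 < m + n" using Suc.prems(5) by linarith
  have le: "K * L \<le> 2 ^ Suc j * K * L"
    using mult_right_mono[of 1 "2 ^ Suc j" "K * L"] KL one_le_power[of "2::real" "Suc j"] by (simp add: mult.assoc)
  have "\<exists>v. wd i (\<lambda>x. f x * g x) v \<and> sob j (min m n - 1) (2 ^ Suc j * K * L) v" for i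
  proof -
    obtain f' where f': "wd i f f'" "sob k' (m - 1) K f'" using Suc.prems(1) kl by auto
    obtain g' where g': "wd i g g'" "sob l' (n - 1) L g'" using Suc.prems(2) kl by auto
    have a: "sob j (min m (n - 1)) (2 ^ j * K * L) (\<lambda>x. f x * g' x)"
      using Suc.prems kl by (intro Suc.IH[OF Suc.prems(1) g'(2)]) auto
    have b: "sob j (min (m - 1) n) (2 ^ j * K * L) (\<lambda>x. f' x * g x)"
      using Suc.prems kl by (intro Suc.IH[OF f'(2) Suc.prems(2)]) auto
    have e: "2 ^ Suc j * K * L = 2 ^ j * K * L + 2 ^ j * K * L" by simp
    have "sob j (min m n - 1) (2 ^ Suc j * K * L) (\<lambda>x. f x * g' x + f' x * g x)"
      unfolding e by (intro sob_add sob_mono[OF a order_refl _ order_refl] sob_mono[OF b order_refl _ order_refl]) auto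
    moreover have "wd i (\<lambda>x. f x * g x) (\<lambda>x. f x * g' x + f' x * g x)"
      by (intro wd_mult sob_good[OF Suc.prems(1)] sob_good[OF Suc.prems(2)] sob_good[OF f'(2)] sob_good[OF g'(2)] f' g' base(1) mn)
    ultimately show ?thesis by blast
  qed
  moreover have "AE x in nu. \<bar>f x * g x\<bar> \<le> 2 ^ Suc j * K * L" if "0 < min m n"
    using base(3)[OF mn that] le by (auto elim!: eventually_mono)
  ultimately show ?case using base(1,2)[OF mn] le by simp
qed

text \<open>A bootstrap on the order: the derivative is minus the product of \<open>recip D\<close>,
  \<open>recip D\<close> and \<open>D'\<close>, where the reciprocals are already controlled up to
  order \<open>j\<close>. The number of bounded orders grows along until \<open>D\<close> limits it
  to \<open>r - 1\<close>; at the last step, where \<open>j = r - 1\<close>, the condition of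
  \<open>sob_mult\<close> requires \<open>r - 2\<close> to be positive for \<open>D'\<close> to
  help.\<close>

lemma sob_recip:
  assumes D: "sob r (r - 1) K D" and r: "3 \<le> r" and c: "0 < c" "\<And>x. x \<in> slab \<Longrightarrow> c \<le> D x"
  shows "j \<le> r \<Longrightarrow> \<exists>L. sob j (min (j + 1) (r - 1)) L (recip D)"
proof (induction j)
  case 0
  have "sob 0 1 (max (1 / c) (nrm (recip D))) (recip D)"
    using slabL2_recip[OF sob_good[OF D] c] recip_bound[OF c] by (auto simp: le_max_iff_disj)
  moreover have "min (0 + 1) (r - 1) = 1" using r by simp
  ultimately show ?case by metis
next
  case (Suc j)
  let ?g = "recip D" and ?m = "min (j + 1) (r - 1)"
  have gg: "slabL2 ?g" by (rule slabL2_recip[OF sob_good[OF D] c])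
  obtain L where L: "sob j ?m L ?g" using Suc by auto
  obtain r' where r': "r = Suc r'" using r by (cases r) auto
  have "\<exists>M v. wd i ?g v \<and> sob j (min ?m (r - 2)) M v" for i
  proof -
    obtain D' where D': "wd i D D'" "sob r' (r - 1 - 1) K D'" using D r' by auto
    have "sob j (min ?m (r - 1 - 1)) (2 ^ j * L * K) (\<lambda>x. ?g x * D' x)"
      using Suc.prems r r' by (intro sob_mult[OF L D'(2)]) auto
    from sob_mult[OF L this, of j]
    have "sob j (min ?m (min ?m (r - 1 - 1))) (2 ^ j * L * (2 ^ j * L * K)) (\<lambda>x. ?g x * (?g x * D' x))"
      using Suc.prems r by (auto simp: min_def)
    then have "sob j (min ?m (r - 2)) (2 ^ j * L * (2 ^ j * L * K)) (\<lambda>x. ?g x * (?g x * D' x))"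
      by (rule sob_mono) auto
    from sob_cmult[OF this, of "-1"] wd_recip[OF sob_good[OF D] sob_good[OF D'(2)] D'(1) c]
    show ?thesis by auto
  qed
  then obtain M v where M: "\<And>i. wd i ?g (v i)" "\<And>i. sob j (min ?m (r - 2)) (M i) (v i)" by metis
  define L' where "L' = 1 / c + nrm ?g + (\<Sum>i\<in>UNIV. M i)"
  have M0: "0 \<le> M i" for i by (rule sob_nonneg[OF M(2)])
  have c0: "0 < 1 / c" using c(1) by simp
  have "0 \<le> (\<Sum>i\<in>UNIV. M i)" by (intro sum_nonneg M0)
  then have l: "1 / c \<le> L'" "nrm ?g \<le> L'"
    using c0 nrm_nonneg[of ?g] unfolding L'_def by linarith+
  have lM: "M i \<le> L'" for i
  proof -
    have "M i \<le> (\<Sum>i\<in>UNIV. M i)" by (rule member_le_sum) (simp_all add: M0)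
    then show ?thesis using c0 nrm_nonneg[of ?g] unfolding L'_def by linarith
  qed
  have "sob j (min (Suc j + 1) (r - 1) - 1) L' (v i)" for i
    using r by (intro sob_mono[OF M(2) order_refl _ lM]) auto
  moreover have "AE x in nu. \<bar>?g x\<bar> \<le> L'"
    using recip_bound[OF c] l(1) by (intro AE_I2) (meson order_trans)
  ultimately have "sob (Suc j) (min (Suc j + 1) (r - 1)) L' ?g"
    using gg l(2) M(1) by (simp del: min_Suc_Suc) blast
  then show ?case by blast
qed

section \<open>The distance function and its regularization\<close>

lemma infdist_Gam_lower:
  assumes "x \<in> slab" "x$3 \<le> 1 / 2" shows "infdist x Gam = x$3"
proof (rule antisym)
  let ?a = "x - (x$3) *\<^sub>R axis 3 1"
  have "?a \<in> Gam" by (simp add: Gam_def)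
  then have "infdist x Gam \<le> dist x ?a" by (rule infdist_le)
  also have "dist x ?a = x$3" using assms(1) by (simp add: dist_norm slab_def)
  finally show "infdist x Gam \<le> x$3" .
  have "Gam \<noteq> {}" using \<open>?a \<in> Gam\<close> by blast
  moreover have "x$3 \<le> dist x a" if "a \<in> Gam" for a
  proof -
    have "x$3 \<le> \<bar>(x - a)$3\<bar>" using that assms by (auto simp: Gam_def)
    also have "\<dots> \<le> dist x a" unfolding dist_norm by (rule component_le_norm_cart)
    finally show ?thesis .
  qed
  ultimately show "x$3 \<le> infdist x Gam" unfolding infdist_def by (auto intro: cINF_greatest)
qed

lemma infdist_Gam_upper:
  assumes "x \<in> slab" "1 / 2 \<le> x$3" shows "infdist x Gam = 1 - x$3"
proof (rule antisym)
  let ?a = "x + (1 - x$3) *\<^sub>R axis 3 1"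
  have "?a \<in> Gam" by (simp add: Gam_def)
  then have "infdist x Gam \<le> dist x ?a" by (rule infdist_le)
  also have "dist x ?a = 1 - x$3" using assms(1) by (simp add: dist_norm slab_def)
  finally show "infdist x Gam \<le> 1 - x$3" .
  have "Gam \<noteq> {}" using \<open>?a \<in> Gam\<close> by blast
  moreover have "1 - x$3 \<le> dist x a" if "a \<in> Gam" for a
  proof -
    have "1 - x$3 \<le> \<bar>(x - a)$3\<bar>" using that assms by (auto simp: Gam_def)
    also have "\<dots> \<le> dist x a" unfolding dist_norm by (rule component_le_norm_cart)
    finally show ?thesis .
  qed
  ultimately show "1 - x$3 \<le> infdist x Gam" unfolding infdist_def by (auto intro: cINF_greatest)
qed

text \<open>The cap at 1/2 keeps the two collars apart, so that in each of them the nearer face is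
  known.\<close>

lemma distance_near_bdryE:
  assumes "is_distance_near_bdry d"
  obtains e where "0 < e" "e \<le> 1 / 2"
    "\<And>x. x \<in> slab \<Longrightarrow> x$3 < e \<Longrightarrow> d x = x$3" "\<And>x. x \<in> slab \<Longrightarrow> 1 - e < x$3 \<Longrightarrow> d x = 1 - x$3"
proof -
  obtain \<epsilon> where \<epsilon>: "0 < \<epsilon>" "\<And>x. x \<in> slab \<Longrightarrow> infdist x Gam < \<epsilon> \<Longrightarrow> d x = infdist x Gam"
    using assms by (auto simp: is_distance_near_bdry_def)
  show ?thesis
  proof
    show "0 < min \<epsilon> (1 / 2)" "min \<epsilon> (1 / 2) \<le> 1 / 2" using \<epsilon> by auto
    show "d x = x$3" if "x \<in> slab" "x$3 < min \<epsilon> (1 / 2)" for x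
      using that \<epsilon>(2)[of x] infdist_Gam_lower[of x] by simp
    show "d x = 1 - x$3" if "x \<in> slab" "1 - min \<epsilon> (1 / 2) < x$3" for x
    proof -
      have "1 / 2 \<le> x$3" "1 - x$3 < \<epsilon>" using that by auto
      then show ?thesis using that \<epsilon>(2)[of x] infdist_Gam_upper[of x] by simp
    qed
  qed
qed

lemma bump_mono: "s \<le> t \<Longrightarrow> bump s \<le> bump t"
  by (auto simp: bump_eq frac_le)

text \<open>Within the slab it is positive exactly at distance less than \<open>e\<close> from one
  of the faces, thus where \<open>d\<close> degenerates but is known explicitly.\<close>

definition collar :: "real \<Rightarrow> real^3 \<Rightarrow> real" where
  "collar e x = bump (e - x$3) + bump (x$3 - (1 - e))"

text \<open>
  Chosen such that \<open>numer e / (d + collar e) = x\<^sub>3 (1 - x\<^sub>3) / d\<close>, because \<open>d = x\<^sub>3\<close> on the support of the first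
  bump and \<open>d = 1 - x\<^sub>3\<close> on that of the second; unlike \<open>d\<close>, the denominator is bounded away from \<open>0\<close>.
\<close>

definition numer :: "real \<Rightarrow> real^3 \<Rightarrow> real" where
  "numer e x = x$3 * (1 - x$3) + bump (e - x$3) * (1 - x$3) + bump (x$3 - (1 - e)) * x$3"

lemma collar_smooth: "smooth (collar e)" "periodic_on UNIV (collar e)"
  and numer_smooth: "smooth (numer e)" "periodic_on UNIV (numer e)"
  unfolding collar_def[abs_def] numer_def[abs_def]
  by (intro smooth_add smooth_mult smooth_bump smooth_diff smooth_const smooth_nth | simp add: periodic_on_def)+

lemma collar_lower_bound:
  assumes d: "\<forall>x\<in>slab. d x > 0" "continuous_on slab d" and e: "0 < e" "e \<le> 1 / 2"
  shows "\<exists>c>0. \<forall>x\<in>cell. c \<le> d x + collar e x"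
proof -
  \<comment> \<open>The box is closed, unlike the cell, so the continuous \<open>d\<close> has a
    positive minimum on it. It stops at distance \<open>e / 2\<close> from the faces, since in the
    remaining layers one bump is at least \<open>bump (e / 2)\<close>.\<close>
  let ?K = "cbox (vector [0, 0, e / 2]) (vector [1, 1, 1 - e / 2]) :: (real^3) set"
  have sub: "?K \<subseteq> slab" using e by (auto simp: mem_box_cart forall_3 slab_def)
  have "vector [0, 0, e / 2] \<in> ?K" using e by (simp add: mem_box_cart forall_3)
  then have "?K \<noteq> {}" by blast
  then obtain y where y: "y \<in> ?K" "\<And>x. x \<in> ?K \<Longrightarrow> d y \<le> d x"
    using continuous_attains_inf[of ?K d] continuous_on_subset[OF d(2) sub] by auto
  have dy: "0 < d y" using d(1) y(1) sub by blast
  define c where "c = min (bump (e / 2)) (d y)"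
  have c: "0 < c" using dy e bump_pos_iff[of "e / 2"] by (simp add: c_def)
  have "c \<le> d x + collar e x" if x: "x \<in> cell" for x
  proof -
    have xs: "x \<in> slab" using x by (simp add: cell_def)
    then have d0: "0 < d x" using d(1) by blast
    note b = bump_nonneg[of "e - x$3"] bump_nonneg[of "x$3 - (1 - e)"]
    consider "x$3 \<le> e / 2" | "1 - e / 2 \<le> x$3" | "e / 2 \<le> x$3" "x$3 \<le> 1 - e / 2" by linarith
    then show ?thesis
    proof cases
      case 1
      then have "bump (e / 2) \<le> bump (e - x$3)" by (intro bump_mono) simp
      then show ?thesis using d0 b by (simp add: c_def collar_def)
    next
      case 2
      then have "bump (e / 2) \<le> bump (x$3 - (1 - e))" by (intro bump_mono) simp
      then show ?thesis using d0 b by (simp add: c_def collar_def)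
    next
      case 3
      then have "x \<in> ?K" using x by (auto simp: mem_box_cart forall_3 cell_def)
      then have "d y \<le> d x" by (rule y(2))
      then show ?thesis using b by (simp add: c_def collar_def)
    qed
  qed
  with c show ?thesis by blast
qed

text \<open>The reciprocal rule asks for a lower bound at every point of the slab, whereas a Borel
  representative of \<open>d\<close> plus the collar satisfies it only almost everywhere.\<close>

lemma regularized_distance:
  assumes d: "\<forall>x\<in>slab. d x > 0" "continuous_on slab d" "d \<in> sobolev r" and r: "3 \<le> r" and e: "0 < e" "e \<le> 1 / 2"
  shows "\<exists>\<delta> K c. sob r (r - 1) K \<delta> \<and> 0 < c \<and> (\<forall>x\<in>slab. c \<le> \<delta> x) \<and> (AE x in nu. \<delta> x = d x + collar e x)"
proof -
  obtain c where c: "0 < c" "\<And>x. x \<in> cell \<Longrightarrow> c \<le> d x + collar e x"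
    using collar_lower_bound[OF d(1,2) e] by blast
  have "d \<in> L2" using d(3) by (simp add: sobolev_def)
  then obtain d' where d': "slabL2 d'" "AE x in nu. d x = d' x" using L2_rep by blast
  obtain Kc where Kc: "sob r (r - 1) Kc (\<lambda>x. indicator slab x * collar e x)"
    using sob_smooth[OF collar_smooth] by blast
  define \<delta>0 where "\<delta>0 x = d' x + indicator slab x * collar e x" for x
  \<comment> \<open>The maximum with \<open>c\<close> enforces the lower bound everywhere and
    changes the function only on a null set.\<close>
  define \<delta> where "\<delta> x = indicator slab x * max c (\<delta>0 x)" for x
  have Z0: "sob r (r - 1) (312 * sobolev_norm r d + Kc) \<delta>0"
    unfolding \<delta>0_def by (intro sob_add Kc sob_embedding sobolev_imp_sob[OF d(3) d'])
  have slab: "AE x in nu. x \<in> cell \<and> x \<in> slab" by (rule AE_nu_cell) (simp add: cell_def)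
  have e0: "AE x in nu. \<delta>0 x = d x + collar e x"
    using d'(2) slab by eventually_elim (simp add: \<delta>0_def)
  have ae: "AE x in nu. \<delta>0 x = \<delta> x"
    using e0 slab
  proof eventually_elim
    case (elim x)
    then have "c \<le> \<delta>0 x" using c(2)[of x] by simp
    then show ?case using elim by (simp add: \<delta>_def)
  qed
  have g0: "slabL2 \<delta>0" by (rule sob_good[OF Z0])
  note [measurable] = slabL2_borel[OF g0]
  have "\<delta> \<in> borel_measurable borel" unfolding \<delta>_def[abs_def] by measurable
  moreover from this have "sqint \<delta>"
    using ae by (intro sqint_cong_AE[OF slabL2_sq[OF g0], of _ 1]) (auto elim: eventually_mono)
  ultimately have "slabL2 \<delta>"
    using slabL2_per[OF g0] by (simp add: slabL2_def periodic_on_def \<delta>_def indicator_def)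
  from sob_cong_AE[OF Z0 this ae] have "sob r (r - 1) (312 * sobolev_norm r d + Kc) \<delta>" .
  moreover have "\<forall>x\<in>slab. c \<le> \<delta> x" by (simp add: \<delta>_def)
  moreover have "AE x in nu. \<delta> x = d x + collar e x" using e0 ae by eventually_elim simp
  ultimately show ?thesis using c(1) by blast
qed

text \<open>Both one-sided quotients are averages of the same vertical derivative \<open>u3\<close>.
  Each average costs Hardy's factor 2, hence the 4.\<close>

lemma hardy_quotient:
  assumes u: "u \<in> sobolev (Suc k)" "u \<in> H10"
  shows "\<exists>w. sob k 0 (4 * sobolev_norm (Suc k) u) w \<and> (AE x in nu. x$3 * (1 - x$3) * w x = u x)"
proof -
  have "u \<in> L2" using u(1) by (simp add: sobolev_def)
  then obtain u' where u': "slabL2 u'" "AE x in nu. u x = u' x" using L2_rep by blast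
  let ?N = "sobolev_norm (Suc k) u"
  obtain u3 where u3: "wd 3 u' u3" "sob k 0 ?N u3" using sobolev_imp_sob[OF u(1) u'] by auto
  have tr: "has_trace u (\<lambda>_. 0)" using u(2) by (simp add: H10_def)
  let ?w = "\<lambda>x. avg 0 0 u3 x + (-1) * avg 0 1 u3 x"
  have "sob k 0 (2 * ?N + \<bar>-1\<bar> * (2 * ?N)) ?w"
    by (intro sob_add sob_cmult sob_avg u3) auto
  moreover have "AE x in nu. x$3 * (1 - x$3) * ?w x = u x"
    using trace_avg[OF tr u' u3(1) sob_good[OF u3(2)], of 0] trace_avg[OF tr u' u3(1) sob_good[OF u3(2)], of 1] u'(2)
  proof simp
    assume "AE x in nu. u' x = x$3 * avg 0 0 u3 x" "AE x in nu. u' x = (x$3 - 1) * avg 0 1 u3 x" "AE x in nu. u x = u' x"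
    then show "AE x in nu. x$3 * (1 - x$3) * (avg 0 0 u3 x - avg 0 1 u3 x) = u x"
    proof eventually_elim
      case (elim x)
      have "x$3 * (1 - x$3) * (avg 0 0 u3 x - avg 0 1 u3 x)
        = (1 - x$3) * (x$3 * avg 0 0 u3 x) + x$3 * ((x$3 - 1) * avg 0 1 u3 x)" by (simp add: algebra_simps)
      also have "\<dots> = (1 - x$3) * u' x + x$3 * u' x" by (simp only: elim(1)[symmetric] elim(2)[symmetric])
      finally show ?case using elim(3) by (simp add: algebra_simps)
    qed
  qed
  ultimately show ?thesis by auto
qed

lemma weight_identity:
  assumes x: "x \<in> slab" and e: "0 < e"
    and d: "x$3 < e \<Longrightarrow> d x = x$3" "1 - e < x$3 \<Longrightarrow> d x = 1 - x$3"
  shows "numer e x * d x = x$3 * (1 - x$3) * (d x + collar e x)"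
proof -
  have a: "bump (e - x$3) * d x = bump (e - x$3) * x$3"
    using d(1) by (cases "x$3 < e") (auto simp: bump_eq)
  have b: "bump (x$3 - (1 - e)) * d x = bump (x$3 - (1 - e)) * (1 - x$3)"
    using d(2) by (cases "1 - e < x$3") (auto simp: bump_eq)
  have "numer e x * d x = x$3 * (1 - x$3) * d x + (1 - x$3) * (bump (e - x$3) * d x) + x$3 * (bump (x$3 - (1 - e)) * d x)"
    by (simp add: numer_def algebra_simps)
  also have "\<dots> = x$3 * (1 - x$3) * (d x + collar e x)"
    unfolding a b by (simp add: collar_def algebra_simps)
  finally show ?thesis .
qed

text \<open>The claim concerns the given \<open>u\<close> and \<open>d\<close>, not representatives:
  measurability and periodicity come from them, and only square integrability is taken from
  \<open>W\<close>.\<close>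

lemma quotient_L2:
  assumes u: "u \<in> L2" and d: "d \<in> L2" and W: "slabL2 W" "AE x in nu. u x / d x = W x"
  shows "(\<lambda>x. u x / d x) \<in> L2"
proof -
  have m: "u \<in> borel_measurable (lebesgue_on cell)" "d \<in> borel_measurable (lebesgue_on cell)"
    using u d by (auto simp: L2_def)
  then have q: "(\<lambda>x. u x / d x) \<in> borel_measurable (lebesgue_on cell)" by simp
  have "integrable (lebesgue_on cell) (\<lambda>x. (u x / d x)\<^sup>2)"
  proof (subst integral_cell_AE(2))
    show "(\<lambda>x. (u x / d x)\<^sup>2) \<in> borel_measurable (lebesgue_on cell)" using q by (rule borel_measurable_power)
    show "(\<lambda>x. (W x)\<^sup>2) \<in> borel_measurable borel" using slabL2_borel[OF W(1)] by simp
    show "AE x in nu. (u x / d x)\<^sup>2 = (W x)\<^sup>2" using W(2) by eventually_elim simp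
    show "integrable nu (\<lambda>x. (W x)\<^sup>2)" using slabL2_sq[OF W(1)] by (simp add: sqint_def)
  qed
  then show ?thesis using q u d by (simp add: L2_def periodic_on_def)
qed

theorem lemma3p1:
  fixes s :: nat and d :: "real^3 \<Rightarrow> real"
  assumes "s \<ge> 1"
    and "\<forall>x\<in>slab. d x > 0"
    and "d \<in> sobolev (max (s - 1) 3)"
    and "continuous_on slab d"
    and "is_distance_near_bdry d"
  shows "\<exists>C::real. \<forall>u \<in> sobolev s \<inter> H10.
           (\<lambda>x. u x / d x) \<in> sobolev (s - 1) \<and>
           sobolev_norm (s - 1) (\<lambda>x. u x / d x) \<le> C * sobolev_norm s u"
proof -
  define k where "k = s - 1"
  define r where "r = max k 3"
  have s: "s = Suc k" using assms(1) by (simp add: k_def)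
  have r: "3 \<le> r" "k \<le> r" by (auto simp: r_def)
  have dr: "d \<in> sobolev r" using assms(3) by (simp add: r_def k_def)
  obtain e where e: "0 < e" "e \<le> 1 / 2"
    and near: "\<And>x. x \<in> slab \<Longrightarrow> x$3 < e \<Longrightarrow> d x = x$3" "\<And>x. x \<in> slab \<Longrightarrow> 1 - e < x$3 \<Longrightarrow> d x = 1 - x$3"
    using distance_near_bdryE[OF assms(5)] by blast
  obtain \<delta> K c where \<delta>: "sob r (r - 1) K \<delta>" "0 < c" "\<And>x. x \<in> slab \<Longrightarrow> c \<le> \<delta> x" "AE x in nu. \<delta> x = d x + collar e x"
    using regularized_distance[OF assms(2,4) dr r(1) e] by blast
  obtain L where L: "sob r (min (r + 1) (r - 1)) L (recip \<delta>)" using sob_recip[OF \<delta>(1) r(1) \<delta>(2,3) order_refl] by blast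
  obtain P where P: "sob r (r - 1) P (\<lambda>x. indicator slab x * numer e x)" using sob_smooth[OF numer_smooth] by blast
  define g where "g x = (indicator slab x * numer e x) * recip \<delta> x" for x
  define G where "G = 2 ^ r * P * L"
  \<comment> \<open>Both factors have all derivatives of order below \<open>r - 1\<close> bounded,
    and the product rule at order \<open>r\<close> needs \<open>r < 2 * (r - 1)\<close>, which holds
    for \<open>r\<close> at least 3.\<close>
  have g: "sob r (r - 1) G g"
    unfolding g_def G_def using r by (intro sob_mono[OF sob_mult[OF P L, of r]]) auto
  \<comment> \<open>The factors are the number of derivatives in the norm, the Leibniz terms, the
    embedding constant 312, the 4 from Hardy's inequality, and \<open>G\<close>, which depends on
    \<open>d\<close> and \<open>r\<close> but not on \<open>u\<close>.\<close>
  define C where "C = sqrt (real (card {\<alpha>. mi_order \<alpha> \<le> k})) * (2 ^ k * (312 * 4) * G)"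
  have "(\<lambda>x. u x / d x) \<in> sobolev k \<and> sobolev_norm k (\<lambda>x. u x / d x) \<le> C * sobolev_norm s u"
    if u: "u \<in> sobolev s" "u \<in> H10" for u
  proof -
    obtain w where w: "sob k 0 (4 * sobolev_norm s u) w" "AE x in nu. x$3 * (1 - x$3) * w x = u x"
      using hardy_quotient[of u k] u s by auto
    let ?W = "\<lambda>x. w x * g x"
    \<comment> \<open>The embedding bounds the derivatives of \<open>w\<close> of order below
      \<open>k - 1\<close>; together with the \<open>r - 1\<close> bounded orders of
      \<open>g\<close> this exceeds \<open>k\<close>. For \<open>k = 0\<close> the truncated
      \<open>k - 1\<close> is 0 and \<open>g\<close> alone suffices.\<close>
    have W: "sob k (min (k - 1) (r - 1)) (2 ^ k * (312 * (4 * sobolev_norm s u)) * G) ?W"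
      using r by (intro sob_mult[OF sob_embedding[OF w(1)] g]) auto
    have ae: "AE x in nu. u x / d x = ?W x"
    proof -
      have "AE x in nu. x \<in> slab" by (rule AE_nu_cell) (simp add: cell_def)
      with w(2) \<delta>(4) show ?thesis
      proof eventually_elim
        case (elim x)
        have d0: "0 < d x" using assms(2) elim(3) by blast
        have \<delta>0: "0 < d x + collar e x" using \<delta>(2) \<delta>(3)[OF elim(3)] elim(2) by simp
        have "numer e x / (d x + collar e x) = x$3 * (1 - x$3) / d x"
          using weight_identity[of x e d, OF elim(3) e(1) near[OF elim(3)]] d0 \<delta>0 by (simp add: frac_eq_eq)
        then have "?W x = w x * (x$3 * (1 - x$3) / d x)"
          using elim by (simp add: g_def recip_def)
        also have "\<dots> = u x / d x" using elim(1) by (simp add: mult_ac)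
        finally show ?case by simp
      qed
    qed
    have "(\<lambda>x. u x / d x) \<in> L2"
      using u(1) dr by (intro quotient_L2[OF _ _ sob_good[OF W] ae]) (auto simp: sobolev_def)
    from sob_imp_sobolev[OF this ae W] show ?thesis by (simp add: C_def mult_ac)
  qed
  then show ?thesis unfolding k_def[symmetric] by blast
qed

end
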